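(* Let $n$ be a positive integer, let $M\in\mathbb{R}^{n\times n}$ be a nonzero real symmetric matrix, let $G\sim N(0,I_n)$, and let $\delta=\frac{\operatorname{tr}(M^3)}{\|M\|_{\mathrm F}^3}$. Then $|\delta|\le1$. Let $Z_\delta$ be the centered Gamma difference with parameter $\delta$ (defined in the context). For every function $f\in C^2(\mathbb{R})$ such that $f''$ is convex and such that there are constants $C>0$ and $m>0$ with $|f(x)|+|f'(x)|+|f''(x)|\le C(1+|x|^m)$ for all $x\in\mathbb{R}$, \[ \mathbb{E} f\left(\frac{G^{\mathsf T}MG-\operatorname{tr}M}{\|M\|_{\mathrm F}}\right)\le \mathbb{E} f(Z_\delta). \] In particular, for every real $p\ge3$, \[ \mathbb{E}\left|G^{\mathsf T}MG-\operatorname{tr}M\right|^p\le \|M\|_{\mathrm F}^p\,\mathbb{E}|Z_\delta|^p. \] The variable $\|M\|_{\mathrm F}Z_\delta$ has the same mean, variance, and third centered moment as $G^{\mathsf T}MG-\operatorname{tr}M$.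
   Context: For a real symmetric matrix $M$, $\|M\|_{\mathrm F}=\sqrt{\operatorname{tr}(M^2)}$. $N(0,I_n)$ is the standard Gaussian distribution on $\mathbb{R}^n$. $\operatorname{Gamma}(\alpha,\beta)$ denotes the Gamma distribution with shape $\alpha$ and rate $\beta$; a Gamma variable with shape zero is understood to be identically zero. For $-1\le\delta\le1$, let $A$ and $B$ be independent with $A\sim\operatorname{Gamma}(\tfrac14(1+\delta),\tfrac12)$ and $B\sim\operatorname{Gamma}(\tfrac14(1-\delta),\tfrac12)$, and define $Z_\delta=A-B-\delta$. *)

theory Defs
  imports "HOL-Probability.Probability"
begin

text \<open>Only meant for symmetric matrices.\<close>

definition frobenius_norm :: "real^'n^'n \<Rightarrow> real" where
  "frobenius_norm M = sqrt (trace (M ** M))"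

definition gamma_density :: "real \<Rightarrow> real \<Rightarrow> real \<Rightarrow> real" where
  "gamma_density a b x =
     (if x > 0 then b powr a / Gamma a * x powr (a - 1) * exp (- b * x) else 0)"

text \<open>The Gamma law with shape \<open>a \<ge> 0\<close> and rate \<open>b > 0\<close>; for shape zero it is the
  point mass at the origin.\<close>

definition gamma_distribution :: "real \<Rightarrow> real \<Rightarrow> real measure" where
  "gamma_distribution a b =
     (if a = 0 then return borel 0 else density lborel (\<lambda>x. ennreal (gamma_density a b x)))"

lemma prob_space_gamma_distribution:
  assumes "a \<ge> 0" "b > 0"
  shows "prob_space (gamma_distribution a b)"
proof (cases "a = 0")
  case True
  then show ?thesis
    by (simp add: gamma_distribution_def prob_space_return)
next
  case False
  with assms have a: "a > 0" by simp
  define g where "g = (\<lambda>t::real. ennreal (t powr (a - 1) / exp t * indicator {0..} t))"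
  have "((\<lambda>t. if t \<in> {0..} then t powr (a - 1) / exp t else 0) has_integral Gamma a) UNIV"
    using Gamma_integral_real[OF a] by (subst has_integral_restrict_UNIV)
  then have "((\<lambda>t. t powr (a - 1) / exp t * indicator {0..} t) has_integral Gamma a) UNIV"
    by (rule has_integral_eq[rotated]) (auto simp: indicator_def)
  then have g: "(\<integral>\<^sup>+ t. g t \<partial>lborel) = ennreal (Gamma a)"
    unfolding g_def by (intro nn_integral_has_integral_lborel) auto
  have gm: "g \<in> borel_measurable borel"
    unfolding g_def by measurable
  have pos: "Gamma a > 0" using a by (rule Gamma_real_pos)
  have "(\<integral>\<^sup>+ x. ennreal (gamma_density a b x) \<partial>lborel)
      = (\<integral>\<^sup>+ x. ennreal (b / Gamma a) * g (0 + b * x) \<partial>lborel)"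
  proof (rule nn_integral_cong_AE)
    have "AE x in lborel. x \<noteq> (0::real)" by (rule AE_lborel_singleton)
    then show "AE x in lborel. ennreal (gamma_density a b x) = ennreal (b / Gamma a) * g (0 + b * x)"
    proof eventually_elim
      case (elim x)
      show ?case
      proof (cases "x > 0")
        case True
        have "b powr a = b * b powr (a - 1)"
          using assms by (simp add: powr_diff)
        with True assms pos show ?thesis
          by (simp add: gamma_density_def g_def ennreal_mult[symmetric] powr_mult exp_minus
              field_simps)
      next
        case False
        with elim assms have "b * x < 0" by (simp add: mult_pos_neg)
        with False show ?thesis by (simp add: gamma_density_def g_def)
      qed
    qed
  qed
  also have "\<dots> = ennreal (b / Gamma a) * (\<integral>\<^sup>+ x. g (0 + b * x) \<partial>lborel)"
    by (intro nn_integral_cmult) (simp, intro measurable_compose[OF _ gm], simp)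
  also have "\<dots> = ennreal (1 / Gamma a) * (ennreal \<bar>b\<bar> * (\<integral>\<^sup>+ x. g (0 + b * x) \<partial>lborel))"
    using assms pos by (simp add: mult.assoc[symmetric] ennreal_mult[symmetric])
  also have "\<dots> = ennreal (1 / Gamma a) * ennreal (Gamma a)"
    using nn_integral_real_affine[OF gm, of b 0] assms g by simp
  also have "\<dots> = 1"
    using pos by (simp add: ennreal_mult[symmetric])
  finally show ?thesis
    using False by (intro prob_spaceI)
      (simp add: gamma_distribution_def emeasure_density gamma_density_def[abs_def])
qed

end

theory Submission
  imports Defs
begin

text \<open>
  Diagonalising \<open>M\<close> turns the normalised quadratic form into \<open>\<Sum> l i * ((Y i)\<^sup>2 - 1)\<close> with independent
  standard normals \<open>Y i\<close>, \<open>\<bar>l i\<bar> \<le> 1\<close>, \<open>\<Sum> (l i)\<^sup>2 = 1\<close> and \<open>\<Sum> (l i)\<^sup>3 = \<delta>\<close>. The order given by all test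
  functions with convex second derivative is closed under convolution, and Gamma shapes add up, so
  it suffices to compare one summand \<open>l * (Y\<^sup>2 - 1)\<close> with a centered difference of Gamma variables of
  shapes \<open>l\<^sup>2 * (1 + l) / 4\<close> and \<open>l\<^sup>2 * (1 - l) / 4\<close>. Both laws belong to convolution semigroups (the square
  of a standard normal is Gamma distributed with shape \<open>1 / 2\<close>), so it is enough to compare their
  generators. Both generators average a function of the jump size \<open>v\<close> over the same exponential law,
  and for fixed \<open>v\<close> the required inequality says that \<open>t \<mapsto> f (w + t * v)\<close> at \<open>t = l\<close> lies below its cubic
  Hermite interpolant at the nodes \<open>-1, 0, 0, 1\<close>, which holds because \<open>f''\<close> is convex. Polynomials of
  degree at most three are test functions together with their negatives, so the first three moments
  agree.
\<close>

section \<open>Polynomial growth and moments\<close>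

text \<open>The constants come from the cubic Hermite interpolant. Evaluated at \<open>l\<close>
  with nodes -1, 0, 0, 1, it gives the values at 1 and -1 the weights l^2 (1 + l) / 2 and l^2 (1 -
  l) / 2, and the derivative at 0 the weight l - l^3. The first two become Gamma shapes, halved
  because the squared normal has shape 1/2; the third becomes a drift. The shapes are linear in l^2
  and l^3, which is why the final law depends on the eigenvalues only through \<delta>.

  The jump measure exp(-x/2)/x dx of the Gamma semigroup has infinite mass near 0. Size biasing
  avoids it: x gam_a(dx) = 2a gam_(a+1)(dx). An increment f(w + x) - f(w), written as x times an
  average of f', is thus integrated against shape a + 1, and as a tends to 0 only the exponential
  law of shape 1 remains.

  Test functions are unbounded, so errors cannot be measured in the supremum norm. They carry
  weights (1 + |x|)^q, which are submultiplicative under addition and so pass through convolutions.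
  The comparison of semigroups then needs only one-step expansions with error of order h^2.\<close>

definition poly_bounded :: "(real \<Rightarrow> real) \<Rightarrow> bool" where
  "poly_bounded g \<longleftrightarrow> (\<exists>C q. \<forall>x. \<bar>g x\<bar> \<le> C * (1 + \<bar>x\<bar>) ^ q)"

text \<open>The product of the two weights dominates the weight at every point between
  \<open>x\<close> and \<open>y\<close>, as the mean value theorem requires, and it leaves a
  polynomial weight in one variable once the other is fixed.\<close>

definition poly_lipschitz :: "(real \<Rightarrow> real) \<Rightarrow> bool" where
  "poly_lipschitz g \<longleftrightarrow>
     (\<exists>C q. \<forall>x y. \<bar>g x - g y\<bar> \<le> C * \<bar>x - y\<bar> * ((1 + \<bar>x\<bar>) ^ q * (1 + \<bar>y\<bar>) ^ q))"

definition has_moments :: "real measure \<Rightarrow> bool" where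
  "has_moments \<mu> \<longleftrightarrow>
     prob_space \<mu> \<and> sets \<mu> = sets borel \<and> (\<forall>q. integrable \<mu> (\<lambda>x. (1 + \<bar>x\<bar>) ^ q))"

lemma weight_ge_1: "1 \<le> (1 + \<bar>x :: real\<bar>) ^ q"
  by (rule one_le_power) simp

lemma weight_mono: "p \<le> q \<Longrightarrow> (1 + \<bar>x :: real\<bar>) ^ p \<le> (1 + \<bar>x\<bar>) ^ q"
  by (rule power_increasing) auto

lemma weight2_mono:
  assumes "p \<le> q" "0 \<le> c"
  shows "c * ((1 + \<bar>x :: real\<bar>) ^ p * (1 + \<bar>y :: real\<bar>) ^ p) \<le> c * ((1 + \<bar>x\<bar>) ^ q * (1 + \<bar>y\<bar>) ^ q)"
  unfolding power_mult_distrib[symmetric]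
proof (intro mult_left_mono power_increasing assms)
  show "1 \<le> (1 + \<bar>x\<bar>) * (1 + \<bar>y\<bar>)" by (simp add: algebra_simps)
qed

text \<open>From 1 + |x + y| \<le> (1 + |x|) (1 + |y|). This submultiplicativity separates the
  factors of a convolution in every estimate below.\<close>

lemma weight_add: "(1 + \<bar>x + y :: real\<bar>) ^ q \<le> (1 + \<bar>x\<bar>) ^ q * (1 + \<bar>y\<bar>) ^ q"
proof -
  have "1 + \<bar>x + y\<bar> \<le> (1 + \<bar>x\<bar>) * (1 + \<bar>y\<bar>)"
    using abs_triangle_ineq[of x y] mult_nonneg_nonneg[of "\<bar>x\<bar>" "\<bar>y\<bar>"] unfolding distrib_left distrib_right by linarith
  then show ?thesis
    unfolding power_mult_distrib[symmetric] by (intro power_mono) auto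
qed

lemma poly_boundedE:
  assumes "poly_bounded g"
  obtains C q where "C \<ge> 0" "\<And>x. \<bar>g x\<bar> \<le> C * (1 + \<bar>x\<bar>) ^ q"
proof -
  obtain C q where C: "\<And>x. \<bar>g x\<bar> \<le> C * (1 + \<bar>x\<bar>) ^ q"
    using assms unfolding poly_bounded_def by blast
  have "0 \<le> C" using C[of 0] by simp
  with C show thesis using that by blast
qed

lemma poly_lipschitzE:
  assumes "poly_lipschitz g"
  obtains C q where "C \<ge> 0"
    "\<And>x y. \<bar>g x - g y\<bar> \<le> C * \<bar>x - y\<bar> * ((1 + \<bar>x\<bar>) ^ q * (1 + \<bar>y\<bar>) ^ q)"
proof -
  obtain C q where C: "\<And>x y. \<bar>g x - g y\<bar> \<le> C * \<bar>x - y\<bar> * ((1 + \<bar>x\<bar>) ^ q * (1 + \<bar>y\<bar>) ^ q)"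
    using assms unfolding poly_lipschitz_def by blast
  have "0 \<le> C * 2 ^ q" using C[of 0 1] by simp
  then have "0 \<le> C" using zero_less_power[of "2::real" q] by (auto simp: zero_le_mult_iff simp del: zero_less_power)
  with C show thesis using that by blast
qed

lemma poly_lipschitzI:
  "(\<And>x y. \<bar>g x - g y\<bar> \<le> C * \<bar>x - y\<bar> * ((1 + \<bar>x\<bar>) ^ q * (1 + \<bar>y\<bar>) ^ q)) \<Longrightarrow> poly_lipschitz g"
  unfolding poly_lipschitz_def by (intro exI allI)

lemma poly_lipschitz_imp_poly_bounded:
  assumes "poly_lipschitz g" shows "poly_bounded g"
proof -
  obtain C q where "C \<ge> 0" and
    C: "\<And>x y. \<bar>g x - g y\<bar> \<le> C * \<bar>x - y\<bar> * ((1 + \<bar>x\<bar>) ^ q * (1 + \<bar>y\<bar>) ^ q)"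
    using assms by (rule poly_lipschitzE) blast
  have "\<bar>g x\<bar> \<le> (\<bar>g 0\<bar> + C) * (1 + \<bar>x\<bar>) ^ Suc q" for x
  proof -
    have "\<bar>g x\<bar> \<le> \<bar>g 0\<bar> + C * \<bar>x\<bar> * (1 + \<bar>x\<bar>) ^ q"
      using C[of x 0] by simp
    also have "C * \<bar>x\<bar> * (1 + \<bar>x\<bar>) ^ q \<le> C * (1 + \<bar>x\<bar>) ^ Suc q"
      using \<open>C \<ge> 0\<close> by (simp add: mult.assoc mult_left_mono mult_right_mono)
    also have "\<bar>g 0\<bar> \<le> \<bar>g 0\<bar> * (1 + \<bar>x\<bar>) ^ Suc q"
      using weight_ge_1[of x "Suc q"] mult_left_mono[of 1 _ "\<bar>g 0\<bar>"] by fastforce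
    finally show ?thesis by (simp add: algebra_simps)
  qed
  then show ?thesis unfolding poly_bounded_def by blast
qed

lemma poly_lipschitz_continuous:
  assumes "poly_lipschitz g" shows "continuous_on UNIV g"
proof -
  obtain C q where "C \<ge> 0" and
    C: "\<And>x y. \<bar>g x - g y\<bar> \<le> C * \<bar>x - y\<bar> * ((1 + \<bar>x\<bar>) ^ q * (1 + \<bar>y\<bar>) ^ q)"
    using assms by (rule poly_lipschitzE) blast
  have "(g \<longlongrightarrow> g x) (at x)" for x
  proof (rule LIM_zero_cancel, rule Lim_null_comparison)
    show "eventually (\<lambda>y. norm (g y - g x) \<le> C * \<bar>y - x\<bar> * ((1 + \<bar>y\<bar>) ^ q * (1 + \<bar>x\<bar>) ^ q)) (at x)"
      using C by (auto intro!: always_eventually)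
    have "((\<lambda>y. C * \<bar>y - x\<bar> * ((1 + \<bar>y\<bar>) ^ q * (1 + \<bar>x\<bar>) ^ q)) \<longlongrightarrow>
        C * \<bar>x - x\<bar> * ((1 + \<bar>x\<bar>) ^ q * (1 + \<bar>x\<bar>) ^ q)) (at x)"
      by (intro tendsto_intros)
    then show "((\<lambda>y. C * \<bar>y - x\<bar> * ((1 + \<bar>y\<bar>) ^ q * (1 + \<bar>x\<bar>) ^ q)) \<longlongrightarrow> 0) (at x)"
      by simp
  qed
  then show ?thesis by (simp add: continuous_on_def)
qed

lemma poly_lipschitz_measurable [measurable_dest]:
  "poly_lipschitz g \<Longrightarrow> g \<in> borel_measurable borel"
  by (intro borel_measurable_continuous_onI poly_lipschitz_continuous)

lemma poly_lipschitz_cmult: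
  assumes "poly_lipschitz f" shows "poly_lipschitz (\<lambda>x. c * f x)"
proof -
  obtain C q where C: "\<And>x y. \<bar>f x - f y\<bar> \<le> C * \<bar>x - y\<bar> * ((1 + \<bar>x\<bar>) ^ q * (1 + \<bar>y\<bar>) ^ q)"
    using assms by (rule poly_lipschitzE) blast
  have "\<bar>c * f x - c * f y\<bar> \<le> (\<bar>c\<bar> * C) * \<bar>x - y\<bar> * ((1 + \<bar>x\<bar>) ^ q * (1 + \<bar>y\<bar>) ^ q)" for x y
  proof -
    have "\<bar>c * f x - c * f y\<bar> = \<bar>c\<bar> * \<bar>f x - f y\<bar>"
      by (simp add: right_diff_distrib[symmetric] abs_mult)
    also have "\<dots> \<le> \<bar>c\<bar> * (C * \<bar>x - y\<bar> * ((1 + \<bar>x\<bar>) ^ q * (1 + \<bar>y\<bar>) ^ q))"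
      by (intro mult_left_mono C) simp
    finally show ?thesis by (simp only: mult.assoc)
  qed
  then show ?thesis by (rule poly_lipschitzI)
qed

lemma poly_lipschitz_add:
  assumes "poly_lipschitz f" "poly_lipschitz g" shows "poly_lipschitz (\<lambda>x. f x + g x)"
proof -
  obtain C p where "C \<ge> 0" and
    C: "\<And>x y. \<bar>f x - f y\<bar> \<le> C * \<bar>x - y\<bar> * ((1 + \<bar>x\<bar>) ^ p * (1 + \<bar>y\<bar>) ^ p)"
    using assms(1) by (rule poly_lipschitzE) blast
  obtain D q where "D \<ge> 0" and
    D: "\<And>x y. \<bar>g x - g y\<bar> \<le> D * \<bar>x - y\<bar> * ((1 + \<bar>x\<bar>) ^ q * (1 + \<bar>y\<bar>) ^ q)"
    using assms(2) by (rule poly_lipschitzE) blast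
  define r where "r = max p q"
  have "\<bar>(f x + g x) - (f y + g y)\<bar> \<le> (C + D) * \<bar>x - y\<bar> * ((1 + \<bar>x\<bar>) ^ r * (1 + \<bar>y\<bar>) ^ r)" for x y
  proof -
    have "\<bar>(f x + g x) - (f y + g y)\<bar> \<le> \<bar>f x - f y\<bar> + \<bar>g x - g y\<bar>" by linarith
    also have "\<bar>f x - f y\<bar> \<le> C * \<bar>x - y\<bar> * ((1 + \<bar>x\<bar>) ^ r * (1 + \<bar>y\<bar>) ^ r)"
      using \<open>C \<ge> 0\<close> by (intro order.trans[OF C] weight2_mono) (auto simp: r_def)
    also have "\<bar>g x - g y\<bar> \<le> D * \<bar>x - y\<bar> * ((1 + \<bar>x\<bar>) ^ r * (1 + \<bar>y\<bar>) ^ r)"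
      using \<open>D \<ge> 0\<close> by (intro order.trans[OF D] weight2_mono) (auto simp: r_def)
    finally show ?thesis by (simp add: algebra_simps)
  qed
  then show ?thesis by (rule poly_lipschitzI)
qed

lemma poly_lipschitz_derivative:
  assumes f: "\<And>x. (f has_real_derivative f' x) (at x)" and f': "poly_bounded f'"
  shows "poly_lipschitz f"
proof -
  obtain C q where "C \<ge> 0" and C: "\<And>x. \<bar>f' x\<bar> \<le> C * (1 + \<bar>x\<bar>) ^ q"
    using f' by (rule poly_boundedE) blast
  have aux: "\<bar>f y - f x\<bar> \<le> C * \<bar>y - x\<bar> * ((1 + \<bar>x\<bar>) ^ q * (1 + \<bar>y\<bar>) ^ q)" if xy: "x < y" for x y
  proof -
    obtain z where z: "x < z" "z < y" "f y - f x = (y - x) * f' z"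
      using MVT2[OF xy f] by blast
    have "\<bar>f' z\<bar> \<le> C * (1 + \<bar>z\<bar>) ^ q" by (rule C)
    also have "(1 + \<bar>z\<bar>) ^ q \<le> (1 + \<bar>x\<bar>) ^ q * (1 + \<bar>y\<bar>) ^ q"
    proof -
      have "1 + \<bar>z\<bar> \<le> 1 + max \<bar>x\<bar> \<bar>y\<bar>" using z by auto
      also have "\<dots> \<le> (1 + \<bar>x\<bar>) * (1 + \<bar>y\<bar>)" by (simp add: algebra_simps max_def)
      finally show ?thesis unfolding power_mult_distrib[symmetric] by (intro power_mono) auto
    qed
    finally have "\<bar>f' z\<bar> \<le> C * ((1 + \<bar>x\<bar>) ^ q * (1 + \<bar>y\<bar>) ^ q)"
      using \<open>C \<ge> 0\<close> by (simp add: mult_left_mono)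
    then have "\<bar>y - x\<bar> * \<bar>f' z\<bar> \<le> \<bar>y - x\<bar> * (C * ((1 + \<bar>x\<bar>) ^ q * (1 + \<bar>y\<bar>) ^ q))"
      by (rule mult_left_mono) simp
    then show ?thesis unfolding z(3) abs_mult by (simp add: mult_ac)
  qed
  have "\<bar>f x - f y\<bar> \<le> C * \<bar>x - y\<bar> * ((1 + \<bar>x\<bar>) ^ q * (1 + \<bar>y\<bar>) ^ q)" for x y
    using aux[of x y] aux[of y x]
    by (cases x y rule: linorder_cases) (simp_all add: abs_minus_commute mult_ac)
  then show ?thesis by (rule poly_lipschitzI)
qed

lemma poly_bounded_shift:
  assumes "poly_bounded f" shows "poly_bounded (\<lambda>x. f (w + x))"
proof -
  obtain B k where "B \<ge> 0" and B: "\<And>x. \<bar>f x\<bar> \<le> B * (1 + \<bar>x\<bar>) ^ k"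
    using assms by (rule poly_boundedE) blast
  have "\<bar>f (w + x)\<bar> \<le> (B * (1 + \<bar>w\<bar>) ^ k) * (1 + \<bar>x\<bar>) ^ k" for x
    using order.trans[OF B mult_left_mono[OF weight_add \<open>B \<ge> 0\<close>], of w x] by (simp add: mult_ac)
  then show ?thesis unfolding poly_bounded_def by blast
qed

context
  fixes \<mu> assumes \<mu>: "has_moments \<mu>"
begin

lemma has_moments_prob_space: "prob_space \<mu>"
  and has_moments_sets [measurable_cong]: "sets \<mu> = sets borel"
  and integrable_weight: "integrable \<mu> (\<lambda>x. (1 + \<bar>x\<bar>) ^ q)"
  using \<mu> by (auto simp: has_moments_def)

lemma integrable_poly_bounded:
  assumes [measurable]: "g \<in> borel_measurable borel" and g: "poly_bounded g"
  shows "integrable \<mu> (\<lambda>x. g (w + x))"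
proof -
  obtain C q where "C \<ge> 0" and C: "\<And>x. \<bar>g x\<bar> \<le> C * (1 + \<bar>x\<bar>) ^ q"
    using g by (rule poly_boundedE) blast
  have "\<bar>g (w + x)\<bar> \<le> C * ((1 + \<bar>w\<bar>) ^ q * (1 + \<bar>x\<bar>) ^ q)" for x
    using C[of "w + x"] mult_left_mono[OF weight_add[of w x q] \<open>C \<ge> 0\<close>] by linarith
  then have "AE x in \<mu>. norm (g (w + x)) \<le> norm (C * ((1 + \<bar>w\<bar>) ^ q * (1 + \<bar>x\<bar>) ^ q))"
    using \<open>C \<ge> 0\<close> by (intro AE_I2) (simp add: abs_mult power_abs)
  moreover have "integrable \<mu> (\<lambda>x. C * ((1 + \<bar>w\<bar>) ^ q * (1 + \<bar>x\<bar>) ^ q))"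
    by (intro integrable_mult_right integrable_weight)
  moreover have "(\<lambda>x. g (w + x)) \<in> borel_measurable \<mu>"
    by measurable
  ultimately show ?thesis
    by (blast intro: Bochner_Integration.integrable_bound)
qed

end

lemma poly_bounded_weight: "poly_bounded (\<lambda>x. (1 + \<bar>x\<bar>) ^ q)"
  unfolding poly_bounded_def by (rule exI[of _ 1], rule exI[of _ q]) simp

lemma poly_bounded_abs_weight: "poly_bounded (\<lambda>x. \<bar>x\<bar> * (1 + \<bar>x\<bar>) ^ q)"
  unfolding poly_bounded_def
  by (rule exI[of _ 1], rule exI[of _ "Suc q"]) (auto simp: abs_mult intro!: mult_right_mono)

section \<open>Convolutions of laws with all moments\<close>

text \<open>A product of two weights dominates \<open>g (x + y)\<close>, and it is integrable on the
  product space because each factor is a moment. This domination licenses Fubini.\<close>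

lemma
  assumes \<mu>: "has_moments \<mu>" and \<nu>: "has_moments \<nu>"
    and [measurable]: "g \<in> borel_measurable borel" and g: "poly_bounded g"
  shows integral_convolution: "(\<integral>z. g z \<partial>(\<mu> \<star> \<nu>)) = (\<integral>x. (\<integral>y. g (x + y) \<partial>\<nu>) \<partial>\<mu>)"
    and integrable_convolution_fst: "integrable \<mu> (\<lambda>x. \<integral>y. g (x + y) \<partial>\<nu>)"
    and integrable_convolution: "integrable (\<mu> \<star> \<nu>) g"
proof -
  note [measurable_cong] = has_moments_sets[OF \<mu>] has_moments_sets[OF \<nu>]
  interpret M: prob_space \<mu> using \<mu> by (rule has_moments_prob_space)
  interpret N: prob_space \<nu> using \<nu> by (rule has_moments_prob_space)
  interpret pair_sigma_finite \<mu> \<nu> ..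
  obtain C q where "C \<ge> 0" and C: "\<And>x. \<bar>g x\<bar> \<le> C * (1 + \<bar>x\<bar>) ^ q"
    using g by (rule poly_boundedE) blast
  let ?w = "\<lambda>x::real. (1 + \<bar>x\<bar>) ^ q"
  \<comment> \<open>Measurability on the product is moved to
    \<open>borel \<Otimes>\<^sub>M borel\<close>, where it can be checked automatically.\<close>
  have pair: "measurable (\<mu> \<Otimes>\<^sub>M \<nu>) K = measurable (borel \<Otimes>\<^sub>M borel) K" for K :: "'k measure"
    by (intro measurable_cong_sets sets_pair_measure_cong has_moments_sets \<mu> \<nu> refl)
  have w: "integrable (\<mu> \<Otimes>\<^sub>M \<nu>) (\<lambda>z. ?w (fst z) * ?w (snd z))"
    unfolding integrable_iff_bounded
  proof
    have wm: "(\<lambda>x. ennreal (?w x)) \<in> borel_measurable \<mu>" "(\<lambda>x. ennreal (?w x)) \<in> borel_measurable \<nu>"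
      by (simp_all add: measurable_cong_sets[OF has_moments_sets[OF \<mu>] refl] measurable_cong_sets[OF has_moments_sets[OF \<nu>] refl])
    have [measurable]: "(\<lambda>z. ?w (fst z)) \<in> borel_measurable (\<mu> \<Otimes>\<^sub>M \<nu>)" "(\<lambda>z. ?w (snd z)) \<in> borel_measurable (\<mu> \<Otimes>\<^sub>M \<nu>)"
      unfolding pair by measurable
    have "(\<integral>\<^sup>+z. ennreal (norm (?w (fst z) * ?w (snd z))) \<partial>(\<mu> \<Otimes>\<^sub>M \<nu>)) =
        (\<integral>\<^sup>+x. (\<integral>\<^sup>+y. ennreal (?w x) * ennreal (?w y) \<partial>\<nu>) \<partial>\<mu>)"
      by (subst N.nn_integral_fst[symmetric]) (auto simp: ennreal_mult abs_mult power_abs)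
    also have "\<dots> = (\<integral>\<^sup>+x. ennreal (?w x) \<partial>\<mu>) * (\<integral>\<^sup>+y. ennreal (?w y) \<partial>\<nu>)"
      by (simp add: nn_integral_cmult nn_integral_multc wm)
    also have "\<dots> < \<infinity>"
      using integrable_weight[OF \<mu>, of q] integrable_weight[OF \<nu>, of q]
      by (auto simp: nn_integral_eq_integral ennreal_mult_less_top)
    finally show "(\<integral>\<^sup>+z. ennreal (norm (?w (fst z) * ?w (snd z))) \<partial>(\<mu> \<Otimes>\<^sub>M \<nu>)) < \<infinity>" .
  qed (unfold pair, measurable)
  have pm: "(\<lambda>(x, y). x + y) \<in> borel_measurable (\<mu> \<Otimes>\<^sub>M \<nu>)"
    unfolding pair by measurable
  have gm: "(\<lambda>(x, y). g (x + y)) \<in> borel_measurable (\<mu> \<Otimes>\<^sub>M \<nu>)"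
    using measurable_compose[OF pm, of g borel] by (simp add: case_prod_beta)
  have int: "integrable (\<mu> \<Otimes>\<^sub>M \<nu>) (\<lambda>(x, y). g (x + y))"
  proof (rule Bochner_Integration.integrable_bound[OF integrable_mult_right[OF w, of C] gm])
    show "AE z in \<mu> \<Otimes>\<^sub>M \<nu>. norm (case z of (x, y) \<Rightarrow> g (x + y)) \<le> norm (C * (?w (fst z) * ?w (snd z)))"
    proof (rule AE_I2)
      fix z :: "real \<times> real"
      have "\<bar>g (fst z + snd z)\<bar> \<le> C * (?w (fst z) * ?w (snd z))"
        using C[of "fst z + snd z"] mult_left_mono[OF weight_add[of "fst z" "snd z" q] \<open>C \<ge> 0\<close>] by linarith
      then show "norm (case z of (x, y) \<Rightarrow> g (x + y)) \<le> norm (C * (?w (fst z) * ?w (snd z)))"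
        by (simp add: case_prod_beta abs_mult power_abs \<open>C \<ge> 0\<close>)
    qed
  qed
  show "(\<integral>z. g z \<partial>(\<mu> \<star> \<nu>)) = (\<integral>x. (\<integral>y. g (x + y) \<partial>\<nu>) \<partial>\<mu>)"
    unfolding convolution_def
    using integral_fst'[OF int] unfolding case_prod_unfold
    by (simp add: integral_distr[OF pm[unfolded case_prod_unfold]])
  show "integrable \<mu> (\<lambda>x. \<integral>y. g (x + y) \<partial>\<nu>)"
    using integrable_fst'[OF int] by simp
  show "integrable (\<mu> \<star> \<nu>) g"
    unfolding convolution_def
    using int unfolding case_prod_unfold
    by (simp add: integrable_distr_eq[OF pm[unfolded case_prod_unfold]])
qed

lemma has_moments_convolution:
  assumes \<mu>: "has_moments \<mu>" and \<nu>: "has_moments \<nu>"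
  shows "has_moments (\<mu> \<star> \<nu>)"
proof -
  note [measurable_cong] = has_moments_sets[OF \<mu>] has_moments_sets[OF \<nu>]
  interpret M: prob_space \<mu> using \<mu> by (rule has_moments_prob_space)
  interpret N: prob_space \<nu> using \<nu> by (rule has_moments_prob_space)
  interpret pair_prob_space \<mu> \<nu> ..
  have "prob_space (\<mu> \<star> \<nu>)"
    unfolding convolution_def
    by (intro prob_space_distr, subst measurable_cong_sets[OF sets_pair_measure_cong[OF has_moments_sets[OF \<mu>] has_moments_sets[OF \<nu>]] refl]) measurable
  moreover have "integrable (\<mu> \<star> \<nu>) (\<lambda>x. (1 + \<bar>x\<bar>) ^ q)" for q
    by (intro integrable_convolution assms poly_bounded_weight) measurable
  ultimately show ?thesis
    unfolding has_moments_def by simp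
qed

section \<open>Generators\<close>

text \<open>A weighted Lipschitz bound on \<open>f'\<close> is the regularity from which the errors
  of order \<open>h\<^sup>2\<close> arise: for a drift it bounds the Taylor remainder, and for a
  Gamma step it makes averages of \<open>f'\<close> change by O(h) when a small independent Gamma
  variable is added.\<close>

definition smooth :: "(real \<Rightarrow> real) \<Rightarrow> (real \<Rightarrow> real) \<Rightarrow> bool" where
  "smooth f f' \<longleftrightarrow> (\<forall>x. (f has_real_derivative f' x) (at x)) \<and> poly_lipschitz f'"

text \<open>\<open>L f f' w\<close> is the right derivative at \<open>h = 0\<close> of the integral of \<open>f (w + x)\<close> against
  \<open>\<mu> h\<close>. The remainder carries a polynomial weight in \<open>w\<close> so that it stays integrable against
  further convolution factors.\<close>

definition generator ::
  "(real \<Rightarrow> real measure) \<Rightarrow> ((real \<Rightarrow> real) \<Rightarrow> (real \<Rightarrow> real) \<Rightarrow> real \<Rightarrow> real) \<Rightarrow> bool" where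
  "generator \<mu> L \<longleftrightarrow>
     (\<forall>h\<in>{0..1}. has_moments (\<mu> h)) \<and>
     (\<forall>q. \<exists>C. \<forall>h\<in>{0..1}. (\<integral>x. \<bar>x\<bar> * (1 + \<bar>x\<bar>) ^ q \<partial>\<mu> h) \<le> C * h) \<and>
     (\<forall>f f'. smooth f f' \<longrightarrow> poly_lipschitz (L f f') \<and>
        (\<exists>C q. \<forall>h\<in>{0..1}. \<forall>w.
           \<bar>(\<integral>x. f (w + x) \<partial>\<mu> h) - f w - h * L f f' w\<bar> \<le> C * h\<^sup>2 * (1 + \<bar>w\<bar>) ^ q))"

lemma smooth_poly_lipschitz: "smooth f f' \<Longrightarrow> poly_lipschitz f"
  by (auto simp: smooth_def intro: poly_lipschitz_derivative poly_lipschitz_imp_poly_bounded)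

lemma smooth_poly_bounded: "smooth f f' \<Longrightarrow> poly_bounded f"
  by (intro poly_lipschitz_imp_poly_bounded smooth_poly_lipschitz)

lemma smooth_measurable: "smooth f f' \<Longrightarrow> f \<in> borel_measurable borel"
  by (intro poly_lipschitz_measurable smooth_poly_lipschitz)

lemma integrable_abs_weight:
  assumes "has_moments \<mu>" shows "integrable \<mu> (\<lambda>x. \<bar>x\<bar> * (1 + \<bar>x\<bar>) ^ q)"
proof -
  have "integrable \<mu> (\<lambda>x. \<bar>0 + x\<bar> * (1 + \<bar>0 + x\<bar>) ^ q)"
    by (rule integrable_poly_bounded[OF assms _ poly_bounded_abs_weight]) measurable
  then show ?thesis by simp
qed

lemma generator_has_moments: "generator \<mu> L \<Longrightarrow> h \<in> {0..1} \<Longrightarrow> has_moments (\<mu> h)"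
  by (simp add: generator_def)

lemma generator_abs_moment:
  assumes "generator \<mu> L"
  obtains C where "C \<ge> 0" "\<And>h. h \<in> {0..1} \<Longrightarrow> (\<integral>x. \<bar>x\<bar> * (1 + \<bar>x\<bar>) ^ q \<partial>\<mu> h) \<le> C * h"
proof -
  obtain C where C: "\<forall>h\<in>{0..1}. (\<integral>x. \<bar>x\<bar> * (1 + \<bar>x\<bar>) ^ q \<partial>\<mu> h) \<le> C * h"
    using assms unfolding generator_def by blast
  have "0 \<le> (\<integral>x. \<bar>x\<bar> * (1 + \<bar>x\<bar>) ^ q \<partial>\<mu> 1)"
    by (intro Bochner_Integration.integral_nonneg) simp
  also have "\<dots> \<le> C * 1" using C by (rule bspec) simp
  finally have "0 \<le> C" by simp
  with C show thesis using that by blast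
qed

text \<open>Where |x| \<le> 1 the weight is at most \<open>2 ^ q\<close>; elsewhere it is at most
  |x| times itself, which the first-moment condition controls. The bound does not depend on
  \<open>h\<close>, so weighted errors can be integrated against a law at any time in
  [0, 1].\<close>

lemma generator_moment:
  assumes \<mu>: "generator \<mu> L"
  obtains B where "B \<ge> 0" "\<And>h. h \<in> {0..1} \<Longrightarrow> (\<integral>x. (1 + \<bar>x\<bar>) ^ q \<partial>\<mu> h) \<le> B"
proof -
  obtain C where "C \<ge> 0" and
    C: "\<And>h. h \<in> {0..1} \<Longrightarrow> (\<integral>x. \<bar>x\<bar> * (1 + \<bar>x\<bar>) ^ q \<partial>\<mu> h) \<le> C * h"
    using generator_abs_moment[OF \<mu>] by blast
  have "(\<integral>x. (1 + \<bar>x\<bar>) ^ q \<partial>\<mu> h) \<le> 2 ^ q + C" if h: "h \<in> {0..1}" for h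
  proof -
    have m: "has_moments (\<mu> h)" using generator_has_moments[OF \<mu> h] .
    interpret prob_space "\<mu> h" by (rule has_moments_prob_space[OF m])
    have a: "integrable (\<mu> h) (\<lambda>x. \<bar>x\<bar> * (1 + \<bar>x\<bar>) ^ q)"
      by (rule integrable_abs_weight[OF m])
    have "(\<integral>x. (1 + \<bar>x\<bar>) ^ q \<partial>\<mu> h) \<le> (\<integral>x. 2 ^ q + \<bar>x\<bar> * (1 + \<bar>x\<bar>) ^ q \<partial>\<mu> h)"
    proof (intro integral_mono integrable_weight[OF m] Bochner_Integration.integrable_add a)
      fix x :: real
      show "(1 + \<bar>x\<bar>) ^ q \<le> 2 ^ q + \<bar>x\<bar> * (1 + \<bar>x\<bar>) ^ q"
      proof (cases "\<bar>x\<bar> \<le> 1")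
        case True
        then have "(1 + \<bar>x\<bar>) ^ q \<le> 2 ^ q" by (intro power_mono) auto
        moreover have "0 \<le> \<bar>x\<bar> * (1 + \<bar>x\<bar>) ^ q" by simp
        ultimately show ?thesis by linarith
      next
        case False
        then have "1 * (1 + \<bar>x\<bar>) ^ q \<le> \<bar>x\<bar> * (1 + \<bar>x\<bar>) ^ q" by (intro mult_right_mono) auto
        moreover have "0 \<le> (2 :: real) ^ q" by simp
        ultimately show ?thesis by linarith
      qed
    qed simp
    also have "\<dots> = 2 ^ q + (\<integral>x. \<bar>x\<bar> * (1 + \<bar>x\<bar>) ^ q \<partial>\<mu> h)"
      using a by (simp add: prob_space)
    also have "\<dots> \<le> 2 ^ q + C * h" using C[OF h] by simp
    also have "\<dots> \<le> 2 ^ q + C" using \<open>C \<ge> 0\<close> h by (simp add: mult_left_le)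
    finally show ?thesis .
  qed
  then show thesis using that[of "2 ^ q + C"] \<open>C \<ge> 0\<close> by simp
qed

lemma generator_error:
  assumes "generator \<mu> L" "smooth f f'"
  obtains C q where "C \<ge> 0"
    "\<And>h w. h \<in> {0..1} \<Longrightarrow>
       \<bar>(\<integral>x. f (w + x) \<partial>\<mu> h) - f w - h * L f f' w\<bar> \<le> C * h\<^sup>2 * (1 + \<bar>w\<bar>) ^ q"
proof -
  obtain C q where C: "\<forall>h\<in>{0..1}. \<forall>w.
           \<bar>(\<integral>x. f (w + x) \<partial>\<mu> h) - f w - h * L f f' w\<bar> \<le> C * h\<^sup>2 * (1 + \<bar>w\<bar>) ^ q"
    using assms unfolding generator_def by blast
  have "\<forall>w. \<bar>(\<integral>x. f (w + x) \<partial>\<mu> 1) - f w - 1 * L f f' w\<bar> \<le> C * 1\<^sup>2 * (1 + \<bar>w\<bar>) ^ q"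
    using C by (rule bspec) simp
  from spec[OF this, of 0] have "0 \<le> C * 1\<^sup>2 * (1 + \<bar>0\<bar>) ^ q"
    by (rule order.trans[OF abs_ge_zero])
  then have "0 \<le> C" by simp
  with C show thesis using that by blast
qed

lemma generator_lipschitz: "generator \<mu> L \<Longrightarrow> smooth f f' \<Longrightarrow> poly_lipschitz (L f f')"
  by (simp add: generator_def)

text \<open>The exponent \<open>q * 2\<close> collects two factors at \<open>w\<close>: one is the
  Lipschitz weight at \<open>w\<close> itself, the other comes from splitting the weight at
  \<open>w + x\<close>.\<close>

lemma lipschitz_increment:
  assumes m: "has_moments \<mu>" and "D \<ge> 0"
    and D: "\<And>x y. \<bar>g x - g y\<bar> \<le> D * \<bar>x - y\<bar> * ((1 + \<bar>x\<bar>) ^ q * (1 + \<bar>y\<bar>) ^ q)"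
  shows "\<bar>(\<integral>x. g (w + x) \<partial>\<mu>) - g w\<bar>
    \<le> D * (1 + \<bar>w\<bar>) ^ (q * 2) * (\<integral>x. \<bar>x\<bar> * (1 + \<bar>x\<bar>) ^ q \<partial>\<mu>)"
proof -
  interpret prob_space \<mu> by (rule has_moments_prob_space[OF m])
  let ?c = "D * (1 + \<bar>w\<bar>) ^ (q * 2)"
  have g: "poly_lipschitz g" using D by (rule poly_lipschitzI)
  have i: "integrable \<mu> (\<lambda>x. g (w + x))"
    by (intro integrable_poly_bounded[OF m] poly_lipschitz_measurable
        poly_lipschitz_imp_poly_bounded g)
  have b: "\<bar>g (w + x) - g w\<bar> \<le> ?c * (\<bar>x\<bar> * (1 + \<bar>x\<bar>) ^ q)" for x
  proof -
    have "\<bar>g (w + x) - g w\<bar> \<le> D * \<bar>x\<bar> * ((1 + \<bar>w + x\<bar>) ^ q * (1 + \<bar>w\<bar>) ^ q)"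
      using D[of "w + x" w] by simp
    also have "\<dots> \<le> D * \<bar>x\<bar> * (((1 + \<bar>w\<bar>) ^ q * (1 + \<bar>x\<bar>) ^ q) * (1 + \<bar>w\<bar>) ^ q)"
      using \<open>D \<ge> 0\<close> by (intro mult_left_mono mult_right_mono weight_add) auto
    also have "\<dots> = ?c * (\<bar>x\<bar> * (1 + \<bar>x\<bar>) ^ q)"
      by (simp add: mult_2_right power_add mult_ac)
    finally show ?thesis .
  qed
  have "\<bar>(\<integral>x. g (w + x) \<partial>\<mu>) - g w\<bar> = \<bar>\<integral>x. g (w + x) - g w \<partial>\<mu>\<bar>"
    using i by (simp add: prob_space)
  also have "\<dots> \<le> (\<integral>x. \<bar>g (w + x) - g w\<bar> \<partial>\<mu>)"
    by (rule integral_abs_bound)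
  also have "\<dots> \<le> (\<integral>x. ?c * (\<bar>x\<bar> * (1 + \<bar>x\<bar>) ^ q) \<partial>\<mu>)"
    using i integrable_abs_weight[OF m, of q] b by (intro integral_mono) auto
  finally show ?thesis by simp
qed

text \<open>Here the first-moment condition in \<open>generator\<close> is put to use: a Lipschitz
  function moves by O(h) in the mean during a step of length \<open>h\<close>.\<close>

lemma generator_increment:
  assumes \<mu>: "generator \<mu> L" and g: "poly_lipschitz g"
  obtains C q where "C \<ge> 0"
    "\<And>h w. h \<in> {0..1} \<Longrightarrow> \<bar>(\<integral>x. g (w + x) \<partial>\<mu> h) - g w\<bar> \<le> C * h * (1 + \<bar>w\<bar>) ^ q"
proof -
  obtain D q where "D \<ge> 0" and
    D: "\<And>x y. \<bar>g x - g y\<bar> \<le> D * \<bar>x - y\<bar> * ((1 + \<bar>x\<bar>) ^ q * (1 + \<bar>y\<bar>) ^ q)"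
    using g by (rule poly_lipschitzE) blast
  obtain C where "C \<ge> 0" and
    C: "\<And>h. h \<in> {0..1} \<Longrightarrow> (\<integral>x. \<bar>x\<bar> * (1 + \<bar>x\<bar>) ^ q \<partial>\<mu> h) \<le> C * h"
    using generator_abs_moment[OF \<mu>] by blast
  have "\<bar>(\<integral>x. g (w + x) \<partial>\<mu> h) - g w\<bar> \<le> (D * C) * h * (1 + \<bar>w\<bar>) ^ (q * 2)"
    if h: "h \<in> {0..1}" for h w
  proof -
    have "\<bar>(\<integral>x. g (w + x) \<partial>\<mu> h) - g w\<bar>
        \<le> D * (1 + \<bar>w\<bar>) ^ (q * 2) * (\<integral>x. \<bar>x\<bar> * (1 + \<bar>x\<bar>) ^ q \<partial>\<mu> h)"
      using generator_has_moments[OF \<mu> h] \<open>D \<ge> 0\<close> D by (rule lipschitz_increment)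
    also have "\<dots> \<le> D * (1 + \<bar>w\<bar>) ^ (q * 2) * (C * h)"
      using \<open>D \<ge> 0\<close> by (intro mult_left_mono C h) auto
    finally show ?thesis by (simp add: mult_ac)
  qed
  then show thesis using that[of "D * C" "q * 2"] \<open>C \<ge> 0\<close> \<open>D \<ge> 0\<close> by simp
qed

lemma abs_weight_add:
  "\<bar>x + y :: real\<bar> * (1 + \<bar>x + y\<bar>) ^ q
     \<le> \<bar>x\<bar> * (1 + \<bar>x\<bar>) ^ q * (1 + \<bar>y\<bar>) ^ q + (1 + \<bar>x\<bar>) ^ q * (\<bar>y\<bar> * (1 + \<bar>y\<bar>) ^ q)"
proof -
  have "\<bar>x + y\<bar> * (1 + \<bar>x + y\<bar>) ^ q \<le> (\<bar>x\<bar> + \<bar>y\<bar>) * ((1 + \<bar>x\<bar>) ^ q * (1 + \<bar>y\<bar>) ^ q)"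
    by (intro mult_mono weight_add abs_triangle_ineq) auto
  then show ?thesis by (simp add: algebra_simps)
qed

lemma integral_abs_weight_convolution:
  assumes m: "has_moments \<mu>" and n: "has_moments \<nu>"
  shows "(\<integral>x. \<bar>x\<bar> * (1 + \<bar>x\<bar>) ^ q \<partial>(\<mu> \<star> \<nu>))
    \<le> (\<integral>x. \<bar>x\<bar> * (1 + \<bar>x\<bar>) ^ q \<partial>\<mu>) * (\<integral>x. (1 + \<bar>x\<bar>) ^ q \<partial>\<nu>)
      + (\<integral>x. (1 + \<bar>x\<bar>) ^ q \<partial>\<mu>) * (\<integral>x. \<bar>x\<bar> * (1 + \<bar>x\<bar>) ^ q \<partial>\<nu>)"
proof -
  let ?a = "\<lambda>x::real. \<bar>x\<bar> * (1 + \<bar>x\<bar>) ^ q" and ?w = "\<lambda>x::real. (1 + \<bar>x\<bar>) ^ q"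
  have am: "?a \<in> borel_measurable borel" by measurable
  note i = integrable_abs_weight
  have "(\<integral>x. ?a x \<partial>(\<mu> \<star> \<nu>)) = (\<integral>x. (\<integral>y. ?a (x + y) \<partial>\<nu>) \<partial>\<mu>)"
    by (intro integral_convolution m n poly_bounded_abs_weight am)
  also have "\<dots> \<le> (\<integral>x. ?a x * (\<integral>y. ?w y \<partial>\<nu>) + ?w x * (\<integral>y. ?a y \<partial>\<nu>) \<partial>\<mu>)"
  proof (intro integral_mono)
    show "integrable \<mu> (\<lambda>x. \<integral>y. ?a (x + y) \<partial>\<nu>)"
      by (intro integrable_convolution_fst m n poly_bounded_abs_weight am)
    show "integrable \<mu> (\<lambda>x. ?a x * (\<integral>y. ?w y \<partial>\<nu>) + ?w x * (\<integral>y. ?a y \<partial>\<nu>))"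
      using i[OF m] integrable_weight[OF m] by simp
    fix x :: real
    have "(\<integral>y. ?a (x + y) \<partial>\<nu>) \<le> (\<integral>y. ?a x * ?w y + ?w x * ?a y \<partial>\<nu>)"
      using i[OF n] integrable_weight[OF n]
      by (intro integral_mono abs_weight_add integrable_poly_bounded n am poly_bounded_abs_weight) auto
    then show "(\<integral>y. ?a (x + y) \<partial>\<nu>) \<le> ?a x * (\<integral>y. ?w y \<partial>\<nu>) + ?w x * (\<integral>y. ?a y \<partial>\<nu>)"
      using i[OF n] integrable_weight[OF n] by simp
  qed
  also have "\<dots> = (\<integral>x. ?a x \<partial>\<mu>) * (\<integral>x. ?w x \<partial>\<nu>) + (\<integral>x. ?w x \<partial>\<mu>) * (\<integral>x. ?a x \<partial>\<nu>)"
    using i[OF m] integrable_weight[OF m] by simp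
  finally show ?thesis .
qed

lemma integral_weight_convolution:
  assumes m: "has_moments \<mu>" and n: "has_moments \<nu>"
  shows "(\<integral>x. (1 + \<bar>x\<bar>) ^ q \<partial>(\<mu> \<star> \<nu>)) \<le> (\<integral>x. (1 + \<bar>x\<bar>) ^ q \<partial>\<mu>) * (\<integral>x. (1 + \<bar>x\<bar>) ^ q \<partial>\<nu>)"
proof -
  let ?w = "\<lambda>x::real. (1 + \<bar>x\<bar>) ^ q"
  have wm: "?w \<in> borel_measurable borel" by measurable
  have "(\<integral>x. ?w x \<partial>(\<mu> \<star> \<nu>)) = (\<integral>x. (\<integral>y. ?w (x + y) \<partial>\<nu>) \<partial>\<mu>)"
    by (intro integral_convolution m n poly_bounded_weight wm)
  also have "\<dots> \<le> (\<integral>x. ?w x * (\<integral>y. ?w y \<partial>\<nu>) \<partial>\<mu>)"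
  proof (intro integral_mono)
    show "integrable \<mu> (\<lambda>x. \<integral>y. ?w (x + y) \<partial>\<nu>)"
      by (intro integrable_convolution_fst m n poly_bounded_weight wm)
    show "integrable \<mu> (\<lambda>x. ?w x * (\<integral>y. ?w y \<partial>\<nu>))"
      using integrable_weight[OF m] by simp
    fix x :: real
    have "(\<integral>y. ?w (x + y) \<partial>\<nu>) \<le> (\<integral>y. ?w x * ?w y \<partial>\<nu>)"
      using integrable_weight[OF n]
      by (intro integral_mono weight_add integrable_poly_bounded n wm poly_bounded_weight) auto
    then show "(\<integral>y. ?w (x + y) \<partial>\<nu>) \<le> ?w x * (\<integral>y. ?w y \<partial>\<nu>)" by simp
  qed
  also have "\<dots> = (\<integral>x. ?w x \<partial>\<mu>) * (\<integral>x. ?w x \<partial>\<nu>)" by simp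
  finally show ?thesis .
qed

text \<open>Expand the \<open>\<nu>\<close> step at the random point w + x, then the
  \<open>\<mu>\<close> step at \<open>w\<close>. Besides the two expansion errors this leaves
  \<open>h\<close> times the change of \<open>K f f'\<close> from \<open>w\<close> to w + x, whose
  mean is itself O(h). All three errors are of order \<open>h\<^sup>2\<close>, and \<open>?s\<close>
  is a common exponent for their weights.\<close>

lemma generator_convolution:
  assumes \<mu>: "generator \<mu> L" and \<nu>: "generator \<nu> K"
  shows "generator (\<lambda>h. \<mu> h \<star> \<nu> h) (\<lambda>f f' w. L f f' w + K f f' w)"
  unfolding generator_def
proof (intro conjI ballI allI impI)
  show "has_moments (\<mu> h \<star> \<nu> h)" if "h \<in> {0..1}" for h
    using that by (intro has_moments_convolution generator_has_moments[OF \<mu>] generator_has_moments[OF \<nu>])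
  show "\<exists>C. \<forall>h\<in>{0..1}. (\<integral>x. \<bar>x\<bar> * (1 + \<bar>x\<bar>) ^ q \<partial>(\<mu> h \<star> \<nu> h)) \<le> C * h" for q
  proof -
    obtain C where "C \<ge> 0" and
      C: "\<And>h. h \<in> {0..1} \<Longrightarrow> (\<integral>x. \<bar>x\<bar> * (1 + \<bar>x\<bar>) ^ q \<partial>\<mu> h) \<le> C * h"
      using generator_abs_moment[OF \<mu>] by blast
    obtain D where "D \<ge> 0" and
      D: "\<And>h. h \<in> {0..1} \<Longrightarrow> (\<integral>x. \<bar>x\<bar> * (1 + \<bar>x\<bar>) ^ q \<partial>\<nu> h) \<le> D * h"
      using generator_abs_moment[OF \<nu>] by blast
    obtain A where "A \<ge> 0" and A: "\<And>h. h \<in> {0..1} \<Longrightarrow> (\<integral>x. (1 + \<bar>x\<bar>) ^ q \<partial>\<mu> h) \<le> A"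
      using generator_moment[OF \<mu>] by blast
    obtain B where "B \<ge> 0" and B: "\<And>h. h \<in> {0..1} \<Longrightarrow> (\<integral>x. (1 + \<bar>x\<bar>) ^ q \<partial>\<nu> h) \<le> B"
      using generator_moment[OF \<nu>] by blast
    have "(\<integral>x. \<bar>x\<bar> * (1 + \<bar>x\<bar>) ^ q \<partial>(\<mu> h \<star> \<nu> h)) \<le> (C * B + A * D) * h" if h: "h \<in> {0..1}" for h
    proof -
      have "(\<integral>x. \<bar>x\<bar> * (1 + \<bar>x\<bar>) ^ q \<partial>(\<mu> h \<star> \<nu> h)) \<le> (C * h) * B + A * (D * h)"
        using h \<open>A \<ge> 0\<close> \<open>C \<ge> 0\<close>
        by (intro order.trans[OF integral_abs_weight_convolution] add_mono mult_mono A B C D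
            generator_has_moments[OF \<mu>] generator_has_moments[OF \<nu>]
            Bochner_Integration.integral_nonneg) auto
      then show ?thesis by (simp add: algebra_simps)
    qed
    then show ?thesis by blast
  qed
  fix f f' assume f: "smooth f f'"
  show "poly_lipschitz (\<lambda>w. L f f' w + K f f' w)"
    by (intro poly_lipschitz_add generator_lipschitz[OF \<mu> f] generator_lipschitz[OF \<nu> f])
  obtain C p where "C \<ge> 0" and C: "\<And>h w. h \<in> {0..1} \<Longrightarrow>
       \<bar>(\<integral>x. f (w + x) \<partial>\<mu> h) - f w - h * L f f' w\<bar> \<le> C * h\<^sup>2 * (1 + \<bar>w\<bar>) ^ p"
    using generator_error[OF \<mu> f] by blast
  obtain D q where "D \<ge> 0" and D: "\<And>h w. h \<in> {0..1} \<Longrightarrow>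
       \<bar>(\<integral>x. f (w + x) \<partial>\<nu> h) - f w - h * K f f' w\<bar> \<le> D * h\<^sup>2 * (1 + \<bar>w\<bar>) ^ q"
    using generator_error[OF \<nu> f] by blast
  have Kl: "poly_lipschitz (K f f')" by (rule generator_lipschitz[OF \<nu> f])
  obtain E r where "E \<ge> 0" and E: "\<And>h w. h \<in> {0..1} \<Longrightarrow>
       \<bar>(\<integral>x. K f f' (w + x) \<partial>\<mu> h) - K f f' w\<bar> \<le> E * h * (1 + \<bar>w\<bar>) ^ r"
    using generator_increment[OF \<mu> Kl] by blast
  obtain A where "A \<ge> 0" and A: "\<And>h. h \<in> {0..1} \<Longrightarrow> (\<integral>x. (1 + \<bar>x\<bar>) ^ q \<partial>\<mu> h) \<le> A"
    using generator_moment[OF \<mu>] by blast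
  let ?s = "p + q + r"
  have "\<bar>(\<integral>x. f (w + x) \<partial>(\<mu> h \<star> \<nu> h)) - f w - h * (L f f' w + K f f' w)\<bar>
      \<le> (C + A * D + E) * h\<^sup>2 * (1 + \<bar>w\<bar>) ^ ?s" if h: "h \<in> {0..1}" for h w
  proof -
    have m: "has_moments (\<mu> h)" using generator_has_moments[OF \<mu> h] .
    have n: "has_moments (\<nu> h)" using generator_has_moments[OF \<nu> h] .
    note fm = smooth_measurable[OF f] and fb = smooth_poly_bounded[OF f]
    have fwm: "(\<lambda>x. f (w + x)) \<in> borel_measurable borel"
      using fm by measurable
    have fwb: "poly_bounded (\<lambda>x. f (w + x))"
      by (rule poly_bounded_shift[OF fb])
    define F where "F = (\<lambda>x. \<integral>y. f (w + x + y) \<partial>\<nu> h)"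
    have conv: "(\<integral>x. f (w + x) \<partial>(\<mu> h \<star> \<nu> h)) = (\<integral>x. F x \<partial>\<mu> h)"
      using integral_convolution[OF m n fwm fwb] by (simp add: F_def add.assoc)
    have iF: "integrable (\<mu> h) F"
      using integrable_convolution_fst[OF m n fwm fwb] by (simp add: F_def add.assoc)
    have if': "integrable (\<mu> h) (\<lambda>x. f (w + x))"
      by (rule integrable_poly_bounded[OF m fm fb])
    have iK: "integrable (\<mu> h) (\<lambda>x. K f f' (w + x))"
      by (intro integrable_poly_bounded[OF m] poly_lipschitz_measurable
          poly_lipschitz_imp_poly_bounded Kl)
    \<comment> \<open>Error of the \<open>\<nu>\<close> step, averaged over its starting point w +
      x.\<close>
    have "\<bar>(\<integral>x. F x \<partial>\<mu> h) - (\<integral>x. f (w + x) \<partial>\<mu> h) - h * (\<integral>x. K f f' (w + x) \<partial>\<mu> h)\<bar>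
        = \<bar>\<integral>x. F x - f (w + x) - h * K f f' (w + x) \<partial>\<mu> h\<bar>"
      using iF if' iK by simp
    also have "\<dots> \<le> (\<integral>x. \<bar>F x - f (w + x) - h * K f f' (w + x)\<bar> \<partial>\<mu> h)"
      by (rule integral_abs_bound)
    also have "\<dots> \<le> (\<integral>x. D * h\<^sup>2 * ((1 + \<bar>w\<bar>) ^ q * (1 + \<bar>x\<bar>) ^ q) \<partial>\<mu> h)"
    proof (intro integral_mono)
      fix x
      have "\<bar>F x - f (w + x) - h * K f f' (w + x)\<bar> \<le> D * h\<^sup>2 * (1 + \<bar>w + x\<bar>) ^ q"
        unfolding F_def by (rule D[OF h])
      also have "\<dots> \<le> D * h\<^sup>2 * ((1 + \<bar>w\<bar>) ^ q * (1 + \<bar>x\<bar>) ^ q)"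
        using \<open>D \<ge> 0\<close> by (intro mult_left_mono weight_add) auto
      finally show "\<bar>F x - f (w + x) - h * K f f' (w + x)\<bar> \<le> D * h\<^sup>2 * ((1 + \<bar>w\<bar>) ^ q * (1 + \<bar>x\<bar>) ^ q)" .
    qed (use iF if' iK integrable_weight[OF m] in auto)
    also have "\<dots> = D * h\<^sup>2 * ((1 + \<bar>w\<bar>) ^ q * (\<integral>x. (1 + \<bar>x\<bar>) ^ q \<partial>\<mu> h))"
      by simp
    also have "\<dots> \<le> D * h\<^sup>2 * ((1 + \<bar>w\<bar>) ^ q * A)"
      using \<open>D \<ge> 0\<close> by (intro mult_left_mono A h) auto
    also have "\<dots> = (A * D * h\<^sup>2) * (1 + \<bar>w\<bar>) ^ q" by (simp add: mult_ac)
    also have "\<dots> \<le> (A * D * h\<^sup>2) * (1 + \<bar>w\<bar>) ^ ?s"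
      using \<open>A \<ge> 0\<close> \<open>D \<ge> 0\<close> by (intro mult_left_mono weight_mono) auto
    finally have 1: "\<bar>(\<integral>x. F x \<partial>\<mu> h) - (\<integral>x. f (w + x) \<partial>\<mu> h) - h * (\<integral>x. K f f' (w + x) \<partial>\<mu> h)\<bar>
        \<le> (A * D * h\<^sup>2) * (1 + \<bar>w\<bar>) ^ ?s" .
    have 2: "\<bar>(\<integral>x. f (w + x) \<partial>\<mu> h) - f w - h * L f f' w\<bar> \<le> (C * h\<^sup>2) * (1 + \<bar>w\<bar>) ^ ?s"
      using \<open>C \<ge> 0\<close> by (intro order.trans[OF C[OF h]] mult_left_mono weight_mono) auto
    \<comment> \<open>Cost of freezing \<open>K f f'\<close> at \<open>w\<close>.\<close>
    have "\<bar>h * (\<integral>x. K f f' (w + x) \<partial>\<mu> h) - h * K f f' w\<bar>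
        = h * \<bar>(\<integral>x. K f f' (w + x) \<partial>\<mu> h) - K f f' w\<bar>"
      using h by (simp add: right_diff_distrib[symmetric] abs_mult)
    also have "\<dots> \<le> h * (E * h * (1 + \<bar>w\<bar>) ^ r)"
      using h by (intro mult_left_mono E) auto
    also have "\<dots> = (E * h\<^sup>2) * (1 + \<bar>w\<bar>) ^ r" by (simp add: power2_eq_square)
    also have "\<dots> \<le> (E * h\<^sup>2) * (1 + \<bar>w\<bar>) ^ ?s"
      using \<open>E \<ge> 0\<close> by (intro mult_left_mono weight_mono) auto
    finally have 3: "\<bar>h * (\<integral>x. K f f' (w + x) \<partial>\<mu> h) - h * K f f' w\<bar> \<le> (E * h\<^sup>2) * (1 + \<bar>w\<bar>) ^ ?s" .
    have "\<bar>(\<integral>x. F x \<partial>\<mu> h) - f w - h * (L f f' w + K f f' w)\<bar>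
        \<le> (A * D * h\<^sup>2) * (1 + \<bar>w\<bar>) ^ ?s + (C * h\<^sup>2) * (1 + \<bar>w\<bar>) ^ ?s + (E * h\<^sup>2) * (1 + \<bar>w\<bar>) ^ ?s"
      using 1 2 3 unfolding distrib_left by linarith
    then show ?thesis unfolding conv by (simp add: algebra_simps)
  qed
  then show "\<exists>C q. \<forall>h\<in>{0..1}. \<forall>w. \<bar>(\<integral>x. f (w + x) \<partial>(\<mu> h \<star> \<nu> h)) - f w
      - h * (L f f' w + K f f' w)\<bar> \<le> C * h\<^sup>2 * (1 + \<bar>w\<bar>) ^ q" by blast
qed

lemma has_moments_return: "has_moments (return borel c)"
proof -
  have "integrable (return borel c) (\<lambda>x::real. (1 + \<bar>x\<bar>) ^ q)" for q
    by (simp add: integrable_iff_bounded nn_integral_return)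
  then show ?thesis by (simp add: has_moments_def prob_space_return)
qed

lemma generator_return: "generator (\<lambda>h. return borel (c * h)) (\<lambda>f f' w. c * f' w)"
  unfolding generator_def
proof (intro conjI ballI allI impI)
  show "has_moments (return borel (c * h))" for h by (rule has_moments_return)
  show "\<exists>C. \<forall>h\<in>{0..1}. (\<integral>x. \<bar>x\<bar> * (1 + \<bar>x\<bar>) ^ q \<partial>return borel (c * h)) \<le> C * h" for q
  proof (intro exI ballI)
    fix h :: real assume h: "h \<in> {0..1}"
    have "\<bar>c * h\<bar> * (1 + \<bar>c * h\<bar>) ^ q \<le> \<bar>c\<bar> * h * (1 + \<bar>c\<bar>) ^ q"
      using h by (intro mult_mono power_mono add_mono) (auto simp: abs_mult mult_left_le)
    then show "(\<integral>x. \<bar>x\<bar> * (1 + \<bar>x\<bar>) ^ q \<partial>return borel (c * h)) \<le> (\<bar>c\<bar> * (1 + \<bar>c\<bar>) ^ q) * h"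
      by (simp add: integral_return mult_ac)
  qed
  fix f f' assume f: "smooth f f'"
  then have l: "poly_lipschitz f'" by (simp add: smooth_def)
  then show "poly_lipschitz (\<lambda>w. c * f' w)" by (rule poly_lipschitz_cmult)
  obtain D q where "D \<ge> 0" and
    D: "\<And>x y. \<bar>f' x - f' y\<bar> \<le> D * \<bar>x - y\<bar> * ((1 + \<bar>x\<bar>) ^ q * (1 + \<bar>y\<bar>) ^ q)"
    using l by (rule poly_lipschitzE) blast
  have df: "\<And>x. (f has_real_derivative f' x) (at x)" using f by (simp add: smooth_def)
  have "\<bar>(\<integral>x. f (w + x) \<partial>return borel (c * h)) - f w - h * (c * f' w)\<bar>
      \<le> (D * c\<^sup>2 * (1 + \<bar>c\<bar>) ^ q) * h\<^sup>2 * (1 + \<bar>w\<bar>) ^ (q * 2)" if h: "h \<in> {0..1}" for h w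
  proof -
    \<comment> \<open>Parametrising the segment by [0, 1] lets the mean value theorem cover both
      signs of \<open>c\<close> and the degenerate case \<open>c * h = 0\<close>.\<close>
    let ?g = "\<lambda>t. f (w + t * (c * h))"
    have "\<exists>t>0. t < 1 \<and> ?g 1 - ?g 0 = (1 - 0) * (f' (w + t * (c * h)) * (c * h))"
      by (intro MVT2 DERIV_chain2[OF df]) (auto intro!: derivative_eq_intros)
    then obtain t where t: "0 < t" "t < 1" "f (w + c * h) - f w = f' (w + t * (c * h)) * (c * h)"
      by auto
    have ch: "\<bar>t * (c * h)\<bar> \<le> \<bar>c\<bar> * h"
      using t h by (simp add: abs_mult mult_left_le_one_le)
    have "f (w + c * h) - f w - h * (c * f' w) = (f' (w + t * (c * h)) - f' w) * (c * h)"
      unfolding t(3) by (simp add: left_diff_distrib)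
    then have "\<bar>f (w + c * h) - f w - h * (c * f' w)\<bar> = \<bar>f' (w + t * (c * h)) - f' w\<bar> * (\<bar>c\<bar> * h)"
      using h by (simp add: abs_mult)
    also have "\<dots> \<le> (D * (\<bar>c\<bar> * h) * (((1 + \<bar>w\<bar>) ^ q * (1 + \<bar>c\<bar>) ^ q) * (1 + \<bar>w\<bar>) ^ q)) * (\<bar>c\<bar> * h)"
    proof (intro mult_right_mono)
      have "(1 + \<bar>w + t * (c * h)\<bar>) ^ q \<le> (1 + \<bar>w\<bar>) ^ q * (1 + \<bar>t * (c * h)\<bar>) ^ q"
        by (rule weight_add)
      also have "\<dots> \<le> (1 + \<bar>w\<bar>) ^ q * (1 + \<bar>c\<bar>) ^ q"
        using ch h mult_left_le[of h "\<bar>c\<bar>"] by (intro mult_left_mono power_mono) auto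
      finally have "(1 + \<bar>w + t * (c * h)\<bar>) ^ q \<le> (1 + \<bar>w\<bar>) ^ q * (1 + \<bar>c\<bar>) ^ q" .
      then have "D * \<bar>t * (c * h)\<bar> * ((1 + \<bar>w + t * (c * h)\<bar>) ^ q * (1 + \<bar>w\<bar>) ^ q)
          \<le> D * (\<bar>c\<bar> * h) * (((1 + \<bar>w\<bar>) ^ q * (1 + \<bar>c\<bar>) ^ q) * (1 + \<bar>w\<bar>) ^ q)"
        using ch h \<open>D \<ge> 0\<close> by (intro mult_mono mult_left_mono mult_right_mono mult_nonneg_nonneg) auto
      then show "\<bar>f' (w + t * (c * h)) - f' w\<bar>
          \<le> D * (\<bar>c\<bar> * h) * (((1 + \<bar>w\<bar>) ^ q * (1 + \<bar>c\<bar>) ^ q) * (1 + \<bar>w\<bar>) ^ q)"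
        using D[of "w + t * (c * h)" w] by simp
    qed (use h in auto)
    also have "\<dots> = (D * c\<^sup>2 * (1 + \<bar>c\<bar>) ^ q) * h\<^sup>2 * (1 + \<bar>w\<bar>) ^ (q * 2)"
    proof -
      have "\<bar>c\<bar> * \<bar>c\<bar> = c\<^sup>2" by (simp add: power2_eq_square)
      then show ?thesis by (simp add: mult_2_right power_add power2_eq_square[of h] mult_ac flip: \<open>\<bar>c\<bar> * \<bar>c\<bar> = c\<^sup>2\<close>)
    qed
    finally show ?thesis using smooth_measurable[OF f] by (simp add: integral_return)
  qed
  then show "\<exists>C q. \<forall>h\<in>{0..1}. \<forall>w. \<bar>(\<integral>x. f (w + x) \<partial>return borel (c * h)) - f w - h * (c * f' w)\<bar>
      \<le> C * h\<^sup>2 * (1 + \<bar>w\<bar>) ^ q" by blast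
qed

section \<open>The 3-convex order\<close>

text \<open>Growth is demanded of \<open>f''\<close> alone; \<open>poly_lipschitz_derivative\<close>
  passes it on to \<open>f'\<close> and then to \<open>f\<close>.\<close>

definition test_function :: "(real \<Rightarrow> real) \<Rightarrow> (real \<Rightarrow> real) \<Rightarrow> (real \<Rightarrow> real) \<Rightarrow> bool" where
  "test_function f f' f'' \<longleftrightarrow> (\<forall>x. (f has_real_derivative f' x) (at x)) \<and>
     (\<forall>x. (f' has_real_derivative f'' x) (at x)) \<and> convex_on UNIV f'' \<and> poly_bounded f''"

text \<open>Functions with convex second derivative are the convex functions of order three in the
  sense of Popoviciu, order one being ordinary convexity. Moments belong to the relation because the
  Bochner integral of a non-integrable function is 0, which would make the comparison
  meaningless.\<close>

definition le_3convex :: "real measure \<Rightarrow> real measure \<Rightarrow> bool" where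
  "le_3convex \<mu> \<nu> \<longleftrightarrow> has_moments \<mu> \<and> has_moments \<nu> \<and>
     (\<forall>f f' f''. test_function f f' f'' \<longrightarrow> (\<integral>x. f x \<partial>\<mu>) \<le> (\<integral>x. f x \<partial>\<nu>))"

lemma test_function_smooth: "test_function f f' f'' \<Longrightarrow> smooth f f'"
  by (auto simp: test_function_def smooth_def intro: poly_lipschitz_derivative)

lemma test_function_shift:
  assumes f: "test_function f f' f''"
  shows "test_function (\<lambda>x. f (w + x)) (\<lambda>x. f' (w + x)) (\<lambda>x. f'' (w + x))"
  unfolding test_function_def
proof (intro conjI allI)
  show "((\<lambda>x. f (w + x)) has_real_derivative f' (w + x)) (at x)"
    and "((\<lambda>x. f' (w + x)) has_real_derivative f'' (w + x)) (at x)" for x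
    using f DERIV_shift[of f "f' (w + x)" x w] DERIV_shift[of f' "f'' (w + x)" x w]
    by (simp_all add: test_function_def add.commute)
  show "poly_bounded (\<lambda>x. f'' (w + x))"
    using f by (intro poly_bounded_shift) (simp add: test_function_def)
  have c: "convex_on UNIV f''" using f by (simp add: test_function_def)
  show "convex_on UNIV (\<lambda>x. f'' (w + x))"
  proof (rule convex_onI)
    fix t x y :: real assume t: "0 < t" "t < 1"
    have "w + ((1 - t) *\<^sub>R x + t *\<^sub>R y) = (1 - t) *\<^sub>R (w + x) + t *\<^sub>R (w + y)"
      by (simp add: algebra_simps)
    then show "f'' (w + ((1 - t) *\<^sub>R x + t *\<^sub>R y)) \<le> (1 - t) * f'' (w + x) + t * f'' (w + y)"
      using convex_onD[OF c, of t "w + x" "w + y"] t by simp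
  qed simp
qed

lemma has_moments_finite_measure: "has_moments \<mu> \<Longrightarrow> finite_measure \<mu>"
  by (intro prob_space.finite_measure has_moments_prob_space)

lemma convolution_commute:
  "has_moments \<mu> \<Longrightarrow> has_moments \<nu> \<Longrightarrow> (\<mu> \<star> \<nu>) = (\<nu> \<star> \<mu>)"
  by (intro convolution_commutative has_moments_finite_measure has_moments_sets)

lemma convolution_assoc:
  "has_moments \<mu> \<Longrightarrow> has_moments \<nu> \<Longrightarrow> has_moments \<rho> \<Longrightarrow> (\<mu> \<star> (\<nu> \<star> \<rho>)) = ((\<mu> \<star> \<nu>) \<star> \<rho>)"
  by (intro convolution_associative has_moments_finite_measure has_moments_sets)

lemma convolution_return:
  assumes "has_moments \<mu>" shows "(\<mu> \<star> return borel c) = distr \<mu> borel (\<lambda>x. x + c)"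
proof (rule measure_eqI)
  note [measurable_cong] = has_moments_sets[OF assms]
  fix A assume "A \<in> sets (\<mu> \<star> return borel c)"
  then have [measurable]: "A \<in> sets borel" by simp
  have "emeasure (\<mu> \<star> return borel c) A = (\<integral>\<^sup>+x. \<integral>\<^sup>+y. indicator A (x + y) \<partial>return borel c \<partial>\<mu>)"
    by (intro convolution_emeasure' has_moments_finite_measure has_moments_sets assms
        has_moments_return) simp_all
  also have "\<dots> = (\<integral>\<^sup>+x. indicator A (x + c) \<partial>\<mu>)"
    by (simp add: nn_integral_return)
  also have "\<dots> = emeasure (distr \<mu> borel (\<lambda>x. x + c)) A"
    by (subst nn_integral_indicator[symmetric], simp, subst nn_integral_distr)
      (simp_all add: measurable_cong_sets[OF has_moments_sets[OF assms] refl])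
  finally show "emeasure (\<mu> \<star> return borel c) A = emeasure (distr \<mu> borel (\<lambda>x. x + c)) A" .
qed simp

lemma convolution_return_0: "has_moments \<mu> \<Longrightarrow> (\<mu> \<star> return borel 0) = \<mu>"
  by (simp add: convolution_return has_moments_sets distr_id2 sets_eq_imp_space_eq)

lemma le_3convex_refl: "has_moments \<mu> \<Longrightarrow> le_3convex \<mu> \<mu>"
  by (simp add: le_3convex_def)

lemma le_3convex_trans: "le_3convex \<mu> \<nu> \<Longrightarrow> le_3convex \<nu> \<rho> \<Longrightarrow> le_3convex \<mu> \<rho>"
  unfolding le_3convex_def by (meson order.trans)

text \<open>With the \<open>\<rho>\<close> coordinate fixed, the integrand is a translate of the
  test function, hence again a test function.\<close>

lemma le_3convex_convolution_left:
  assumes l: "le_3convex \<mu> \<nu>" and r: "has_moments \<rho>" shows "le_3convex (\<rho> \<star> \<mu>) (\<rho> \<star> \<nu>)"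
  unfolding le_3convex_def
proof (intro conjI allI impI)
  have m: "has_moments \<mu>" and n: "has_moments \<nu>" using l by (auto simp: le_3convex_def)
  show "has_moments (\<rho> \<star> \<mu>)" "has_moments (\<rho> \<star> \<nu>)"
    by (intro has_moments_convolution m n r)+
  fix f f' f'' assume f: "test_function f f' f''"
  note fm = smooth_measurable[OF test_function_smooth[OF f]]
    and fb = smooth_poly_bounded[OF test_function_smooth[OF f]]
  have "(\<integral>x. (\<integral>y. f (x + y) \<partial>\<mu>) \<partial>\<rho>) \<le> (\<integral>x. (\<integral>y. f (x + y) \<partial>\<nu>) \<partial>\<rho>)"
    using l test_function_shift[OF f]
    by (intro integral_mono integrable_convolution_fst r m n fm fb) (auto simp: le_3convex_def)
  then show "(\<integral>x. f x \<partial>(\<rho> \<star> \<mu>)) \<le> (\<integral>x. f x \<partial>(\<rho> \<star> \<nu>))"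
    by (simp add: integral_convolution r m n fm fb)
qed

lemma le_3convex_convolution:
  assumes l: "le_3convex \<mu> \<nu>" and l': "le_3convex \<mu>' \<nu>'" shows "le_3convex (\<mu> \<star> \<mu>') (\<nu> \<star> \<nu>')"
proof (rule le_3convex_trans)
  have m: "has_moments \<mu>" and n: "has_moments \<nu>" and m': "has_moments \<mu>'" and n': "has_moments \<nu>'"
    using l l' by (auto simp: le_3convex_def)
  show "le_3convex (\<mu> \<star> \<mu>') (\<mu> \<star> \<nu>')" by (rule le_3convex_convolution_left[OF l' m])
  show "le_3convex (\<mu> \<star> \<nu>') (\<nu> \<star> \<nu>')"
    using le_3convex_convolution_left[OF l n'] by (simp add: convolution_commute m n n')
qed

text \<open>The difference of the two sides is a function of \<open>v\<close> that vanishes to first order at \<open>0\<close>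
  and whose second derivative is nonnegative by convexity of \<open>f''\<close>.\<close>

lemma test_function_taylor_le:
  assumes f: "test_function f f' f''" and l: "- 1 \<le> l" "l \<le> 1" and v: "0 \<le> v"
  shows "f (w + l * v) - f w - l * v * f' w
    \<le> l\<^sup>2 * ((1 + l) / 2 * (f (w + v) - f w - v * f' w) + (1 - l) / 2 * (f (w - v) - f w + v * f' w))"
proof -
  have f': "\<And>x. (f has_real_derivative f' x) (at x)"
    and f'': "\<And>x. (f' has_real_derivative f'' x) (at x)" and c: "convex_on UNIV f''"
    using f by (auto simp: test_function_def)
  define D where "D v = l\<^sup>2 * ((1 + l) / 2 * (f (w + v) - f w - v * f' w)
      + (1 - l) / 2 * (f (w - v) - f w + v * f' w)) - (f (w + l * v) - f w - l * v * f' w)" for v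
  define D' where "D' v = l\<^sup>2 * ((1 + l) / 2 * (f' (w + v) - f' w)
      + (1 - l) / 2 * (f' w - f' (w - v))) - (l * f' (w + l * v) - l * f' w)" for v
  define D'' where "D'' v = l\<^sup>2 * ((1 + l) / 2 * f'' (w + v) + (1 - l) / 2 * f'' (w - v))
      - l * (l * f'' (w + l * v))" for v
  have "(D has_real_derivative D' v) (at v)" for v
    unfolding D_def D'_def
    by (rule derivative_eq_intros DERIV_chain2[OF f'] refl)+ (simp add: algebra_simps)
  moreover have "(D' has_real_derivative D'' v) (at v)" for v
    unfolding D'_def D''_def
    by (rule derivative_eq_intros DERIV_chain2[OF f''] refl)+ (simp add: algebra_simps)
  moreover have "0 \<le> D'' v" for v
  proof -
    \<comment> \<open>The weights (1 + l) / 2 and (1 - l) / 2 are the barycentric coordinates of w +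
      l v between w + v and w - v.\<close>
    have eq: "(1 - (1 - l) / 2) *\<^sub>R (w + v) + ((1 - l) / 2) *\<^sub>R (w - v) = w + l * v"
      by (simp add: field_simps)
    have "f'' (w + l * v) \<le> (1 + l) / 2 * f'' (w + v) + (1 - l) / 2 * f'' (w - v)"
      using convex_onD[OF c, of "(1 - l) / 2" "w + v" "w - v"] l unfolding eq
      by (simp add: field_simps)
    then have "l\<^sup>2 * f'' (w + l * v) \<le> l\<^sup>2 * ((1 + l) / 2 * f'' (w + v) + (1 - l) / 2 * f'' (w - v))"
      by (rule mult_left_mono) simp
    then show ?thesis by (simp add: D''_def power2_eq_square mult.assoc)
  qed
  ultimately have "D' 0 \<le> D' u" if "0 \<le> u" for u
    using that by (intro DERIV_nonneg_imp_nondecreasing[of 0 u D']) auto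
  then have "0 \<le> D' u" if "0 \<le> u" for u
    using that by (simp add: D'_def)
  with \<open>\<And>v. (D has_real_derivative D' v) (at v)\<close> have "D 0 \<le> D v"
    using v by (intro DERIV_nonneg_imp_nondecreasing[of 0 v D]) auto
  then show ?thesis by (simp add: D_def)
qed

text \<open>Both semigroups are cut into \<open>N\<close> steps of length \<open>h = s / N\<close>; replacing one step of \<open>\<mu>\<close> by a
  step of \<open>\<nu>\<close> costs only \<open>O(h\<^sup>2)\<close>.\<close>

lemma generator_compare:
  assumes \<mu>: "generator \<mu> L" and \<nu>: "generator \<nu> K"
    and \<mu>0: "\<mu> 0 = return borel 0" and \<nu>0: "\<nu> 0 = return borel 0"
    and \<mu>_add: "\<And>s t. 0 \<le> s \<Longrightarrow> 0 \<le> t \<Longrightarrow> \<mu> (s + t) = (\<mu> s \<star> \<mu> t)"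
    and \<nu>_add: "\<And>s t. 0 \<le> s \<Longrightarrow> 0 \<le> t \<Longrightarrow> \<nu> (s + t) = (\<nu> s \<star> \<nu> t)"
    and f: "smooth f f'" and LK: "\<And>w. L f f' w \<le> K f f' w" and s: "s \<in> {0..1}"
  shows "(\<integral>x. f x \<partial>\<mu> s) \<le> (\<integral>x. f x \<partial>\<nu> s)"
proof -
  obtain C p where "C \<ge> 0" and C: "\<And>h w. h \<in> {0..1} \<Longrightarrow>
       \<bar>(\<integral>x. f (w + x) \<partial>\<mu> h) - f w - h * L f f' w\<bar> \<le> C * h\<^sup>2 * (1 + \<bar>w\<bar>) ^ p"
    using generator_error[OF \<mu> f] by blast
  obtain D q where "D \<ge> 0" and D: "\<And>h w. h \<in> {0..1} \<Longrightarrow>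
       \<bar>(\<integral>x. f (w + x) \<partial>\<nu> h) - f w - h * K f f' w\<bar> \<le> D * h\<^sup>2 * (1 + \<bar>w\<bar>) ^ q"
    using generator_error[OF \<nu> f] by blast
  define r where "r = p + q"
  obtain A where "A \<ge> 0" and A: "\<And>h. h \<in> {0..1} \<Longrightarrow> (\<integral>x. (1 + \<bar>x\<bar>) ^ r \<partial>\<mu> h) \<le> A"
    using generator_moment[OF \<mu>] by blast
  obtain B where "B \<ge> 0" and B: "\<And>h. h \<in> {0..1} \<Longrightarrow> (\<integral>x. (1 + \<bar>x\<bar>) ^ r \<partial>\<nu> h) \<le> B"
    using generator_moment[OF \<nu>] by blast
  note m = generator_has_moments[OF \<mu>] and n = generator_has_moments[OF \<nu>]
  note fm = smooth_measurable[OF f] and fb = smooth_poly_bounded[OF f]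
  \<comment> \<open>C + D bounds the two one-step errors. A * B bounds the weight under a mixed law
    \<open>\<mu> a \<star> \<nu> b\<close>; both times stay in [0, 1], where the moment bounds are
    uniform.\<close>
  define E where "E = (C + D) * (A * B)"
  have step: "(\<integral>x. f x \<partial>(\<mu> (a + h) \<star> \<nu> b)) \<le> (\<integral>x. f x \<partial>(\<mu> a \<star> \<nu> (b + h))) + E * h\<^sup>2"
    if "a \<in> {0..1}" "b \<in> {0..1}" "h \<in> {0..1}" for a b h
  proof -
    note ma = m[OF that(1)] and nb = n[OF that(2)] and mh = m[OF that(3)] and nh = n[OF that(3)]
    \<comment> \<open>The common part of the two laws. Commuting the factors makes the exchanged
      step the last one, so that it acts on translates of \<open>f\<close>.\<close>
    define \<rho> where "\<rho> = (\<mu> a \<star> \<nu> b)"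
    have r: "has_moments \<rho>" unfolding \<rho>_def by (intro has_moments_convolution ma nb)
    have "(\<mu> (a + h) \<star> \<nu> b) = ((\<mu> a \<star> \<mu> h) \<star> \<nu> b)" using that by (simp add: \<mu>_add)
    also have "\<dots> = (\<mu> a \<star> (\<mu> h \<star> \<nu> b))" by (simp add: convolution_assoc ma mh nb)
    also have "(\<mu> h \<star> \<nu> b) = (\<nu> b \<star> \<mu> h)" by (rule convolution_commute[OF mh nb])
    also have "(\<mu> a \<star> (\<nu> b \<star> \<mu> h)) = (\<rho> \<star> \<mu> h)" by (simp add: \<rho>_def convolution_assoc ma mh nb)
    finally have 1: "(\<mu> (a + h) \<star> \<nu> b) = (\<rho> \<star> \<mu> h)" .
    have 2: "(\<mu> a \<star> \<nu> (b + h)) = (\<rho> \<star> \<nu> h)"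
      using that by (simp add: \<nu>_add \<rho>_def convolution_assoc ma nh nb)
    have "(\<integral>w. (\<integral>x. f (w + x) \<partial>\<mu> h) \<partial>\<rho>)
        \<le> (\<integral>w. (\<integral>x. f (w + x) \<partial>\<nu> h) + (C + D) * h\<^sup>2 * (1 + \<bar>w\<bar>) ^ r \<partial>\<rho>)"
    proof (intro integral_mono integrable_convolution_fst Bochner_Integration.integrable_add
        integrable_mult_right integrable_weight r mh nh fm fb)
      fix w
      have "(\<integral>x. f (w + x) \<partial>\<mu> h) \<le> f w + h * L f f' w + C * h\<^sup>2 * (1 + \<bar>w\<bar>) ^ p"
        using C[OF that(3), of w] by linarith
      moreover have "f w + h * K f f' w \<le> (\<integral>x. f (w + x) \<partial>\<nu> h) + D * h\<^sup>2 * (1 + \<bar>w\<bar>) ^ q"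
        using D[OF that(3), of w] by linarith
      moreover have "h * L f f' w \<le> h * K f f' w"
        using that(3) by (intro mult_left_mono LK) auto
      moreover have "C * h\<^sup>2 * (1 + \<bar>w\<bar>) ^ p \<le> C * h\<^sup>2 * (1 + \<bar>w\<bar>) ^ r"
        using \<open>C \<ge> 0\<close> by (intro mult_left_mono weight_mono) (auto simp: r_def)
      moreover have "D * h\<^sup>2 * (1 + \<bar>w\<bar>) ^ q \<le> D * h\<^sup>2 * (1 + \<bar>w\<bar>) ^ r"
        using \<open>D \<ge> 0\<close> by (intro mult_left_mono weight_mono) (auto simp: r_def)
      ultimately show "(\<integral>x. f (w + x) \<partial>\<mu> h) \<le> (\<integral>x. f (w + x) \<partial>\<nu> h) + (C + D) * h\<^sup>2 * (1 + \<bar>w\<bar>) ^ r"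
        unfolding distrib_right by linarith
    qed
    also have "\<dots> = (\<integral>w. (\<integral>x. f (w + x) \<partial>\<nu> h) \<partial>\<rho>) + (C + D) * h\<^sup>2 * (\<integral>w. (1 + \<bar>w\<bar>) ^ r \<partial>\<rho>)"
      by (simp add: integrable_convolution_fst integrable_weight r nh fm fb)
    also have "(C + D) * h\<^sup>2 * (\<integral>w. (1 + \<bar>w\<bar>) ^ r \<partial>\<rho>) \<le> (C + D) * h\<^sup>2 * (A * B)"
      using \<open>C \<ge> 0\<close> \<open>D \<ge> 0\<close> \<open>A \<ge> 0\<close> unfolding \<rho>_def
      by (intro mult_left_mono order.trans[OF integral_weight_convolution] mult_mono A B ma nb that
          Bochner_Integration.integral_nonneg) auto
    finally show ?thesis
      unfolding 1 2 by (simp add: integral_convolution r mh nh fm fb E_def mult_ac)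
  qed
  have bound: "(\<integral>x. f x \<partial>\<mu> s) \<le> (\<integral>x. f x \<partial>\<nu> s) + E * s\<^sup>2 / real (Suc N)" for N
  proof -
    \<comment> \<open>\<open>Suc N\<close> steps keep the divisor positive. The induction below is
      on the number \<open>k\<close> of steps already exchanged.\<close>
    define h where "h = s / real (Suc N)"
    have sh: "s = real (Suc N) * h" by (simp add: h_def)
    have h0: "0 \<le> h" using s by (simp add: h_def)
    have le: "real k * h \<in> {0..1}" if "k \<le> Suc N" for k
    proof -
      have "real k * h \<le> real (Suc N) * h" using that h0 by (intro mult_right_mono) auto
      then show ?thesis using s h0 sh by auto
    qed
    have "(\<integral>x. f x \<partial>\<mu> s) \<le> (\<integral>x. f x \<partial>(\<mu> (real (Suc N - k) * h) \<star> \<nu> (real k * h))) + real k * (E * h\<^sup>2)"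
      if "k \<le> Suc N" for k using that
    proof (induction k)
      case 0
      then show ?case using m[OF s] sh by (simp add: \<nu>0 convolution_return_0)
    next
      case (Suc k)
      have e: "real (Suc N - k) * h = real (Suc N - Suc k) * h + h" "real (Suc k) * h = real k * h + h"
        using Suc.prems by (simp_all add: of_nat_diff algebra_simps)
      have "h \<in> {0..1}" using le[of 1] by simp
      moreover have "real (Suc N - Suc k) * h \<in> {0..1}" "real k * h \<in> {0..1}"
        using Suc.prems by (intro le; simp)+
      ultimately have "(\<integral>x. f x \<partial>(\<mu> (real (Suc N - k) * h) \<star> \<nu> (real k * h)))
          \<le> (\<integral>x. f x \<partial>(\<mu> (real (Suc N - Suc k) * h) \<star> \<nu> (real (Suc k) * h))) + E * h\<^sup>2"
        unfolding e by (intro step)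
      moreover have "real (Suc k) * (E * h\<^sup>2) = real k * (E * h\<^sup>2) + E * h\<^sup>2"
        by (simp add: algebra_simps)
      ultimately show ?case using Suc by linarith
    qed
    from this[of "Suc N"]
    have "(\<integral>x. f x \<partial>\<mu> s) \<le> (\<integral>x. f x \<partial>(return borel 0 \<star> \<nu> s)) + real (Suc N) * (E * h\<^sup>2)"
      unfolding sh[symmetric] by (simp add: \<mu>0)
    also have "(return borel 0 \<star> \<nu> s) = \<nu> s"
      by (simp add: convolution_commute[OF has_moments_return] convolution_return_0 n[OF s])
    finally have "(\<integral>x. f x \<partial>\<mu> s) \<le> (\<integral>x. f x \<partial>\<nu> s) + real (Suc N) * (E * h\<^sup>2)" .
    also have "real (Suc N) * (E * h\<^sup>2) = E * s\<^sup>2 / real (Suc N)"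
      by (simp add: h_def power_divide power2_eq_square)
    finally show ?thesis .
  qed
  have "(\<lambda>N. (\<integral>x. f x \<partial>\<nu> s) + E * s\<^sup>2 / real (Suc N)) \<longlonglongrightarrow> (\<integral>x. f x \<partial>\<nu> s) + 0"
    by (intro tendsto_intros LIMSEQ_Suc lim_const_over_n)
  then show ?thesis
    using bound by (intro LIMSEQ_le_const) auto
qed

section \<open>Gamma distributions\<close>

abbreviation (input) gam :: "real \<Rightarrow> real measure" where
  "gam a \<equiv> gamma_distribution a (1 / 2)"

lemma gamma_density_measurable [measurable]: "gamma_density a b \<in> borel_measurable borel"
  unfolding gamma_density_def[abs_def] by measurable

lemma gamma_density_nonneg: "0 < a \<Longrightarrow> 0 \<le> gamma_density a b x"
  using Gamma_real_pos[of a] by (simp add: gamma_density_def)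

lemma sets_gamma [simp, measurable_cong]: "sets (gamma_distribution a b) = sets borel"
  by (simp add: gamma_distribution_def)

lemma measurable_gamma [simp]: "measurable (gamma_distribution a b) N = measurable borel N"
  by (intro measurable_cong_sets) auto

lemma prob_space_gam: "0 \<le> a \<Longrightarrow> prob_space (gam a)"
  by (rule prob_space_gamma_distribution) auto

lemma gamma_density_size_bias:
  assumes "a > 0" "b > 0"
  shows "x * gamma_density a b x = a / b * gamma_density (a + 1) b x"
proof (cases "x > 0")
  case True
  have "Gamma (a + 1) = a * Gamma a"
    using assms by (intro Gamma_plus1) (auto dest: nonpos_Ints_nonpos)
  moreover have "x * x powr (a - 1) = x powr a" using True by (simp add: powr_mult_base)
  moreover have "b powr (a + 1) = b * b powr a" using assms by (simp add: powr_add)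
  moreover have "Gamma a > 0" using assms by (simp add: Gamma_real_pos)
  ultimately show ?thesis
    using assms True by (simp add: gamma_density_def field_simps)
qed (simp add: gamma_density_def)

text \<open>The factor \<open>x\<close> raises the shape by one and thereby removes the singularity
  of the jump measure at the origin. At rate 1/2 the constant a / (1/2) is 2a. For
  \<open>a = 0\<close> the law is the point mass at 0 and both sides vanish.\<close>

lemma
  assumes a: "0 \<le> a" and [measurable]: "g \<in> borel_measurable borel"
  shows integral_gam_size_bias: "(\<integral>x. x * g x \<partial>gam a) = 2 * a * (\<integral>x. g x \<partial>gam (a + 1))"
    and integrable_gam_size_bias: "integrable (gam (a + 1)) g \<Longrightarrow> integrable (gam a) (\<lambda>x. x * g x)"
proof -
  have eq: "gamma_density a (1 / 2) x * (x * g x) = 2 * a * (gamma_density (a + 1) (1 / 2) x * g x)"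
    if "a \<noteq> 0" for x
  proof -
    have "gamma_density a (1 / 2) x * (x * g x) = (x * gamma_density a (1 / 2) x) * g x" by simp
    also have "x * gamma_density a (1 / 2) x = 2 * a * gamma_density (a + 1) (1 / 2) x"
      using gamma_density_size_bias[of a "1 / 2" x] that a by simp
    finally show ?thesis by simp
  qed
  have nn: "AE x in lborel. 0 \<le> gamma_density c (1 / 2) x" if "c > 0" for c
    using that by (auto intro: gamma_density_nonneg)
  have dist: "gam (a + 1) = density lborel (\<lambda>x. ennreal (gamma_density (a + 1) (1 / 2) x))"
    using a by (simp add: gamma_distribution_def)
  show "(\<integral>x. x * g x \<partial>gam a) = 2 * a * (\<integral>x. g x \<partial>gam (a + 1))"
  proof (cases "a = 0")
    case True
    then show ?thesis by (simp add: gamma_distribution_def integral_return)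
  next
    case False
    then have d: "gam a = density lborel (\<lambda>x. ennreal (gamma_density a (1 / 2) x))"
      by (simp add: gamma_distribution_def)
    show ?thesis
      unfolding d dist using nn[of a] nn[of "a + 1"] a False by (simp add: integral_density eq[OF False])
  qed
  show "integrable (gam a) (\<lambda>x. x * g x)" if i: "integrable (gam (a + 1)) g"
  proof (cases "a = 0")
    case True
    then show ?thesis
      by (simp add: gamma_distribution_def integrable_iff_bounded nn_integral_return)
  next
    case False
    then have d: "gam a = density lborel (\<lambda>x. ennreal (gamma_density a (1 / 2) x))"
      by (simp add: gamma_distribution_def)
    show ?thesis
      using i nn[of a] nn[of "a + 1"] a False unfolding d dist by (simp add: integrable_density eq[OF False])
  qed
qed

lemma AE_gam_nonneg: "AE x in gam a. 0 \<le> x"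
proof (cases "a = 0")
  case True
  then have "gam a = return borel 0" by (simp add: gamma_distribution_def)
  then show ?thesis by (simp only:) (subst AE_return, auto)
next
  case False
  then have "gam a = density lborel (\<lambda>x. ennreal (gamma_density a (1 / 2) x))"
    by (simp add: gamma_distribution_def)
  then show ?thesis by (simp only:) (subst AE_density, auto simp: gamma_density_def)
qed

text \<open>Together with size biasing this reduces weight q + 1 at shape \<open>a\<close> to weight
  \<open>q\<close> at the shapes \<open>a\<close> and a + 1. The inductions on \<open>q\<close>
  below therefore let the shape, or its range, vary.\<close>

lemma weight_Suc_gam: "AE x in gam a. (1 + \<bar>x\<bar>) ^ Suc q = (1 + \<bar>x\<bar>) ^ q + x * (1 + \<bar>x\<bar>) ^ q"
  using AE_gam_nonneg by eventually_elim (simp add: algebra_simps)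

lemma integrable_weight_gam: "0 \<le> a \<Longrightarrow> integrable (gam a) (\<lambda>x. (1 + \<bar>x\<bar>) ^ q)"
proof (induction q arbitrary: a)
  case 0
  then interpret prob_space "gam a" by (intro prob_space_gam)
  show ?case by simp
next
  case (Suc q)
  have "integrable (gam a) (\<lambda>x. (1 + \<bar>x\<bar>) ^ q + x * (1 + \<bar>x\<bar>) ^ q)"
    by (intro Bochner_Integration.integrable_add Suc.IH Suc.prems integrable_gam_size_bias)
      (use Suc.prems in auto)
  then show ?case
    using weight_Suc_gam[where a = a and q = q] by (subst integrable_cong_AE) auto
qed

lemma has_moments_gam: "0 \<le> a \<Longrightarrow> has_moments (gam a)"
  by (simp add: has_moments_def prob_space_gam integrable_weight_gam)

text \<open>Uniformity in the shape is what makes the constants in \<open>generator_gam\<close>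
  independent of \<open>h\<close>.\<close>

lemma gam_moment_bound:
  "\<exists>B. \<forall>a\<in>{0..r}. (\<integral>x. (1 + \<bar>x\<bar>) ^ q \<partial>gam a) \<le> B"
proof (induction q arbitrary: r)
  case 0
  have "(\<integral>x. (1 + \<bar>x\<bar>) ^ 0 \<partial>gam a) \<le> 1" if "a \<in> {0..r}" for a
  proof -
    interpret prob_space "gam a" using that by (intro prob_space_gam) simp
    show ?thesis by (simp add: prob_space)
  qed
  then show ?case by blast
next
  case (Suc q)
  obtain B where B: "\<forall>a\<in>{0..r}. (\<integral>x. (1 + \<bar>x\<bar>) ^ q \<partial>gam a) \<le> B" using Suc by blast
  obtain C where C: "\<forall>a\<in>{0..r + 1}. (\<integral>x. (1 + \<bar>x\<bar>) ^ q \<partial>gam a) \<le> C" using Suc by blast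
  have "(\<integral>x. (1 + \<bar>x\<bar>) ^ Suc q \<partial>gam a) \<le> B + 2 * r * C" if a: "a \<in> {0..r}" for a
  proof -
    have "(\<integral>x. (1 + \<bar>x\<bar>) ^ Suc q \<partial>gam a) = (\<integral>x. (1 + \<bar>x\<bar>) ^ q + x * (1 + \<bar>x\<bar>) ^ q \<partial>gam a)"
      using weight_Suc_gam[where a = a and q = q] by (intro integral_cong_AE) auto
    also have "\<dots> = (\<integral>x. (1 + \<bar>x\<bar>) ^ q \<partial>gam a) + 2 * a * (\<integral>x. (1 + \<bar>x\<bar>) ^ q \<partial>gam (a + 1))"
      using a by (subst Bochner_Integration.integral_add)
        (auto intro!: integrable_weight_gam integrable_gam_size_bias simp: integral_gam_size_bias)
    also have "\<dots> \<le> B + 2 * r * C"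
      using a B C by (intro add_mono mult_mono Bochner_Integration.integral_nonneg) auto
    finally show ?thesis .
  qed
  then show ?case by blast
qed

lemma nn_integral_Beta:
  assumes "a > 0" "b > 0"
  shows "(\<integral>\<^sup>+t. ennreal (t powr (a - 1) * (1 - t) powr (b - 1) * indicator {0..1} t) \<partial>lborel)
    = ennreal (Beta a b)"
proof -
  have "((\<lambda>t. if t \<in> {0..1} then t powr (a - 1) * (1 - t) powr (b - 1) else 0) has_integral Beta a b) UNIV"
    using has_integral_Beta_real[OF assms] by (subst has_integral_restrict_UNIV)
  then have "((\<lambda>t. t powr (a - 1) * (1 - t) powr (b - 1) * indicator {0..1} t) has_integral Beta a b) UNIV"
    by (rule has_integral_eq[rotated]) (auto simp: indicator_def)
  then show ?thesis by (intro nn_integral_has_integral_lborel) auto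
qed

text \<open>For x > 0 the substitution y = x t collects the exponentials into exp (- c x) and leaves
  a Beta integral over [0, 1], which supplies Gamma a * Gamma b / Gamma (a + b).\<close>

lemma convolution_gamma_density:
  assumes a: "a > 0" and b: "b > 0" and c: "c > 0"
  shows "(\<integral>\<^sup>+y. ennreal (gamma_density a c (x - y)) * ennreal (gamma_density b c y) \<partial>lborel)
    = ennreal (gamma_density (a + b) c x)"
proof (cases "x > 0")
  case False
  then have "(\<integral>\<^sup>+y. ennreal (gamma_density a c (x - y)) * ennreal (gamma_density b c y) \<partial>lborel)
      = (\<integral>\<^sup>+y. 0 \<partial>(lborel :: real measure))"
    by (intro nn_integral_cong) (simp add: gamma_density_def)
  with False show ?thesis by (simp add: gamma_density_def)
next
  case True
  let ?k = "c powr a / Gamma a * (c powr b / Gamma b) * exp (- c * x)"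
  have G: "Gamma a > 0" "Gamma b > 0" "Gamma (a + b) > 0"
    using a b by (auto intro: Gamma_real_pos)
  define F where "F y = ennreal (gamma_density a c (x - y)) * ennreal (gamma_density b c y)" for y
  have [measurable]: "F \<in> borel_measurable borel"
    unfolding F_def[abs_def] by measurable
  have "(\<integral>\<^sup>+y. F y \<partial>lborel) = ennreal \<bar>x\<bar> * (\<integral>\<^sup>+t. F (0 + x * t) \<partial>lborel)"
    using True by (intro nn_integral_real_affine) auto
  also have "(\<integral>\<^sup>+t. F (0 + x * t) \<partial>lborel) = (\<integral>\<^sup>+t. ennreal (?k * x powr (a + b - 2)) *
      ennreal (t powr (b - 1) * (1 - t) powr (a - 1) * indicator {0..1} t) \<partial>lborel)"
  proof (rule nn_integral_cong_AE)
    have "AE t in lborel. t \<noteq> (0::real)" "AE t in lborel. t \<noteq> (1::real)"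
      by (rule AE_lborel_singleton)+
    then show "AE t in lborel. F (0 + x * t) = ennreal (?k * x powr (a + b - 2)) *
      ennreal (t powr (b - 1) * (1 - t) powr (a - 1) * indicator {0..1} t)"
    proof eventually_elim
      case (elim t)
      show ?case
      proof (cases "0 < t \<and> t < 1")
        case t: True
        have xt: "x - x * t = x * (1 - t)" by (simp add: algebra_simps)
        have "gamma_density a c (x - x * t) * gamma_density b c (x * t)
            = (c powr a / Gamma a * (c powr b / Gamma b)) * (x powr (a - 1) * x powr (b - 1))
              * (exp (- c * (x * (1 - t))) * exp (- c * (x * t))) * (t powr (b - 1) * (1 - t) powr (a - 1))"
          using t True unfolding xt by (simp add: gamma_density_def powr_mult mult_ac)
        also have "x powr (a - 1) * x powr (b - 1) = x powr (a + b - 2)"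
          by (simp add: powr_add[symmetric] algebra_simps)
        also have "exp (- c * (x * (1 - t))) * exp (- c * (x * t)) = exp (- c * x)"
          by (simp add: exp_add[symmetric] algebra_simps)
        finally show ?thesis
          using t G a b by (simp add: F_def ennreal_mult[symmetric] gamma_density_nonneg mult_ac)
      next
        case False
        with elim have "t < 0 \<or> 1 < t" by auto
        then have "x * t < 0 \<or> x < x * t"
          using True by (auto simp: mult_less_0_iff)
        with \<open>t < 0 \<or> 1 < t\<close> True show ?thesis
          by (auto simp: F_def gamma_density_def indicator_def)
      qed
    qed
  qed
  also have "\<dots> = ennreal (?k * x powr (a + b - 2)) * ennreal (Beta b a)"
    by (subst nn_integral_cmult) (simp_all add: nn_integral_Beta[OF b a])
  also have "ennreal \<bar>x\<bar> * (ennreal (?k * x powr (a + b - 2)) * ennreal (Beta b a))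
      = ennreal (x * (?k * x powr (a + b - 2) * Beta b a))"
    using True G by (simp add: Beta_def ennreal_mult[symmetric] add.commute)
  also have "x * (?k * x powr (a + b - 2) * Beta b a) = gamma_density (a + b) c x"
  proof -
    have "x * x powr (a + b - 2) = x powr (a + b - 1)"
      using True by (simp add: powr_mult_base algebra_simps)
    moreover have "x * (?k * x powr (a + b - 2) * Beta b a) = ?k * (x * x powr (a + b - 2)) * Beta b a"
      by (simp add: mult_ac)
    ultimately show ?thesis
      using True G c by (simp add: gamma_density_def Beta_def powr_add add.commute[of b a])
  qed
  finally show ?thesis by (simp add: F_def)
qed

text \<open>Shape zero is split off because the point mass has no density; it is the unit of
  convolution.\<close>

lemma gam_add:
  assumes "0 \<le> a" "0 \<le> b" shows "gam (a + b) = (gam a \<star> gam b)"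
proof (cases "a = 0 \<or> b = 0")
  case True
  have z: "gam 0 = return borel 0" by (simp add: gamma_distribution_def)
  have "(return borel 0 \<star> gam b) = gam b"
    by (simp add: convolution_commute[OF has_moments_return has_moments_gam]
        convolution_return_0 has_moments_gam assms)
  moreover have "(gam a \<star> return borel 0) = gam a"
    by (simp add: convolution_return_0 has_moments_gam assms)
  ultimately show ?thesis using True by (auto simp: z)
next
  case False
  with assms have ab: "a > 0" "b > 0" by auto
  then have d: "gam a = density lborel (\<lambda>x. ennreal (gamma_density a (1 / 2) x))"
    "gam b = density lborel (\<lambda>x. ennreal (gamma_density b (1 / 2) x))"
    "gam (a + b) = density lborel (\<lambda>x. ennreal (gamma_density (a + b) (1 / 2) x))"
    by (auto simp: gamma_distribution_def)
  have "finite_measure (gam a)" "finite_measure (gam b)"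
    using has_moments_finite_measure has_moments_gam assms by blast+
  then show ?thesis
    unfolding d using ab by (subst convolution_density) (auto simp: convolution_gamma_density)
qed

section \<open>Averaged derivatives and the generator of the Gamma semigroup\<close>

text \<open>For g = f' this is the difference quotient (f (w + z) - f w) / z, continued by f' w at z
  = 0.\<close>

definition avg :: "(real \<Rightarrow> real) \<Rightarrow> real \<Rightarrow> real \<Rightarrow> real" where
  "avg g w z = integral {0..1} (\<lambda>t. g (w + t * z))"

lemma avg_0 [simp]: "avg g w 0 = g w"
  by (simp add: avg_def)

lemma mult_avg:
  assumes "smooth f f'" shows "z * avg f' w z = f (w + z) - f w"
proof -
  have d: "\<And>x. (f has_real_derivative f' x) (at x)" using assms by (simp add: smooth_def)
  have "((\<lambda>t. f (w + t * z)) has_real_derivative f' (w + t * z) * z) (at t)" for t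
    by (rule DERIV_chain2[OF d]) (auto intro!: derivative_eq_intros)
  then have "((\<lambda>t. f' (w + t * z) * z) has_integral f (w + 1 * z) - f (w + 0 * z)) {0..1}"
    by (intro fundamental_theorem_of_calculus)
      (auto simp: has_real_derivative_iff_has_vector_derivative[symmetric] intro: has_field_derivative_at_within)
  then have "integral {0..1} (\<lambda>t. f' (w + t * z) * z) = f (w + z) - f w"
    by (intro integral_unique) simp
  then show ?thesis by (simp add: avg_def mult.commute)
qed

text \<open>Both variables matter: the bound in \<open>w\<close> gives the regularity of the
  generator, the one in \<open>z\<close> the effect of changing the Gamma variable.\<close>

lemma avg_lipschitz:
  assumes "D \<ge> 0" and D: "\<And>x y. \<bar>g x - g y\<bar> \<le> D * \<bar>x - y\<bar> * ((1 + \<bar>x\<bar>) ^ q * (1 + \<bar>y\<bar>) ^ q)"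
  shows "\<bar>avg g w z - avg g w' z'\<bar> \<le> D * (\<bar>w - w'\<bar> + \<bar>z - z'\<bar>)
    * (((1 + \<bar>w\<bar>) ^ q * (1 + \<bar>z\<bar>) ^ q) * ((1 + \<bar>w'\<bar>) ^ q * (1 + \<bar>z'\<bar>) ^ q))"
proof -
  have "poly_lipschitz g" using D by (rule poly_lipschitzI)
  then have g: "continuous_on UNIV g" by (rule poly_lipschitz_continuous)
  have c: "continuous_on {0..1} (\<lambda>t. g (w + t * z))" for w z
    by (rule continuous_on_compose2[OF g]) (auto intro!: continuous_intros)
  note i = integrable_continuous_real[OF c]
  have wt: "(1 + \<bar>w + t * z\<bar>) ^ q \<le> (1 + \<bar>w\<bar>) ^ q * (1 + \<bar>z\<bar>) ^ q" if "t \<in> {0..1}" for w z t :: real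
  proof -
    have "\<bar>t * z\<bar> \<le> \<bar>z\<bar>" using that by (simp add: abs_mult mult_left_le_one_le)
    then have "(1 + \<bar>w\<bar>) ^ q * (1 + \<bar>t * z\<bar>) ^ q \<le> (1 + \<bar>w\<bar>) ^ q * (1 + \<bar>z\<bar>) ^ q"
      by (intro mult_left_mono power_mono) auto
    with weight_add[of w "t * z" q] show ?thesis by linarith
  qed
  have "avg g w z - avg g w' z' = integral {0..1} (\<lambda>t. g (w + t * z) - g (w' + t * z'))"
    unfolding avg_def by (rule integral_diff[symmetric]) (rule i)+
  also have "norm \<dots> \<le> (D * (\<bar>w - w'\<bar> + \<bar>z - z'\<bar>)
    * (((1 + \<bar>w\<bar>) ^ q * (1 + \<bar>z\<bar>) ^ q) * ((1 + \<bar>w'\<bar>) ^ q * (1 + \<bar>z'\<bar>) ^ q))) * (1 - 0)"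
  proof (rule integral_bound)
    fix t :: real assume t: "t \<in> {0..1}"
    have "\<bar>(w + t * z) - (w' + t * z')\<bar> \<le> \<bar>w - w'\<bar> + \<bar>t * (z - z')\<bar>"
      unfolding right_diff_distrib by linarith
    also have "\<bar>t * (z - z')\<bar> \<le> \<bar>z - z'\<bar>" using t by (simp add: abs_mult mult_left_le_one_le)
    finally have "\<bar>(w + t * z) - (w' + t * z')\<bar> \<le> \<bar>w - w'\<bar> + \<bar>z - z'\<bar>" by simp
    then show "norm (g (w + t * z) - g (w' + t * z')) \<le> D * (\<bar>w - w'\<bar> + \<bar>z - z'\<bar>)
        * (((1 + \<bar>w\<bar>) ^ q * (1 + \<bar>z\<bar>) ^ q) * ((1 + \<bar>w'\<bar>) ^ q * (1 + \<bar>z'\<bar>) ^ q))"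
      unfolding real_norm_def using \<open>D \<ge> 0\<close> t
      by (intro order.trans[OF D] mult_mono mult_left_mono wt mult_nonneg_nonneg) auto
  qed (auto intro!: continuous_on_diff c)
  finally show ?thesis by simp
qed

lemma poly_lipschitz_avg:
  assumes g: "poly_lipschitz g" shows "poly_lipschitz (avg g w)"
proof -
  obtain D q where "D \<ge> 0" and
    D: "\<And>x y. \<bar>g x - g y\<bar> \<le> D * \<bar>x - y\<bar> * ((1 + \<bar>x\<bar>) ^ q * (1 + \<bar>y\<bar>) ^ q)"
    using g by (rule poly_lipschitzE) blast
  have "\<bar>avg g w z - avg g w z'\<bar> \<le> (D * (1 + \<bar>w\<bar>) ^ (q * 2)) * \<bar>z - z'\<bar> * ((1 + \<bar>z\<bar>) ^ q * (1 + \<bar>z'\<bar>) ^ q)"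
    for z z'
    using avg_lipschitz[OF \<open>D \<ge> 0\<close> D, of w z w z'] by (simp add: mult_2_right power_add mult_ac)
  then show ?thesis by (rule poly_lipschitzI)
qed

lemma weight_scale: "\<bar>c\<bar> \<le> 1 \<Longrightarrow> (1 + \<bar>c * x :: real\<bar>) ^ q \<le> (1 + \<bar>x\<bar>) ^ q"
  by (intro power_mono add_mono) (auto simp: abs_mult mult_left_le_one_le)

lemma poly_bounded_scale:
  assumes "poly_bounded g" "\<bar>c\<bar> \<le> 1" shows "poly_bounded (\<lambda>x. g (c * x))"
proof -
  obtain C q where "C \<ge> 0" and C: "\<And>x. \<bar>g x\<bar> \<le> C * (1 + \<bar>x\<bar>) ^ q"
    using assms(1) by (rule poly_boundedE) blast
  have "\<bar>g (c * x)\<bar> \<le> C * (1 + \<bar>x\<bar>) ^ q" for x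
    by (rule order.trans[OF C mult_left_mono[OF weight_scale[OF assms(2)] \<open>C \<ge> 0\<close>]])
  then show ?thesis unfolding poly_bounded_def by blast
qed

lemma has_moments_scale:
  assumes m: "has_moments \<mu>" and c: "\<bar>c\<bar> \<le> 1"
  shows "has_moments (distr \<mu> borel (\<lambda>x. c * x))"
proof -
  have meas: "(\<lambda>x. c * x) \<in> borel_measurable \<mu>"
    by (simp add: measurable_cong_sets[OF has_moments_sets[OF m] refl])
  have "integrable \<mu> (\<lambda>x. (1 + \<bar>c * (0 + x)\<bar>) ^ q)" for q
    by (rule integrable_poly_bounded[OF m _ poly_bounded_scale[OF poly_bounded_weight c]]) measurable
  then show ?thesis
    unfolding has_moments_def
    by (simp add: integrable_distr_eq[OF meas] prob_space.prob_space_distr[OF has_moments_prob_space[OF m] meas])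
qed

text \<open>The increment f (w + c x) - f w is x times \<open>c * avg f' w (c * x)\<close>, so size
  biasing yields exactly 2 a h c times an integral against \<open>gam (a * h + 1)\<close>. That law
  is \<open>gam 1\<close> convolved with \<open>gam (a * h)\<close>; dropping the second factor
  changes the integral by O(h), hence the whole by O(h^2).\<close>

lemma generator_gam:
  assumes a: "0 \<le> a" "a \<le> 1" and c: "\<bar>c\<bar> \<le> 1"
  shows "generator (\<lambda>h. distr (gam (a * h)) borel (\<lambda>x. c * x))
    (\<lambda>f f' w. 2 * a * c * (\<integral>v. avg f' w (c * v) \<partial>gam 1))"
proof -
  have ah: "0 \<le> a * h" "a * h \<le> 1" if "h \<in> {0..1}" for h
    using a that by (auto simp: mult_le_one)
  have hm: "has_moments (gam (a * h))" if "h \<in> {0..1}" for h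
    using ah[OF that] by (intro has_moments_gam)
  have abs_moment: "\<exists>B\<ge>0. \<forall>h\<in>{0..1}. (\<integral>x. \<bar>x\<bar> * (1 + \<bar>x\<bar>) ^ q \<partial>gam (a * h)) \<le> B * h" for q
  proof -
    \<comment> \<open>The range ends at 2 because size biasing produces the shape a h + 1, and a h
      \<le> 1.\<close>
    obtain B where B: "\<forall>b\<in>{0..2}. (\<integral>x. (1 + \<bar>x\<bar>) ^ q \<partial>gam b) \<le> B"
      using gam_moment_bound by blast
    have "0 \<le> (\<integral>x. (1 + \<bar>x\<bar>) ^ q \<partial>gam 0)" by (intro Bochner_Integration.integral_nonneg) simp
    also have "\<dots> \<le> B" using B by (rule bspec) simp
    finally have "0 \<le> B" .
    have "(\<integral>x. \<bar>x\<bar> * (1 + \<bar>x\<bar>) ^ q \<partial>gam (a * h)) \<le> 2 * B * h" if h: "h \<in> {0..1}" for h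
    proof -
      have "(\<integral>x. \<bar>x\<bar> * (1 + \<bar>x\<bar>) ^ q \<partial>gam (a * h)) = (\<integral>x. x * (1 + \<bar>x\<bar>) ^ q \<partial>gam (a * h))"
        using AE_gam_nonneg[of "a * h"] by (intro integral_cong_AE) auto
      also have "\<dots> = 2 * (a * h) * (\<integral>x. (1 + \<bar>x\<bar>) ^ q \<partial>gam (a * h + 1))"
        using ah[OF h] by (intro integral_gam_size_bias) auto
      also have "\<dots> \<le> 2 * (1 * h) * B"
        using a h ah[OF h] B by (intro mult_mono mult_right_mono Bochner_Integration.integral_nonneg) auto
      finally show ?thesis by (simp add: mult_ac)
    qed
    with \<open>0 \<le> B\<close> show ?thesis by (intro exI[of _ "2 * B"]) auto
  qed
  show ?thesis
    unfolding generator_def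
  proof (intro conjI ballI allI impI)
    show "has_moments (distr (gam (a * h)) borel (\<lambda>x. c * x))" if "h \<in> {0..1}" for h
      by (intro has_moments_scale hm that c)
    show "\<exists>B. \<forall>h\<in>{0..1}. (\<integral>x. \<bar>x\<bar> * (1 + \<bar>x\<bar>) ^ q \<partial>distr (gam (a * h)) borel (\<lambda>x. c * x)) \<le> B * h" for q
    proof -
      obtain B where B: "\<forall>h\<in>{0..1}. (\<integral>x. \<bar>x\<bar> * (1 + \<bar>x\<bar>) ^ q \<partial>gam (a * h)) \<le> B * h"
        using abs_moment by blast
      have "(\<integral>x. \<bar>x\<bar> * (1 + \<bar>x\<bar>) ^ q \<partial>distr (gam (a * h)) borel (\<lambda>x. c * x)) \<le> B * h"
        if h: "h \<in> {0..1}" for h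
      proof -
        have "integrable (gam (a * h)) (\<lambda>x. \<bar>c * (0 + x)\<bar> * (1 + \<bar>c * (0 + x)\<bar>) ^ q)"
          by (rule integrable_poly_bounded[OF hm[OF h] _ poly_bounded_scale[OF poly_bounded_abs_weight c]]) measurable
        then have "(\<integral>x. \<bar>c * x\<bar> * (1 + \<bar>c * x\<bar>) ^ q \<partial>gam (a * h)) \<le> (\<integral>x. \<bar>x\<bar> * (1 + \<bar>x\<bar>) ^ q \<partial>gam (a * h))"
          using c by (intro integral_mono integrable_abs_weight hm h mult_mono weight_scale)
            (auto simp: abs_mult mult_left_le_one_le)
        also have "\<dots> \<le> B * h" using B h by blast
        finally show ?thesis by (simp add: integral_distr)
      qed
      then show ?thesis by blast
    qed
    fix f f' assume f: "smooth f f'"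
    then have l: "poly_lipschitz f'" by (simp add: smooth_def)
    obtain D q where "D \<ge> 0" and
      D: "\<And>x y. \<bar>f' x - f' y\<bar> \<le> D * \<bar>x - y\<bar> * ((1 + \<bar>x\<bar>) ^ q * (1 + \<bar>y\<bar>) ^ q)"
      using l by (rule poly_lipschitzE) blast
    define G where "G w v = avg f' w (c * v)" for w v
    define J where "J w = (\<integral>v. G w v \<partial>gam 1)" for w
    note g1 = has_moments_gam[of 1, simplified]
    have G: "\<bar>G w v - G w' v'\<bar> \<le> D * (\<bar>w - w'\<bar> + \<bar>v - v'\<bar>)
        * (((1 + \<bar>w\<bar>) ^ q * (1 + \<bar>v\<bar>) ^ q) * ((1 + \<bar>w'\<bar>) ^ q * (1 + \<bar>v'\<bar>) ^ q))" for w v w' v'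
    proof -
      have "\<bar>c * v - c * v'\<bar> \<le> \<bar>v - v'\<bar>"
        using c by (simp add: right_diff_distrib[symmetric] abs_mult mult_left_le_one_le)
      then show ?thesis
        unfolding G_def using \<open>D \<ge> 0\<close>
        by (intro order.trans[OF avg_lipschitz[OF \<open>D \<ge> 0\<close> D]] mult_mono mult_left_mono
            weight_scale c mult_nonneg_nonneg) auto
    qed
    have Gv: "\<bar>G w v - G w v'\<bar> \<le> (D * (1 + \<bar>w\<bar>) ^ (q * 2)) * \<bar>v - v'\<bar> * ((1 + \<bar>v\<bar>) ^ q * (1 + \<bar>v'\<bar>) ^ q)"
      for w v v'
      using G[of w v w v'] by (simp add: mult_2_right power_add mult_ac)
    have Gl: "poly_lipschitz (G w)" for w using Gv by (rule poly_lipschitzI)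
    note Gm = poly_lipschitz_measurable[OF Gl] and Gb = poly_lipschitz_imp_poly_bounded[OF Gl]
    have Gi: "integrable (gam b) (G w)" if "0 \<le> b" for b w
      using integrable_poly_bounded[OF has_moments_gam[OF that] Gm Gb, of w 0] by simp
    define W where "W = (\<integral>v. (1 + \<bar>v\<bar>) ^ (q * 2) \<partial>gam 1)"
    have "W \<ge> 0" unfolding W_def by (intro Bochner_Integration.integral_nonneg) simp
    have Wi: "integrable (gam 1) (\<lambda>v. (1 + \<bar>v\<bar>) ^ (q * 2))" by (rule integrable_weight[OF g1])
    have "\<bar>J w - J w'\<bar> \<le> (D * W) * \<bar>w - w'\<bar> * ((1 + \<bar>w\<bar>) ^ q * (1 + \<bar>w'\<bar>) ^ q)" for w w'
    proof -
      have "\<bar>J w - J w'\<bar> = \<bar>\<integral>v. G w v - G w' v \<partial>gam 1\<bar>"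
        unfolding J_def by (simp add: Gi)
      also have "\<dots> \<le> (\<integral>v. \<bar>G w v - G w' v\<bar> \<partial>gam 1)" by (rule integral_abs_bound)
      also have "\<dots> \<le> (\<integral>v. (D * \<bar>w - w'\<bar> * ((1 + \<bar>w\<bar>) ^ q * (1 + \<bar>w'\<bar>) ^ q)) * (1 + \<bar>v\<bar>) ^ (q * 2) \<partial>gam 1)"
      proof (intro integral_mono integrable_mult_right Wi)
        show "\<bar>G w v - G w' v\<bar> \<le> (D * \<bar>w - w'\<bar> * ((1 + \<bar>w\<bar>) ^ q * (1 + \<bar>w'\<bar>) ^ q)) * (1 + \<bar>v\<bar>) ^ (q * 2)" for v
          using G[of w v w' v] by (simp add: mult_2_right power_add mult_ac)
      qed (simp add: Gi)
      finally show ?thesis by (simp add: W_def mult_ac)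
    qed
    then have "poly_lipschitz J" by (rule poly_lipschitzI)
    then have "poly_lipschitz (\<lambda>w. 2 * a * c * J w)" by (rule poly_lipschitz_cmult)
    then show "poly_lipschitz (\<lambda>w. 2 * a * c * (\<integral>v. avg f' w (c * v) \<partial>gam 1))"
      by (simp only: J_def G_def)
    obtain B where "B \<ge> 0" and B: "\<forall>h\<in>{0..1}. (\<integral>x. \<bar>x\<bar> * (1 + \<bar>x\<bar>) ^ q \<partial>gam (a * h)) \<le> B * h"
      using abs_moment by blast
    have "\<bar>(\<integral>x. f (w + x) \<partial>distr (gam (a * h)) borel (\<lambda>x. c * x)) - f w - h * (2 * a * c * J w)\<bar>
        \<le> (2 * D * B * W) * h\<^sup>2 * (1 + \<bar>w\<bar>) ^ (q * 2)" if h: "h \<in> {0..1}" for h w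
    proof -
      note gm = has_moments_gam[of "a * h", OF ah(1)[OF h]]
      interpret prob_space "gam (a * h)" by (rule has_moments_prob_space[OF gm])
      note fm = smooth_measurable[OF f] and fb = smooth_poly_bounded[OF f]
      have fi: "integrable (gam (a * h)) (\<lambda>x. f (w + c * (0 + x)))"
        by (rule integrable_poly_bounded[OF gm _ poly_bounded_scale[OF poly_bounded_shift[OF fb] c]])
          (use fm in measurable)
      have "(\<integral>x. f (w + x) \<partial>distr (gam (a * h)) borel (\<lambda>x. c * x)) - f w
          = (\<integral>x. f (w + c * x) - f w \<partial>gam (a * h))"
        using fi fm by (simp add: integral_distr prob_space)
      also have "\<dots> = (\<integral>x. x * (c * G w x) \<partial>gam (a * h))"
        using mult_avg[OF f, of "c * _" w] by (simp add: G_def mult_ac)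
      also have "\<dots> = 2 * (a * h) * (\<integral>x. c * G w x \<partial>gam (a * h + 1))"
        using Gm by (intro integral_gam_size_bias ah[OF h]) simp
      also have "(\<integral>x. c * G w x \<partial>gam (a * h + 1)) = c * (\<integral>x. G w x \<partial>(gam 1 \<star> gam (a * h)))"
        using gam_add[of 1 "a * h"] ah[OF h] by (simp add: add.commute)
      also have "(\<integral>x. G w x \<partial>(gam 1 \<star> gam (a * h))) = (\<integral>v. (\<integral>u. G w (v + u) \<partial>gam (a * h)) \<partial>gam 1)"
        by (rule integral_convolution[OF g1 gm Gm Gb])
      finally have eq: "(\<integral>x. f (w + x) \<partial>distr (gam (a * h)) borel (\<lambda>x. c * x)) - f w
          = 2 * (a * h) * (c * (\<integral>v. (\<integral>u. G w (v + u) \<partial>gam (a * h)) \<partial>gam 1))" .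
      have ii: "integrable (gam 1) (\<lambda>v. \<integral>u. G w (v + u) \<partial>gam (a * h))"
        by (rule integrable_convolution_fst[OF g1 gm Gm Gb])
      have "\<bar>(\<integral>v. (\<integral>u. G w (v + u) \<partial>gam (a * h)) \<partial>gam 1) - J w\<bar>
          = \<bar>\<integral>v. (\<integral>u. G w (v + u) \<partial>gam (a * h)) - G w v \<partial>gam 1\<bar>"
        unfolding J_def using ii by (simp add: Gi)
      also have "\<dots> \<le> (\<integral>v. \<bar>(\<integral>u. G w (v + u) \<partial>gam (a * h)) - G w v\<bar> \<partial>gam 1)"
        by (rule integral_abs_bound)
      also have "\<dots> \<le> (\<integral>v. (D * (1 + \<bar>w\<bar>) ^ (q * 2) * (B * h)) * (1 + \<bar>v\<bar>) ^ (q * 2) \<partial>gam 1)"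
      proof (intro integral_mono integrable_mult_right Wi)
        fix v
        have "\<bar>(\<integral>u. G w (v + u) \<partial>gam (a * h)) - G w v\<bar>
            \<le> D * (1 + \<bar>w\<bar>) ^ (q * 2) * (1 + \<bar>v\<bar>) ^ (q * 2) * (\<integral>x. \<bar>x\<bar> * (1 + \<bar>x\<bar>) ^ q \<partial>gam (a * h))"
          using \<open>D \<ge> 0\<close> by (intro lipschitz_increment[OF gm _ Gv]) auto
        also have "\<dots> \<le> D * (1 + \<bar>w\<bar>) ^ (q * 2) * (1 + \<bar>v\<bar>) ^ (q * 2) * (B * h)"
          using \<open>D \<ge> 0\<close> B h by (intro mult_left_mono) auto
        finally show "\<bar>(\<integral>u. G w (v + u) \<partial>gam (a * h)) - G w v\<bar>
            \<le> (D * (1 + \<bar>w\<bar>) ^ (q * 2) * (B * h)) * (1 + \<bar>v\<bar>) ^ (q * 2)" by (simp add: mult_ac)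
      qed (use ii Gi in auto)
      finally have d: "\<bar>(\<integral>v. (\<integral>u. G w (v + u) \<partial>gam (a * h)) \<partial>gam 1) - J w\<bar>
          \<le> D * (1 + \<bar>w\<bar>) ^ (q * 2) * (B * h) * W" by (simp add: W_def)
      have "\<bar>2 * (a * h) * c\<bar> \<le> 2 * h"
        using mult_right_mono[of "a * \<bar>c\<bar>" 1 h] mult_le_one[of a "\<bar>c\<bar>"] a c h
        by (simp add: abs_mult mult_ac)
      then have "\<bar>2 * (a * h) * c\<bar> * \<bar>(\<integral>v. (\<integral>u. G w (v + u) \<partial>gam (a * h)) \<partial>gam 1) - J w\<bar>
          \<le> 2 * h * (D * (1 + \<bar>w\<bar>) ^ (q * 2) * (B * h) * W)"
        using h by (intro mult_mono d) auto
      then show ?thesis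
        unfolding eq abs_mult[symmetric] by (simp add: algebra_simps power2_eq_square)
    qed
    then show "\<exists>C q. \<forall>h\<in>{0..1}. \<forall>w. \<bar>(\<integral>x. f (w + x) \<partial>distr (gam (a * h)) borel (\<lambda>x. c * x)) - f w
        - h * (2 * a * c * (\<integral>v. avg f' w (c * v) \<partial>gam 1))\<bar> \<le> C * h\<^sup>2 * (1 + \<bar>w\<bar>) ^ q"
      unfolding J_def G_def by blast
  qed
qed

section \<open>Convolution semigroups and the comparison for a single Gamma variable\<close>

definition conv_semigroup :: "(real \<Rightarrow> real measure) \<Rightarrow> bool" where
  "conv_semigroup \<mu> \<longleftrightarrow> (\<forall>s\<ge>0. has_moments (\<mu> s)) \<and> \<mu> 0 = return borel 0 \<and>
     (\<forall>s\<ge>0. \<forall>t\<ge>0. \<mu> (s + t) = (\<mu> s \<star> \<mu> t))"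

lemma convolution_interchange:
  assumes "has_moments a" "has_moments b" "has_moments c" "has_moments d"
  shows "((a \<star> b) \<star> (c \<star> d)) = ((a \<star> c) \<star> (b \<star> d))"
proof -
  have "((a \<star> b) \<star> (c \<star> d)) = (a \<star> ((b \<star> c) \<star> d))"
    using assms by (simp add: convolution_assoc has_moments_convolution)
  also have "(b \<star> c) = (c \<star> b)" using assms by (intro convolution_commute)
  also have "(a \<star> ((c \<star> b) \<star> d)) = ((a \<star> c) \<star> (b \<star> d))"
    using assms by (simp add: convolution_assoc has_moments_convolution)
  finally show ?thesis .
qed

lemma conv_semigroup_convolution:
  assumes "conv_semigroup \<mu>" "conv_semigroup \<nu>"
  shows "conv_semigroup (\<lambda>s. \<mu> s \<star> \<nu> s)"
  using assms unfolding conv_semigroup_def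
  by (auto simp: has_moments_convolution convolution_interchange convolution_return_0 has_moments_return)

lemma conv_semigroup_return: "conv_semigroup (\<lambda>s. return borel (c * s))"
  unfolding conv_semigroup_def
  by (auto simp: has_moments_return convolution_return distr_return distrib_left)

lemma emeasure_distr_nn_integral:
  assumes "f \<in> measurable M N" "A \<in> sets N"
  shows "emeasure (distr M N f) A = (\<integral>\<^sup>+x. indicator A (f x) \<partial>M)"
proof -
  have "emeasure (distr M N f) A = (\<integral>\<^sup>+x. indicator A x \<partial>distr M N f)"
    using assms by simp
  also have "\<dots> = (\<integral>\<^sup>+x. indicator A (f x) \<partial>M)"
    using assms by (intro nn_integral_distr) auto
  finally show ?thesis .
qed

lemma distr_scale_convolution:
  fixes c :: real
  assumes m: "has_moments \<mu>" and n: "has_moments \<nu>" and c: "\<bar>c\<bar> \<le> 1"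
  shows "distr (\<mu> \<star> \<nu>) borel (\<lambda>x. c * x) = (distr \<mu> borel (\<lambda>x. c * x) \<star> distr \<nu> borel (\<lambda>x. c * x))"
proof (rule measure_eqI)
  have meas: "(\<lambda>x. c * x) \<in> borel_measurable \<mu>" "(\<lambda>x. c * x) \<in> borel_measurable \<nu>"
    by (simp_all add: measurable_cong_sets[OF has_moments_sets[OF m] refl] measurable_cong_sets[OF has_moments_sets[OF n] refl])
  fix A assume "A \<in> sets (distr (\<mu> \<star> \<nu>) borel (\<lambda>x. c * x))"
  then have A[measurable]: "A \<in> sets borel" by simp
  have i: "(\<lambda>x. indicator A (c * x) :: ennreal) \<in> borel_measurable borel" by measurable
  have s: "sigma_finite_measure (distr \<nu> borel (\<lambda>x. c * x))"
    using has_moments_scale[OF n c]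
    by (intro finite_measure.sigma_finite_measure has_moments_finite_measure)
  have bm: "(\<lambda>x. \<integral>\<^sup>+y. indicator A (x + y) \<partial>distr \<nu> borel (\<lambda>x. c * x)) \<in> borel_measurable borel"
    by (rule sigma_finite_measure.borel_measurable_nn_integral[OF s],
        subst measurable_cong_sets[OF sets_pair_measure_cong[OF refl sets_distr] refl]) measurable
  have "emeasure (distr (\<mu> \<star> \<nu>) borel (\<lambda>x. c * x)) A = (\<integral>\<^sup>+x. indicator A (c * x) \<partial>(\<mu> \<star> \<nu>))"
    by (intro emeasure_distr_nn_integral) simp_all
  also have "\<dots> = (\<integral>\<^sup>+x. (\<integral>\<^sup>+y. indicator A (c * (x + y)) \<partial>\<nu>) \<partial>\<mu>)"
    by (intro nn_integral_convolution has_moments_finite_measure has_moments_sets m n i)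
  also have "\<dots> = (\<integral>\<^sup>+x. (\<integral>\<^sup>+y. indicator A (x + y) \<partial>distr \<nu> borel (\<lambda>x. c * x)) \<partial>distr \<mu> borel (\<lambda>x. c * x))"
    using meas bm by (simp add: nn_integral_distr distrib_left)
  also have "\<dots> = emeasure (distr \<mu> borel (\<lambda>x. c * x) \<star> distr \<nu> borel (\<lambda>x. c * x)) A"
    by (intro convolution_emeasure'[symmetric] has_moments_finite_measure has_moments_sets has_moments_scale m n c A)
  finally show "emeasure (distr (\<mu> \<star> \<nu>) borel (\<lambda>x. c * x)) A
      = emeasure (distr \<mu> borel (\<lambda>x. c * x) \<star> distr \<nu> borel (\<lambda>x. c * x)) A" .
qed simp

lemma conv_semigroup_gam:
  assumes a: "0 \<le> a" and c: "\<bar>c\<bar> \<le> 1"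
  shows "conv_semigroup (\<lambda>s. distr (gam (a * s)) borel (\<lambda>x. c * x))"
  unfolding conv_semigroup_def
proof (intro conjI allI impI)
  show "has_moments (distr (gam (a * s)) borel (\<lambda>x. c * x))" if "0 \<le> s" for s
    using a that by (intro has_moments_scale has_moments_gam c) simp
  show "distr (gam (a * 0)) borel (\<lambda>x. c * x) = return borel 0"
    by (simp add: gamma_distribution_def distr_return)
  show "distr (gam (a * (s + t))) borel (\<lambda>x. c * x) =
      (distr (gam (a * s)) borel (\<lambda>x. c * x) \<star> distr (gam (a * t)) borel (\<lambda>x. c * x))"
    if "0 \<le> s" "0 \<le> t" for s t
    using a that by (simp add: distrib_left gam_add distr_scale_convolution has_moments_gam c)
qed

text \<open>This is \<open>test_function_taylor_le\<close> divided by v > 0. At v = 0 both sides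
  equal l f' w, since the jump weights differ by l^3 and the drift contributes l - l^3.\<close>

lemma avg_generator_le:
  assumes f: "test_function f f' f''" and l: "- 1 \<le> l" "l \<le> 1" and v: "0 \<le> v"
  shows "l * avg f' w (l * v)
    \<le> l\<^sup>2 * (1 + l) / 2 * avg f' w v - l\<^sup>2 * (1 - l) / 2 * avg f' w (- v) + (l - l ^ 3) * f' w"
proof (cases "v = 0")
  case True
  then show ?thesis by (simp add: field_simps power3_eq_cube power2_eq_square)
next
  case False
  then have "v > 0" using v by simp
  note s = mult_avg[OF test_function_smooth[OF f], of _ w]
  have e: "f (w + l * v) - f w = l * v * avg f' w (l * v)" "f (w + v) - f w = v * avg f' w v"
    "f (w - v) - f w = - v * avg f' w (- v)"
    using s[of "l * v"] s[of v] s[of "- v"] by simp_all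
  \<comment> \<open>Exhibits the common factor \<open>v\<close> that is cancelled below.\<close>
  have id: "v * (l\<^sup>2 * (p * (x - y) + q * (y - z))) = l\<^sup>2 * (p * (v * x - v * y) + q * (- v * z + v * y))"
    for p q x y z by (simp add: algebra_simps)
  have "v * (l * avg f' w (l * v) - l * f' w)
      \<le> v * (l\<^sup>2 * ((1 + l) / 2 * (avg f' w v - f' w) + (1 - l) / 2 * (f' w - avg f' w (- v))))"
    using test_function_taylor_le[OF f l v, of w] unfolding e id unfolding right_diff_distrib by (simp only: mult_ac)
  then have "l * avg f' w (l * v) - l * f' w
      \<le> l\<^sup>2 * ((1 + l) / 2 * (avg f' w v - f' w) + (1 - l) / 2 * (f' w - avg f' w (- v)))"
    using \<open>v > 0\<close> by (simp only: mult_le_cancel_left_pos)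
  then show ?thesis
    by (simp add: field_simps power3_eq_cube power2_eq_square)
qed

text \<open>At rate \<open>1 / 2\<close> the measure \<open>gam a\<close> has mean \<open>2 * a\<close>, so \<open>gam_diff a b\<close> is centered.\<close>

definition gam_diff :: "real \<Rightarrow> real \<Rightarrow> real measure" where
  "gam_diff a b = ((gam a \<star> distr (gam b) borel (\<lambda>x. - x)) \<star> return borel (- (2 * (a - b))))"

lemma has_moments_gam_uminus: "0 \<le> b \<Longrightarrow> has_moments (distr (gam b) borel (\<lambda>x. - x))"
  using has_moments_scale[OF has_moments_gam, of b "- 1"] by simp

lemma gam_diff_add:
  assumes "0 \<le> a" "0 \<le> b" "0 \<le> a'" "0 \<le> b'"
  shows "gam_diff (a + a') (b + b') = (gam_diff a b \<star> gam_diff a' b')"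
proof -
  have u: "distr (gam (b + b')) borel (\<lambda>x. - x)
      = (distr (gam b) borel (\<lambda>x. - x) \<star> distr (gam b') borel (\<lambda>x. - x))"
    using distr_scale_convolution[OF has_moments_gam has_moments_gam, of b b' "- 1"] assms
    by (simp add: gam_add)
  have r: "return borel (- (2 * (a + a' - (b + b'))))
      = (return borel (- (2 * (a - b))) \<star> return borel (- (2 * (a' - b'))))"
    by (simp add: convolution_return has_moments_return distr_return algebra_simps)
  have "((gam a \<star> gam a') \<star> (distr (gam b) borel (\<lambda>x. - x) \<star> distr (gam b') borel (\<lambda>x. - x)))
      = ((gam a \<star> distr (gam b) borel (\<lambda>x. - x)) \<star> (gam a' \<star> distr (gam b') borel (\<lambda>x. - x)))"
    using assms by (intro convolution_interchange has_moments_gam has_moments_gam_uminus)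
  then show ?thesis
    unfolding gam_diff_def u r gam_add[OF assms(1,3)] using assms
    by (simp only:) (intro convolution_interchange has_moments_convolution has_moments_gam
        has_moments_gam_uminus has_moments_return)
qed

text \<open>The shape \<open>s\<close> plays the role of time. The two semigroups are compared
  before centering, and both sides are then translated by - 2 l s, which centers them since they
  have equal means.\<close>

lemma le_3convex_gam_diff:
  assumes l: "- 1 \<le> l" "l \<le> 1" and s: "s \<in> {0..1}"
  shows "le_3convex (distr (gam s) borel (\<lambda>x. l * (x - 2 * s)))
    (gam_diff (l\<^sup>2 * (1 + l) / 2 * s) (l\<^sup>2 * (1 - l) / 2 * s))"
proof -
  define a where "a = l\<^sup>2 * (1 + l) / 2"
  define b where "b = l\<^sup>2 * (1 - l) / 2"
  have l2: "l\<^sup>2 \<le> 1" using l by (simp add: abs_square_le_1)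
  have a: "0 \<le> a" "a \<le> 1" and b: "0 \<le> b" "b \<le> 1"
    using l l2 mult_le_one[of "l\<^sup>2" "(1 + l) / 2"] mult_le_one[of "l\<^sup>2" "(1 - l) / 2"]
    by (auto simp: a_def b_def)
  have ab: "a - b = l ^ 3" by (simp add: a_def b_def field_simps power3_eq_cube power2_eq_square)
  have l': "\<bar>l\<bar> \<le> 1" using l by simp
  \<comment> \<open>The factors 1 and - 1 are kept visible so that the results on scaled Gamma laws
    apply literally to all three Gamma semigroups.\<close>
  define \<mu> where "\<mu> = (\<lambda>t. distr (gam (1 * t)) borel (\<lambda>x. l * x))"
  \<comment> \<open>The drift 2 (l - l^3) equalises the means: the Gamma difference has mean 2 (a -
    b) t = 2 l^3 t, while the mean of \<open>\<mu> t\<close> is 2 l t.\<close>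
  define \<nu> where "\<nu> = (\<lambda>t. (distr (gam (a * t)) borel (\<lambda>x. 1 * x) \<star> distr (gam (b * t)) borel (\<lambda>x. - 1 * x))
      \<star> return borel (2 * (l - l ^ 3) * t))"
  have g\<mu>: "generator \<mu> (\<lambda>f f' w. 2 * 1 * l * (\<integral>v. avg f' w (l * v) \<partial>gam 1))"
    unfolding \<mu>_def using l' by (intro generator_gam) auto
  have g\<nu>: "generator \<nu> (\<lambda>f f' w. (2 * a * 1 * (\<integral>v. avg f' w (1 * v) \<partial>gam 1)
      + 2 * b * (- 1) * (\<integral>v. avg f' w (- 1 * v) \<partial>gam 1)) + 2 * (l - l ^ 3) * f' w)"
    unfolding \<nu>_def using a b by (intro generator_convolution generator_gam generator_return) auto
  have s\<mu>: "conv_semigroup \<mu>"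
    unfolding \<mu>_def using l' by (intro conv_semigroup_gam) auto
  have s\<nu>: "conv_semigroup \<nu>"
    unfolding \<nu>_def using a b by (intro conv_semigroup_convolution conv_semigroup_gam conv_semigroup_return) auto
  have "le_3convex (\<mu> s) (\<nu> s)"
    unfolding le_3convex_def
  proof (intro conjI allI impI)
    show "has_moments (\<mu> s)" "has_moments (\<nu> s)"
      using s\<mu> s\<nu> s by (auto simp: conv_semigroup_def)
    fix f f' f'' assume f: "test_function f f' f''"
    have fl: "poly_lipschitz f'" using test_function_smooth[OF f] by (simp add: smooth_def)
    show "(\<integral>x. f x \<partial>\<mu> s) \<le> (\<integral>x. f x \<partial>\<nu> s)"
    proof (rule generator_compare[OF g\<mu> g\<nu> _ _ _ _ test_function_smooth[OF f] _ s])
      fix w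
      have g1: "has_moments (gam 1)" by (rule has_moments_gam) simp
      interpret prob_space "gam 1" by (rule has_moments_prob_space[OF g1])
      have i: "integrable (gam 1) (\<lambda>v. avg f' w (c * v))" if "\<bar>c\<bar> \<le> 1" for c
      proof -
        note p = poly_lipschitz_avg[OF fl, of w]
        have "integrable (gam 1) (\<lambda>v. avg f' w (c * (0 + v)))"
          by (rule integrable_poly_bounded[OF g1 _ poly_bounded_scale[OF poly_lipschitz_imp_poly_bounded[OF p] that]])
            (use poly_lipschitz_measurable[OF p] in measurable)
        then show ?thesis by simp
      qed
      have i1: "integrable (gam 1) (\<lambda>v. avg f' w v)" using i[of 1] by simp
      have i2: "integrable (gam 1) (\<lambda>v. avg f' w (- v))" using i[of "- 1"] by simp
      have i3: "integrable (gam 1) (\<lambda>v. avg f' w (l * v))" using i l' by simp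
      have "(\<integral>v. l * avg f' w (l * v) \<partial>gam 1)
          \<le> (\<integral>v. a * avg f' w v - b * avg f' w (- v) + (l - l ^ 3) * f' w \<partial>gam 1)"
      proof (rule integral_mono_AE)
        \<comment> \<open>The pointwise inequality needs v \<ge> 0, and the exponential law is
          carried by such \<open>v\<close>.\<close>
        show "AE v in gam 1. l * avg f' w (l * v) \<le> a * avg f' w v - b * avg f' w (- v) + (l - l ^ 3) * f' w"
          using AE_gam_nonneg[of 1] unfolding a_def b_def
          by eventually_elim (rule avg_generator_le[OF f l])
      qed (use i1 i2 i3 in auto)
      also have "\<dots> = a * (\<integral>v. avg f' w v \<partial>gam 1) - b * (\<integral>v. avg f' w (- v) \<partial>gam 1) + (l - l ^ 3) * f' w"
        using i1 i2 by (simp add: prob_space)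
      finally have le: "l * (\<integral>v. avg f' w (l * v) \<partial>gam 1)
          \<le> a * (\<integral>v. avg f' w v \<partial>gam 1) - b * (\<integral>v. avg f' w (- v) \<partial>gam 1) + (l - l ^ 3) * f' w"
        by simp
      show "2 * 1 * l * (\<integral>v. avg f' w (l * v) \<partial>gam 1)
          \<le> (2 * a * 1 * (\<integral>v. avg f' w (1 * v) \<partial>gam 1)
            + 2 * b * (- 1) * (\<integral>v. avg f' w (- 1 * v) \<partial>gam 1)) + 2 * (l - l ^ 3) * f' w"
        using mult_left_mono[OF le, of 2] by (simp add: algebra_simps)
    qed (use s\<mu> s\<nu> in \<open>auto simp: conv_semigroup_def\<close>)
  qed
  then have "le_3convex (\<mu> s \<star> return borel (- (2 * l * s))) (\<nu> s \<star> return borel (- (2 * l * s)))"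
    by (intro le_3convex_convolution le_3convex_refl has_moments_return)
  moreover have "(\<mu> s \<star> return borel (- (2 * l * s))) = distr (gam s) borel (\<lambda>x. l * (x - 2 * s))"
  proof -
    have "has_moments (\<mu> s)" using s\<mu> s by (simp add: conv_semigroup_def)
    then have "(\<mu> s \<star> return borel (- (2 * l * s))) = distr (\<mu> s) borel (\<lambda>x. x + - (2 * l * s))"
      by (rule convolution_return)
    also have "\<dots> = distr (gam s) borel (\<lambda>x. l * (x - 2 * s))"
      unfolding \<mu>_def by (subst distr_distr) (simp_all add: o_def algebra_simps)
    finally show ?thesis .
  qed
  moreover have "(\<nu> s \<star> return borel (- (2 * l * s))) = gam_diff (a * s) (b * s)"
  proof -
    have nn: "0 \<le> a * s" "0 \<le> b * s" using a b s by auto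
    have "(return borel (2 * (l - l ^ 3) * s) \<star> return borel (- (2 * l * s))) = return borel (- (2 * (a * s - b * s)))"
      by (simp add: convolution_return has_moments_return distr_return left_diff_distrib[symmetric] ab algebra_simps)
    moreover have "\<nu> s = ((gam (a * s) \<star> distr (gam (b * s)) borel (\<lambda>x. - x)) \<star> return borel (2 * (l - l ^ 3) * s))"
    proof -
      have "(\<lambda>x::real. 1 * x) = (\<lambda>x. x)" "(\<lambda>x::real. - 1 * x) = (\<lambda>x. - x)" by auto
      then show ?thesis by (simp only: \<nu>_def) (simp add: distr_id2)
    qed
    ultimately show ?thesis
      unfolding gam_diff_def using nn
      by (simp only: convolution_assoc[symmetric] has_moments_convolution has_moments_gam
        has_moments_gam_uminus has_moments_return)
  qed
  ultimately show ?thesis by (simp add: a_def b_def)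
qed

section \<open>Squares of standard normal variables\<close>

text \<open>The substitution rule is applied on the bounded intervals [0, n + 1]. They and their
  images [0, (n + 1)^2] both exhaust the half-line, so monotone convergence finishes.\<close>

lemma nn_integral_square_substitution:
  fixes f :: "real \<Rightarrow> ennreal"
  assumes f[measurable]: "f \<in> borel_measurable borel"
  shows "(\<integral>\<^sup>+x. f (x\<^sup>2) * ennreal (2 * x) * indicator {0..} x \<partial>lborel) = (\<integral>\<^sup>+y. f y * indicator {0..} y \<partial>lborel)"
proof -
  have "(\<integral>\<^sup>+x. f (x\<^sup>2) * ennreal (2 * x) * indicator {0..} x \<partial>lborel)
      = (\<integral>\<^sup>+x. (SUP n. f (x\<^sup>2) * ennreal (2 * x) * indicator {0..real (Suc n)} x) \<partial>lborel)"
  proof (intro nn_integral_cong antisym SUP_least)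
    fix x :: real
    obtain n where n: "x \<le> real n" using real_arch_simple by blast
    show "f (x\<^sup>2) * ennreal (2 * x) * indicator {0..} x
        \<le> (SUP n. f (x\<^sup>2) * ennreal (2 * x) * indicator {0..real (Suc n)} x)"
      by (rule SUP_upper2[of n]) (use n in \<open>auto simp: indicator_def\<close>)
  qed (auto simp: indicator_def)
  also have "\<dots> = (SUP n. \<integral>\<^sup>+x. f (x\<^sup>2) * ennreal (2 * x) * indicator {0..real (Suc n)} x \<partial>lborel)"
    by (intro nn_integral_monotone_convergence_SUP) (auto simp: incseq_def le_fun_def indicator_def)
  also have "\<dots> = (SUP n. \<integral>\<^sup>+y. f y * indicator {0..(real (Suc n))\<^sup>2} y \<partial>lborel)"
  proof (intro SUP_cong refl)
    fix n
    have "(\<integral>\<^sup>+y. f y * indicator {0\<^sup>2..(real (Suc n))\<^sup>2} y \<partial>lborel)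
        = (\<integral>\<^sup>+x. f (x\<^sup>2) * ennreal (2 * x) * indicator {0..real (Suc n)} x \<partial>lborel)"
      by (rule nn_integral_substitution_aux[where g = "\<lambda>x. x\<^sup>2" and g' = "\<lambda>x. 2 * x"])
        (auto intro!: derivative_eq_intros continuous_intros)
    then show "(\<integral>\<^sup>+x. f (x\<^sup>2) * ennreal (2 * x) * indicator {0..real (Suc n)} x \<partial>lborel)
        = (\<integral>\<^sup>+y. f y * indicator {0..(real (Suc n))\<^sup>2} y \<partial>lborel)" by simp
  qed
  also have "\<dots> = (\<integral>\<^sup>+y. (SUP n. f y * indicator {0..(real (Suc n))\<^sup>2} y) \<partial>lborel)"
  proof (intro nn_integral_monotone_convergence_SUP[symmetric])
    show "incseq (\<lambda>n y. f y * indicator {0..(real (Suc n))\<^sup>2} y)"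
    proof (intro incseq_SucI le_funI mult_left_mono)
      fix n and y :: real
      have "(real (Suc n))\<^sup>2 \<le> (real (Suc (Suc n)))\<^sup>2" by (intro power_mono) auto
      then show "indicator {0..(real (Suc n))\<^sup>2} y \<le> (indicator {0..(real (Suc (Suc n)))\<^sup>2} y :: ennreal)"
        by (intro indicator_leI) (meson atLeastAtMost_iff order_trans)
    qed simp
  qed simp
  also have "\<dots> = (\<integral>\<^sup>+y. f y * indicator {0..} y \<partial>lborel)"
  proof (intro nn_integral_cong antisym SUP_least)
    fix y :: real
    obtain n where n: "y \<le> real n" using real_arch_simple by blast
    have "real n \<le> (real (Suc n))\<^sup>2" by (simp add: power2_eq_square algebra_simps)
    with n have "y \<le> (real (Suc n))\<^sup>2" by linarith
    then show "f y * indicator {0..} y \<le> (SUP n. f y * indicator {0..(real (Suc n))\<^sup>2} y)"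
      by (intro SUP_upper2[of n]) (auto simp: indicator_def)
  qed (auto simp: indicator_def)
  finally show ?thesis .
qed

text \<open>Gamma (1/2) = sqrt pi matches the normal constant. On the left, 2 x is the Jacobian of
  squaring; on the right, 2 counts the preimages x and - x.\<close>

lemma gamma_density_square:
  assumes "x > 0"
  shows "gamma_density (1 / 2) (1 / 2) (x\<^sup>2) * (2 * x) = 2 * std_normal_density x"
proof -
  have "(x\<^sup>2) powr (1 / 2 - 1) = (x\<^sup>2) powr (1 / 2) / x\<^sup>2"
    using assms by (subst powr_diff) simp
  also have "(x\<^sup>2) powr (1 / 2) = x"
    using assms by (simp add: powr_half_sqrt)
  also have "x / x\<^sup>2 = 1 / x" by (simp add: power2_eq_square)
  finally have "(x\<^sup>2) powr (1 / 2 - 1) = 1 / x" .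
  moreover have "(1 / 2 :: real) powr (1 / 2) = 1 / sqrt 2"
    by (simp add: powr_half_sqrt real_sqrt_divide)
  ultimately have "gamma_density (1 / 2) (1 / 2) (x\<^sup>2)
      = (1 / sqrt 2) / Gamma (1 / 2) * (1 / x) * exp (- (1 / 2) * x\<^sup>2)"
    using assms by (simp only: gamma_density_def if_True zero_less_power)
  then show ?thesis
    using assms by (simp add: std_normal_density_def Gamma_one_half_real real_sqrt_mult field_simps)
qed

text \<open>The normal density is even, so the two half-lines contribute equally; their sum is the
  doubled density to which the substitution y = x^2 applies.\<close>

lemma distr_square_std_normal:
  assumes "distributed P lborel Y std_normal_density"
  shows "distr P borel (\<lambda>\<omega>. (Y \<omega>)\<^sup>2) = gam (1 / 2)"
proof (rule measure_eqI)
  have Y: "Y \<in> borel_measurable P" using assms by (auto simp: distributed_def)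
  fix A assume "A \<in> sets (distr P borel (\<lambda>\<omega>. (Y \<omega>)\<^sup>2))"
  then have A[measurable]: "A \<in> sets borel" by simp
  define g where "g x = ennreal (std_normal_density x) * indicator A (x\<^sup>2)" for x
  have [measurable]: "g \<in> borel_measurable borel" unfolding g_def[abs_def] by measurable
  define f where "f y = ennreal (gamma_density (1 / 2) (1 / 2) y) * indicator A y" for y
  have [measurable]: "f \<in> borel_measurable borel" unfolding f_def[abs_def] by measurable
  have gp: "(\<lambda>x. g x * indicator {0..} x) \<in> borel_measurable lborel"
    unfolding measurable_lborel1 measurable_lborel2 by measurable
  have gn: "(\<lambda>x. g x * indicator {..0} x) \<in> borel_measurable lborel"
    unfolding measurable_lborel1 measurable_lborel2 by measurable
  have even: "g (- x) = g x" for x by (simp add: g_def std_normal_density_def)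
  have "emeasure (distr P borel (\<lambda>\<omega>. (Y \<omega>)\<^sup>2)) A = (\<integral>\<^sup>+\<omega>. indicator A ((Y \<omega>)\<^sup>2) \<partial>P)"
    using Y by (intro emeasure_distr_nn_integral A) measurable
  also have "\<dots> = (\<integral>\<^sup>+x. g x \<partial>lborel)"
    unfolding g_def by (rule distributed_nn_integral[OF assms, symmetric]) measurable
  also have "\<dots> = (\<integral>\<^sup>+x. g x * indicator {0..} x + g x * indicator {..0} x \<partial>lborel)"
  proof (rule nn_integral_cong_AE)
    have "AE x in lborel. x \<noteq> (0::real)" by (rule AE_lborel_singleton)
    then show "AE x in lborel. g x = g x * indicator {0..} x + g x * indicator {..0} x"
      by eventually_elim (auto simp: indicator_def)
  qed
  also have "\<dots> = (\<integral>\<^sup>+x. g x * indicator {0..} x \<partial>lborel) + (\<integral>\<^sup>+x. g x * indicator {..0} x \<partial>lborel)"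
    by (rule nn_integral_add[OF gp gn])
  also have "(\<integral>\<^sup>+x. g x * indicator {..0} x \<partial>lborel) = (\<integral>\<^sup>+x. g x * indicator {0..} x \<partial>lborel)"
    using nn_integral_real_affine[of "\<lambda>x. g x * indicator {..0} x" "- 1" 0]
    by (simp add: even indicator_def)
  also have "(\<integral>\<^sup>+x. g x * indicator {0..} x \<partial>lborel) + (\<integral>\<^sup>+x. g x * indicator {0..} x \<partial>lborel)
      = (\<integral>\<^sup>+x. g x * indicator {0..} x + g x * indicator {0..} x \<partial>lborel)"
    by (rule nn_integral_add[OF gp gp, symmetric])
  also have "\<dots> = (\<integral>\<^sup>+x. f (x\<^sup>2) * ennreal (2 * x) * indicator {0..} x \<partial>lborel)"
  proof (rule nn_integral_cong_AE)
    have "AE x in lborel. x \<noteq> (0::real)" by (rule AE_lborel_singleton)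
    then show "AE x in lborel. g x * indicator {0..} x + g x * indicator {0..} x
        = f (x\<^sup>2) * ennreal (2 * x) * indicator {0..} x"
    proof eventually_elim
      case (elim x)
      show ?case
      proof (cases "x > 0")
        case True
        have "ennreal (gamma_density (1 / 2) (1 / 2) (x\<^sup>2)) * ennreal (2 * x)
            = ennreal (std_normal_density x) + ennreal (std_normal_density x)"
          using gamma_density_square[OF True] True gamma_density_nonneg[of "1 / 2" "1 / 2" "x\<^sup>2"]
          by (simp add: ennreal_mult[symmetric] ennreal_plus[symmetric] del: ennreal_plus)
        then show ?thesis
          using True by (auto simp: f_def g_def indicator_def)
      qed (use elim in auto)
    qed
  qed
  also have "\<dots> = (\<integral>\<^sup>+y. f y * indicator {0..} y \<partial>lborel)"
    by (rule nn_integral_square_substitution) simp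
  also have "\<dots> = (\<integral>\<^sup>+y. f y \<partial>lborel)"
    by (intro nn_integral_cong) (auto simp: f_def gamma_density_def indicator_def)
  also have "\<dots> = emeasure (gam (1 / 2)) A"
    by (simp add: f_def gamma_distribution_def emeasure_density)
  finally show "emeasure (distr P borel (\<lambda>\<omega>. (Y \<omega>)\<^sup>2)) A = emeasure (gam (1 / 2)) A" .
qed simp

text \<open>Time s = 1/2: the centering 2 s is 1, and the shapes l^2 (1 + l) / 2 and l^2 (1 - l) / 2
  are halved.\<close>

lemma le_3convex_std_normal_square:
  assumes Y: "distributed P lborel Y std_normal_density" and l: "- 1 \<le> l" "l \<le> 1"
  shows "le_3convex (distr P borel (\<lambda>\<omega>. l * ((Y \<omega>)\<^sup>2 - 1))) (gam_diff (l\<^sup>2 * (1 + l) / 4) (l\<^sup>2 * (1 - l) / 4))"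
proof -
  have Ym[measurable]: "Y \<in> borel_measurable P" using Y by (auto simp: distributed_def)
  have "distr P borel (\<lambda>\<omega>. l * ((Y \<omega>)\<^sup>2 - 1)) = distr (distr P borel (\<lambda>\<omega>. (Y \<omega>)\<^sup>2)) borel (\<lambda>x. l * (x - 2 * (1 / 2)))"
    by (subst distr_distr) (simp_all add: o_def)
  then show ?thesis
    using le_3convex_gam_diff[OF l, of "1 / 2"] by (simp add: distr_square_std_normal[OF Y])
qed

section \<open>Gaussian quadratic forms\<close>

text \<open>A maximiser \<open>v\<close> of the quadratic form on the unit sphere of
  \<open>S\<close> is an eigenvector. Its residual \<open>w\<close> = f v - c v is orthogonal to
  \<open>v\<close>, and comparing the form at v + t w with its maximum bounds a term linear in
  \<open>t\<close>, with coefficient twice |w|^2, by a quadratic one for all \<open>t\<close>. This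
  forces w = 0.\<close>

lemma self_adjoint_eigenvector:
  fixes f :: "'a::euclidean_space \<Rightarrow> 'a"
  assumes f: "linear f" and sa: "\<And>x y. f x \<bullet> y = x \<bullet> f y"
    and S: "subspace S" and inv: "f ` S \<subseteq> S" and ne: "S \<noteq> {0}"
  obtains v c where "v \<in> S" "norm v = 1" "f v = c *\<^sub>R v"
proof -
  have "compact (sphere 0 1 \<inter> S)"
    using S by (intro compact_Int_closed compact_sphere closed_subspace)
  moreover have "sphere 0 1 \<inter> S \<noteq> {}"
  proof -
    obtain x where "x \<in> S" "x \<noteq> 0" using ne subspace_0[OF S] by blast
    then have "(1 / norm x) *\<^sub>R x \<in> sphere 0 1 \<inter> S" using S by (simp add: subspace_scale)
    then show ?thesis by blast
  qed
  moreover have "continuous_on (sphere 0 1 \<inter> S) (\<lambda>x. x \<bullet> f x)"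
    by (intro continuous_intros linear_continuous_on linear_conv_bounded_linear[THEN iffD1] f)
  ultimately obtain v where v: "v \<in> sphere 0 1 \<inter> S" and max: "\<And>y. y \<in> sphere 0 1 \<inter> S \<Longrightarrow> y \<bullet> f y \<le> v \<bullet> f v"
    using continuous_attains_sup[of "sphere 0 1 \<inter> S" "\<lambda>x. x \<bullet> f x"] by blast
  define c where "c = v \<bullet> f v"
  have vS: "v \<in> S" and vn: "norm v = 1" using v by auto
  have le: "y \<bullet> f y \<le> c * (y \<bullet> y)" if "y \<in> S" for y
  proof (cases "y = 0")
    case False
    let ?z = "(1 / norm y) *\<^sub>R y"
    have "?z \<in> sphere 0 1 \<inter> S" using False that S by (simp add: subspace_scale)
    then have "?z \<bullet> f ?z \<le> c" unfolding c_def by (rule max)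
    moreover have "?z \<bullet> f ?z = (y \<bullet> f y) / (norm y)\<^sup>2"
      by (simp add: linear_cmul[OF f] power2_eq_square)
    ultimately have "(y \<bullet> f y) / (norm y)\<^sup>2 \<le> c" by (simp only:)
    then have "y \<bullet> f y \<le> c * (norm y)\<^sup>2" using False by (simp add: field_simps)
    then show ?thesis by (simp add: power2_norm_eq_inner)
  qed (simp add: linear_0[OF f])
  define w where "w = f v - c *\<^sub>R v"
  have wS: "w \<in> S" unfolding w_def using S vS inv by (intro subspace_diff subspace_scale) auto
  have vv: "v \<bullet> v = 1" using vn by (simp add: norm_eq_1)
  have wv: "w \<bullet> v = 0" by (simp add: w_def inner_diff_left vv) (simp add: c_def inner_commute)
  have "f v = w + c *\<^sub>R v" by (simp add: w_def)
  then have wfv: "w \<bullet> f v = w \<bullet> w"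
    using wv by (simp add: inner_add_right)
  let ?p = "w \<bullet> w" and ?q = "c * (w \<bullet> w) - w \<bullet> f w"
  have quad: "2 * t * ?p \<le> t\<^sup>2 * ?q" for t
  proof -
    have "v + t *\<^sub>R w \<in> S" using S vS wS by (intro subspace_add subspace_scale)
    from le[OF this] have "(v + t *\<^sub>R w) \<bullet> f (v + t *\<^sub>R w) \<le> c * ((v + t *\<^sub>R w) \<bullet> (v + t *\<^sub>R w))" .
    moreover have "(v + t *\<^sub>R w) \<bullet> f (v + t *\<^sub>R w) = c + 2 * t * ?p + t\<^sup>2 * (w \<bullet> f w)"
      using wfv sa[of v w] by (simp add: linear_add[OF f] linear_cmul[OF f] inner_add_left inner_add_right
          c_def power2_eq_square inner_commute algebra_simps)
    moreover have "(v + t *\<^sub>R w) \<bullet> (v + t *\<^sub>R w) = 1 + t\<^sup>2 * ?p"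
      using wv by (simp add: inner_add_left inner_add_right vv power2_eq_square inner_commute)
    ultimately have "c + 2 * t * ?p + t\<^sup>2 * (w \<bullet> f w) \<le> c * (1 + t\<^sup>2 * ?p)" by (simp only:)
    then show ?thesis by (simp add: algebra_simps)
  qed
  have "?p = 0"
  proof (rule ccontr)
    assume "?p \<noteq> 0"
    then have p: "?p > 0" by simp
    \<comment> \<open>Small enough that the quadratic side is at most \<open>?p\<close>, against
      \<open>2 * ?p\<close> on the other side; the added 1 keeps the denominator positive.\<close>
    define t where "t = ?p / (\<bar>?q\<bar> + 1)"
    have t: "t > 0" using p by (simp add: t_def add_pos_nonneg)
    have "t * (2 * ?p) \<le> t * (t * ?q)" using quad[of t] by (simp add: power2_eq_square mult_ac)
    then have "2 * ?p \<le> t * ?q" using t by (simp only: mult_le_cancel_left_pos)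
    also have "\<dots> \<le> t * (\<bar>?q\<bar> + 1)" using t by (intro mult_left_mono) auto
    also have "\<dots> = ?p" by (simp add: t_def)
    finally show False using p by simp
  qed
  then have "f v = c *\<^sub>R v" by (simp add: w_def)
  with vS vn show thesis using that by blast
qed

text \<open>Split off one eigenvector. Self-adjointness makes its orthogonal complement within
  \<open>S\<close> invariant, and that complement has smaller dimension.\<close>

lemma self_adjoint_orthonormal_basis:
  fixes f :: "'a::euclidean_space \<Rightarrow> 'a"
  assumes f: "linear f" and sa: "\<And>x y. f x \<bullet> y = x \<bullet> f y"
  shows "subspace S \<Longrightarrow> f ` S \<subseteq> S \<Longrightarrow>
    \<exists>B. B \<subseteq> S \<and> pairwise orthogonal B \<and> (\<forall>b\<in>B. norm b = 1 \<and> (\<exists>c. f b = c *\<^sub>R b)) \<and> span B = S"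
proof (induction "dim S" arbitrary: S rule: less_induct)
  case less
  show ?case
  proof (cases "S = {0}")
    case True
    then show ?thesis by (intro exI[of _ "{}"]) auto
  next
    case False
    obtain v c where v: "v \<in> S" "norm v = 1" "f v = c *\<^sub>R v"
      using self_adjoint_eigenvector[OF f sa less.prems False] by blast
    define T where "T = S \<inter> {x. v \<bullet> x = 0}"
    have vv: "v \<bullet> v = 1" using v by (simp add: norm_eq_1)
    have T: "subspace T" unfolding T_def
      by (intro subspace_inter less.prems subspace_hyperplane)
    have "v \<notin> T" using vv by (simp add: T_def)
    moreover have "T \<subseteq> S" by (auto simp: T_def)
    ultimately have "T \<subset> S" using v by blast
    then have "span T \<subset> span S" using T less.prems by (simp add: span_eq_iff[THEN iffD2])
    then have "dim T < dim S" by (rule dim_psubset)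
    moreover have "f ` T \<subseteq> T"
    proof
      fix y assume "y \<in> f ` T"
      then obtain x where x: "x \<in> S" "v \<bullet> x = 0" "y = f x" by (auto simp: T_def)
      have "v \<bullet> f x = 0" using sa[of v x] x v by simp
      with x less.prems show "y \<in> T" by (auto simp: T_def)
    qed
    ultimately obtain B where B: "B \<subseteq> T" "pairwise orthogonal B"
      "\<forall>b\<in>B. norm b = 1 \<and> (\<exists>c. f b = c *\<^sub>R b)" "span B = T"
      using less.hyps[OF _ T] by blast
    have "pairwise orthogonal (insert v B)"
      using B by (auto simp: pairwise_insert orthogonal_def T_def inner_commute)
    moreover have "span (insert v B) = S"
    proof
      show "span (insert v B) \<subseteq> S"
        using B v less.prems by (intro span_minimal) (auto simp: T_def)
      show "S \<subseteq> span (insert v B)"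
      proof
        fix x assume x: "x \<in> S"
        have "x - (v \<bullet> x) *\<^sub>R v \<in> T"
          unfolding T_def using x v less.prems(1)
          by (auto intro!: subspace_diff subspace_scale simp: inner_diff_right vv)
        then show "x \<in> span (insert v B)" using B by (auto simp: span_insert)
      qed
    qed
    ultimately show ?thesis
      using B v by (intro exI[of _ "insert v B"]) (auto simp: T_def)
  qed
qed

text \<open>The basis has as many elements as the index type, so it can be enumerated by that type
  and used as the rows of a square matrix.\<close>

lemma symmetric_matrix_eigenbasis:
  fixes M :: "real ^ 'n ^ 'n"
  assumes "transpose M = M"
  obtains u :: "'n \<Rightarrow> real ^ 'n" and e :: "'n \<Rightarrow> real"
  where "\<And>i j. u i \<bullet> u j = (if i = j then 1 else 0)" "\<And>i. M *v u i = e i *\<^sub>R u i"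
proof -
  have sa: "(M *v x) \<bullet> y = x \<bullet> (M *v y)" for x y
    using dot_lmul_matrix[of x M y] assms by (metis inner_commute transpose_matrix_vector)
  obtain B where B: "pairwise orthogonal B" "\<forall>b\<in>B. norm b = 1 \<and> (\<exists>c. M *v b = c *\<^sub>R b)" "span B = UNIV"
    using self_adjoint_orthonormal_basis[OF matrix_vector_mul_linear[of M] sa, of UNIV] by auto
  have ind: "independent B" using B by (intro pairwise_orthogonal_independent) auto
  have "card B = CARD('n)"
    using dim_span_eq_card_independent[OF ind] B by simp
  moreover have "finite B" using ind by (rule independent_imp_finite)
  ultimately obtain u where u: "bij_betw u (UNIV :: 'n set) B"
    using finite_same_card_bij[of "UNIV :: 'n set" B] by auto
  then have uB: "u i \<in> B" for i by (auto simp: bij_betw_def)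
  have "\<exists>c. M *v u i = c *\<^sub>R u i" for i using B(2) uB by blast
  then obtain e where e: "\<And>i. M *v u i = e i *\<^sub>R u i" by metis
  have "u i \<bullet> u j = (if i = j then 1 else 0)" for i j
  proof (cases "i = j")
    case True
    then show ?thesis using B(2) uB by (simp add: norm_eq_1)
  next
    case False
    then have "u i \<noteq> u j" using u by (auto simp: bij_betw_def inj_def)
    then show ?thesis using B(1) uB False by (auto simp: pairwise_def orthogonal_def)
  qed
  with e show thesis using that by blast
qed

section \<open>Rotation invariance of Lebesgue measure\<close>

text \<open>If \<open>\<mu>\<close> is a translation invariant measure, then computing the integral of
  \<open>indicator A x * indicator B (x + y)\<close> over \<open>\<mu> \<times> lborel\<close> in both orders gives
  \<open>\<mu> A * lborel B = lborel A * \<mu> B\<close>. For \<open>B\<close> we take the unit ball, on which \<open>\<mu>\<close> and \<open>lborel\<close> agree.\<close>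

lemma lborel_distr_orthogonal_transformation:
  fixes T :: "'a::euclidean_space \<Rightarrow> 'a"
  assumes T: "orthogonal_transformation T"
  shows "distr lborel borel T = lborel"
proof (rule measure_eqI)
  define \<mu> where "\<mu> = distr lborel borel T"
  have lin: "linear T" using T by (rule orthogonal_transformation_linear)
  have Tm[measurable]: "T \<in> borel_measurable borel"
    by (intro borel_measurable_continuous_onI linear_continuous_on linear_conv_bounded_linear[THEN iffD1] lin)
  have sets[simp, measurable_cong]: "sets \<mu> = sets borel" by (simp add: \<mu>_def)
  have ball: "emeasure \<mu> (ball 0 r) = emeasure lborel (ball (0 :: 'a) r)" for r
  proof -
    have "T -` ball 0 r = ball 0 r"
      using orthogonal_transformation_norm[OF T] by auto
    then show ?thesis by (simp add: \<mu>_def emeasure_distr)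
  qed
  have fin: "emeasure lborel (ball (0 :: 'a) r) \<noteq> \<infinity>" for r
    using emeasure_lborel_ball_finite[of "0 :: 'a" r] by auto
  interpret M: sigma_finite_measure \<mu>
  proof
    show "\<exists>A. countable A \<and> A \<subseteq> sets \<mu> \<and> \<Union>A = space \<mu> \<and> (\<forall>a\<in>A. emeasure \<mu> a \<noteq> \<infinity>)"
    proof (intro exI[of _ "range (\<lambda>n::nat. ball (0 :: 'a) (real n))"] conjI)
      show "\<Union> (range (\<lambda>n::nat. ball (0 :: 'a) (real n))) = space \<mu>"
        using reals_Archimedean2 by (auto simp: \<mu>_def)
    qed (use fin in \<open>auto simp: ball\<close>)
  qed
  interpret pair_sigma_finite lborel \<mu> ..
  have shift: "(\<integral>\<^sup>+x. h x \<partial>\<mu>) = (\<integral>\<^sup>+x. h (x - a) \<partial>\<mu>)" if [measurable]: "h \<in> borel_measurable borel" for h and a :: 'a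
  proof -
    \<comment> \<open>Translating the image measure by - a amounts to translating Lebesgue measure
      by a preimage of - a under \<open>T\<close>.\<close>
    obtain b where b: "T b = - a" using orthogonal_transformation_surj[OF T] by (metis surjD)
    have "(\<integral>\<^sup>+x. h x \<partial>\<mu>) = (\<integral>\<^sup>+x. h (T x) \<partial>lborel)"
      by (simp add: \<mu>_def nn_integral_distr)
    also have "\<dots> = (\<integral>\<^sup>+x. h (T x) \<partial>distr lborel borel ((+) b))"
      by (simp add: lborel_distr_plus)
    also have "\<dots> = (\<integral>\<^sup>+x. h (T x - a) \<partial>lborel)"
      by (simp add: nn_integral_distr linear_add[OF lin] b)
    also have "\<dots> = (\<integral>\<^sup>+x. h (x - a) \<partial>\<mu>)"
      by (simp add: \<mu>_def nn_integral_distr)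
    finally show ?thesis .
  qed
  have add: "(\<integral>\<^sup>+y. h (x + y) \<partial>lborel) = (\<integral>\<^sup>+y. h y \<partial>lborel)"
    if [measurable]: "h \<in> borel_measurable borel" for h :: "'a \<Rightarrow> ennreal" and x
  proof -
    have "(\<integral>\<^sup>+y. h y \<partial>lborel) = (\<integral>\<^sup>+y. h y \<partial>distr lborel borel ((+) x))"
      by (simp add: lborel_distr_plus)
    then show ?thesis by (simp add: nn_integral_distr)
  qed
  have sub: "(\<integral>\<^sup>+y. h (x - y) \<partial>lborel) = (\<integral>\<^sup>+y. h y \<partial>lborel)"
    if [measurable]: "h \<in> borel_measurable borel" for h :: "'a \<Rightarrow> ennreal" and x
  proof -
    have "(lborel :: 'a measure) = distr lborel borel (\<lambda>y. x + (- 1) *\<^sub>R y)"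
      using lborel_affine[of "- 1" x] by (simp add: density_1)
    then have "(\<integral>\<^sup>+y. h y \<partial>lborel) = (\<integral>\<^sup>+y. h y \<partial>distr lborel borel (\<lambda>y. x + (- 1) *\<^sub>R y))"
      by simp
    then show ?thesis by (simp add: nn_integral_distr)
  qed
  fix A assume "A \<in> sets (distr lborel borel T)"
  then have A[measurable]: "A \<in> sets borel" by simp
  define B where "B = ball (0 :: 'a) 1"
  have [measurable]: "B \<in> sets borel" by (simp add: B_def)
  let ?I = "\<lambda>S x. indicator S x :: ennreal"
  have "emeasure \<mu> A * emeasure lborel B = (\<integral>\<^sup>+x. ?I A x * (\<integral>\<^sup>+y. ?I B y \<partial>lborel) \<partial>\<mu>)"
    by (simp add: nn_integral_multc)
  also have "\<dots> = (\<integral>\<^sup>+x. (\<integral>\<^sup>+y. ?I A x * ?I B (x + y) \<partial>lborel) \<partial>\<mu>)"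
    by (simp add: nn_integral_cmult add[of "?I B"] del: nn_integral_indicator)
  also have "\<dots> = (\<integral>\<^sup>+y. (\<integral>\<^sup>+x. ?I A x * ?I B (x + y) \<partial>\<mu>) \<partial>lborel)"
    by (rule Fubini') measurable
  also have "\<dots> = (\<integral>\<^sup>+y. (\<integral>\<^sup>+x. ?I A (x - y) * ?I B x \<partial>\<mu>) \<partial>lborel)"
  proof (rule nn_integral_cong)
    fix y
    show "(\<integral>\<^sup>+x. ?I A x * ?I B (x + y) \<partial>\<mu>) = (\<integral>\<^sup>+x. ?I A (x - y) * ?I B x \<partial>\<mu>)"
      using shift[of "\<lambda>x. ?I A x * ?I B (x + y)" y] by simp
  qed
  also have "\<dots> = (\<integral>\<^sup>+x. (\<integral>\<^sup>+y. ?I A (x - y) * ?I B x \<partial>lborel) \<partial>\<mu>)"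
    by (rule Fubini'[symmetric]) measurable
  also have "\<dots> = (\<integral>\<^sup>+x. emeasure lborel A * ?I B x \<partial>\<mu>)"
    by (simp add: nn_integral_multc sub[of "?I A"])
  also have "\<dots> = emeasure lborel A * emeasure lborel B"
    using ball[of 1] by (subst nn_integral_cmult_indicator) (simp_all add: B_def)
  finally have "emeasure \<mu> A * emeasure lborel B = emeasure lborel A * emeasure lborel B" .
  \<comment> \<open>The measure of the unit ball is positive and finite, so it cancels from both
    sides.\<close>
  moreover have "emeasure lborel B \<noteq> 0"
    using content_ball_pos[of 1 "0 :: 'a"] by (auto simp: B_def measure_def)
  ultimately show "emeasure (distr lborel borel T) A = emeasure lborel A"
    using fin[of 1] by (simp add: \<mu>_def B_def mult.commute[of _ "emeasure lborel (ball 0 1)"] ennreal_mult_cancel_left)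
qed simp

section \<open>Coordinates of a Gaussian vector in an orthonormal basis\<close>

lemma nn_integral_lborel_vec:
  fixes f :: "'n::finite \<Rightarrow> real \<Rightarrow> ennreal"
  assumes [measurable]: "\<And>i. f i \<in> borel_measurable borel"
  shows "(\<integral>\<^sup>+x. (\<Prod>i\<in>UNIV. f i (x $ i)) \<partial>(lborel :: (real ^ 'n) measure)) = (\<Prod>i\<in>UNIV. \<integral>\<^sup>+x. f i x \<partial>lborel)"
proof -
  \<comment> \<open>Recovers the index from a standard basis vector, to pass from products over
    \<open>Basis\<close> to products over the index type.\<close>
  define idx where "idx b = (THE i. b = axis i (1 :: real))" for b :: "real ^ 'n"
  have idx: "idx (axis i 1) = i" for i
    unfolding idx_def by (rule the_equality) (auto simp: axis_eq_axis)
  have B: "(Basis :: (real ^ 'n) set) = range (\<lambda>i. axis i 1)"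
    by (auto simp: Basis_vec_def)
  have inj: "inj (\<lambda>i. axis i (1 :: real) :: real ^ 'n)"
    by (auto simp: inj_def axis_eq_axis)
  have "(\<integral>\<^sup>+x. (\<Prod>b\<in>Basis. f (idx b) (x \<bullet> b)) \<partial>(lborel :: (real ^ 'n) measure))
      = (\<Prod>b\<in>Basis. (\<integral>\<^sup>+x. f (idx b) x \<partial>lborel))"
    by (rule nn_integral_lborel_prod) simp_all
  then show ?thesis
    unfolding B by (simp add: prod.reindex[OF inj] idx inner_axis)
qed

text \<open>The joint density depends on \<open>x\<close> only through its norm, hence is invariant
  under orthogonal transformations.\<close>

lemma prod_std_normal_density:
  fixes x :: "real ^ 'n"
  shows "(\<Prod>i\<in>UNIV. std_normal_density (x $ i)) = (1 / sqrt (2 * pi)) ^ CARD('n) * exp (- (x \<bullet> x) / 2)"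
proof -
  have "(\<Prod>i\<in>UNIV. std_normal_density (x $ i)) = (\<Prod>i\<in>(UNIV :: 'n set). 1 / sqrt (2 * pi)) * (\<Prod>i\<in>UNIV. exp (- (x $ i)\<^sup>2 / 2))"
    by (simp only: std_normal_density_def prod.distrib)
  also have "(\<Prod>i\<in>UNIV. exp (- (x $ i)\<^sup>2 / 2)) = exp (\<Sum>i\<in>UNIV. - (x $ i)\<^sup>2 / 2)"
    by (rule exp_sum[symmetric]) simp
  also have "(\<Sum>i\<in>UNIV. - (x $ i)\<^sup>2 / 2) = - (x \<bullet> x) / 2"
    by (simp add: inner_vec_def power2_eq_square sum_negf sum_divide_distrib)
  finally show ?thesis by simp
qed

lemma nn_integral_std_normal_density: "(\<integral>\<^sup>+x. ennreal (std_normal_density x) \<partial>lborel) = 1"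
proof -
  interpret prob_space "density lborel std_normal_density"
    by (rule prob_space_normal_density) simp
  show ?thesis using emeasure_space_1 by (simp add: emeasure_density)
qed

lemma orthogonal_matrix_orthonormal:
  fixes u :: "'n::finite \<Rightarrow> real ^ 'n"
  assumes u: "\<And>i j. u i \<bullet> u j = (if i = j then 1 else 0)"
  shows "orthogonal_matrix (\<chi> i. u i)"
proof -
  have "(\<chi> i. u i) ** transpose (\<chi> i. u i) = mat 1"
    using u by (simp add: vec_eq_iff matrix_matrix_mult_def transpose_def mat_def inner_vec_def)
  then show ?thesis
    using matrix_left_right_inverse by (auto simp: orthogonal_matrix_def)
qed

lemma orthonormal_matrix_vector: "((\<chi> i. u i) *v x) $ i = u i \<bullet> (x :: real ^ 'n)"
  by (simp add: matrix_vector_mult_def inner_vec_def)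

text \<open>The map \<open>T\<close> with coordinates u i \<bullet> x preserves both Lebesgue
  measure and the Gaussian density. The new coordinates therefore have the same product law as the
  old ones. The rectangle formula \<open>key\<close> yields the marginals as well as
  independence.\<close>

lemma
  fixes u :: "'n::finite \<Rightarrow> real ^ 'n"
  assumes P: "prob_space P"
    and G: "distributed P lborel G (\<lambda>x. ennreal (\<Prod>i\<in>UNIV. std_normal_density (x $ i)))"
    and u: "\<And>i j. u i \<bullet> u j = (if i = j then 1 else 0)"
  shows indep_vars_orthonormal_gaussian: "prob_space.indep_vars P (\<lambda>_. borel) (\<lambda>i \<omega>. u i \<bullet> G \<omega>) UNIV"
    and distributed_orthonormal_gaussian: "\<And>i. distributed P lborel (\<lambda>\<omega>. u i \<bullet> G \<omega>) std_normal_density"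
proof -
  interpret prob_space P by fact
  have Gm[measurable]: "G \<in> borel_measurable P" using G by (auto simp: distributed_def)
  define T where "T = (*v) (\<chi> i. u i)"
  have T: "orthogonal_transformation T"
    unfolding T_def using orthogonal_matrix_orthonormal[OF u]
    by (simp add: orthogonal_transformation_matrix)
  have Ti: "T x $ i = u i \<bullet> x" for x i by (simp add: T_def orthonormal_matrix_vector)
  have Tm[measurable]: "T \<in> borel_measurable borel"
    by (intro borel_measurable_continuous_onI linear_continuous_on linear_conv_bounded_linear[THEN iffD1]
        orthogonal_transformation_linear T)
  have key: "emeasure P (\<Inter>i\<in>UNIV. (\<lambda>\<omega>. u i \<bullet> G \<omega>) -` A i \<inter> space P)
      = (\<Prod>i\<in>UNIV. \<integral>\<^sup>+x. ennreal (std_normal_density x) * indicator (A i) x \<partial>lborel)"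
    if A[measurable]: "\<And>i. A i \<in> sets borel" for A
  proof -
    define h where "h y = (\<Prod>i\<in>UNIV. ennreal (std_normal_density (y $ i)) * indicator (A i) (y $ i))" for y :: "real ^ 'n"
    have [measurable]: "h \<in> borel_measurable borel" unfolding h_def[abs_def] by measurable
    have "emeasure P (\<Inter>i\<in>UNIV. (\<lambda>\<omega>. u i \<bullet> G \<omega>) -` A i \<inter> space P)
        = (\<integral>\<^sup>+\<omega>. indicator (\<Inter>i\<in>UNIV. (\<lambda>\<omega>. u i \<bullet> G \<omega>) -` A i \<inter> space P) \<omega> \<partial>P)"
      by (intro nn_integral_indicator[symmetric]) measurable
    also have "\<dots> = (\<integral>\<^sup>+\<omega>. (\<Prod>i\<in>UNIV. indicator (A i) (u i \<bullet> G \<omega>)) \<partial>P)"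
    proof (intro nn_integral_cong)
      fix \<omega> assume "\<omega> \<in> space P"
      then show "indicator (\<Inter>i\<in>UNIV. (\<lambda>\<omega>. u i \<bullet> G \<omega>) -` A i \<inter> space P) \<omega>
          = (\<Prod>i\<in>UNIV. indicator (A i) (u i \<bullet> G \<omega>) :: ennreal)"
        by (cases "\<forall>i. u i \<bullet> G \<omega> \<in> A i") (auto simp: indicator_def prod_zero_iff)
    qed
    also have "\<dots> = (\<integral>\<^sup>+x. ennreal (\<Prod>i\<in>UNIV. std_normal_density (x $ i)) * (\<Prod>i\<in>UNIV. indicator (A i) (u i \<bullet> x)) \<partial>lborel)"
      by (rule distributed_nn_integral[OF G, symmetric]) measurable
    also have "\<dots> = (\<integral>\<^sup>+x. h (T x) \<partial>lborel)"
    proof (intro nn_integral_cong)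
      fix x :: "real ^ 'n"
      have "T x \<bullet> T x = x \<bullet> x" using T by (simp add: orthogonal_transformation_def)
      then have "(\<Prod>i\<in>UNIV. std_normal_density (x $ i)) = (\<Prod>i\<in>UNIV. std_normal_density (T x $ i))"
        by (simp add: prod_std_normal_density)
      then show "ennreal (\<Prod>i\<in>UNIV. std_normal_density (x $ i)) * (\<Prod>i\<in>UNIV. indicator (A i) (u i \<bullet> x)) = h (T x)"
        by (simp add: h_def prod.distrib prod_ennreal flip: Ti)
    qed
    also have "\<dots> = (\<integral>\<^sup>+x. h x \<partial>distr lborel borel T)"
      by (simp add: nn_integral_distr)
    also have "\<dots> = (\<integral>\<^sup>+x. h x \<partial>lborel)"
      by (simp add: lborel_distr_orthogonal_transformation[OF T])
    also have "\<dots> = (\<Prod>i\<in>UNIV. \<integral>\<^sup>+x. ennreal (std_normal_density x) * indicator (A i) x \<partial>lborel)"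
      unfolding h_def by (rule nn_integral_lborel_vec) measurable
    finally show ?thesis .
  qed
  have marg: "emeasure P ((\<lambda>\<omega>. u i \<bullet> G \<omega>) -` A \<inter> space P)
      = (\<integral>\<^sup>+x. ennreal (std_normal_density x) * indicator A x \<partial>lborel)" if A: "A \<in> sets borel" for A i
  proof -
    \<comment> \<open>With all other sides equal to \<open>UNIV\<close>, the rectangle constrains
      coordinate \<open>i\<close> only, and every other factor is 1.\<close>
    let ?A = "\<lambda>j. if j = i then A else UNIV"
    have "(\<Inter>j\<in>UNIV. (\<lambda>\<omega>. u j \<bullet> G \<omega>) -` ?A j \<inter> space P) = (\<lambda>\<omega>. u i \<bullet> G \<omega>) -` A \<inter> space P"
      by (auto split: if_splits)
    then have "emeasure P ((\<lambda>\<omega>. u i \<bullet> G \<omega>) -` A \<inter> space P)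
        = (\<Prod>j\<in>UNIV. \<integral>\<^sup>+x. ennreal (std_normal_density x) * indicator (?A j) x \<partial>lborel)"
      using key[of ?A] A by simp
    also have "\<dots> = (\<Prod>j\<in>UNIV. if j = i then (\<integral>\<^sup>+x. ennreal (std_normal_density x) * indicator A x \<partial>lborel) else 1)"
      by (intro prod.cong) (auto simp: nn_integral_std_normal_density)
    finally show ?thesis by (simp add: prod.delta)
  qed
  show "distributed P lborel (\<lambda>\<omega>. u i \<bullet> G \<omega>) std_normal_density" for i
    unfolding distributed_def
  proof (intro conjI measure_eqI)
    fix A assume "A \<in> sets (distr P lborel (\<lambda>\<omega>. u i \<bullet> G \<omega>))"
    then show "emeasure (distr P lborel (\<lambda>\<omega>. u i \<bullet> G \<omega>)) A
        = emeasure (density lborel (\<lambda>x. ennreal (std_normal_density x))) A"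
      using marg[of A i] by (simp add: emeasure_distr emeasure_density)
  qed simp_all
  have rv: "random_variable borel (\<lambda>\<omega>. u i \<bullet> G \<omega>)" for i by measurable
  have "prob (\<Inter>i\<in>UNIV. (\<lambda>\<omega>. u i \<bullet> G \<omega>) -` A i \<inter> space P)
      = (\<Prod>i\<in>UNIV. prob ((\<lambda>\<omega>. u i \<bullet> G \<omega>) -` A i \<inter> space P))" if A: "\<And>i. A i \<in> sets borel" for A
  proof -
    have "ennreal (prob (\<Inter>i\<in>UNIV. (\<lambda>\<omega>. u i \<bullet> G \<omega>) -` A i \<inter> space P))
        = (\<Prod>i\<in>UNIV. ennreal (prob ((\<lambda>\<omega>. u i \<bullet> G \<omega>) -` A i \<inter> space P)))"
      unfolding emeasure_eq_measure[symmetric] key[OF A] marg[OF A] by (rule refl)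
    also have "\<dots> = ennreal (\<Prod>i\<in>UNIV. prob ((\<lambda>\<omega>. u i \<bullet> G \<omega>) -` A i \<inter> space P))"
      by (rule prod_ennreal) simp
    finally show ?thesis
      by (subst (asm) ennreal_inj) (auto intro!: prod_nonneg)
  qed
  then show "indep_vars (\<lambda>_. borel) (\<lambda>i \<omega>. u i \<bullet> G \<omega>) UNIV"
    by (subst indep_vars_finite[where E = "\<lambda>_. sets borel"])
      (auto simp: rv sets.sigma_sets_eq[of borel, simplified] Int_stable_def Pi_def)
qed

text \<open>Independence turns the sum into a convolution, which both the order and
  \<open>gam_diff\<close> respect. The induction starts from the empty sum, whose counterpart is the
  point mass at 0 thanks to the convention for shape zero.\<close>

lemma le_3convex_sum_std_normal_square:
  assumes "prob_space P" and "finite I"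
    and ind: "prob_space.indep_vars P (\<lambda>_. borel) Y I"
    and Y: "\<And>i. i \<in> I \<Longrightarrow> distributed P lborel (Y i) std_normal_density"
    and l: "\<And>i. i \<in> I \<Longrightarrow> \<bar>l i\<bar> \<le> 1"
  shows "le_3convex (distr P borel (\<lambda>\<omega>. \<Sum>i\<in>I. l i * ((Y i \<omega>)\<^sup>2 - 1)))
    (gam_diff (\<Sum>i\<in>I. (l i)\<^sup>2 * (1 + l i) / 4) (\<Sum>i\<in>I. (l i)\<^sup>2 * (1 - l i) / 4))"
proof -
  interpret prob_space P by fact
  define X where "X = (\<lambda>i \<omega>. l i * ((Y i \<omega>)\<^sup>2 - 1))"
  have indX: "indep_vars (\<lambda>_. borel) X I"
    unfolding X_def by (rule indep_vars_compose2[OF ind]) measurable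
  have Xm: "X i \<in> borel_measurable P" if "i \<in> I" for i
    using indX that by (simp add: indep_vars_def)
  have "le_3convex (distr P borel (\<lambda>\<omega>. \<Sum>i\<in>J. X i \<omega>))
      (gam_diff (\<Sum>i\<in>J. (l i)\<^sup>2 * (1 + l i) / 4) (\<Sum>i\<in>J. (l i)\<^sup>2 * (1 - l i) / 4))"
    if "finite J" "J \<subseteq> I" for J
    using that
  proof (induction J rule: finite_induct)
    case empty
    have r0: "has_moments (return borel (0 :: real))" by (rule has_moments_return)
    have g0: "gam 0 = return borel 0" by (simp add: gamma_distribution_def)
    have "distr (return borel 0) borel (\<lambda>x::real. - x) = return borel 0"
      by (simp add: distr_return)
    then have "gam_diff 0 0 = return borel 0"
      unfolding gam_diff_def g0 by (simp add: convolution_return_0[OF r0])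
    moreover have "distr P borel (\<lambda>\<omega>. 0 :: real) = return borel 0"
      by (simp add: distr_const)
    ultimately show ?case using le_3convex_refl[OF r0] by simp
  next
    case (insert j J)
    have jJ: "j \<in> I" "J \<subseteq> I" using insert.prems by auto
    have nn: "0 \<le> (l i)\<^sup>2 * (1 + l i) / 4" "0 \<le> (l i)\<^sup>2 * (1 - l i) / 4" if "i \<in> I" for i
      using l[OF that] by auto
    have "indep_var borel (X j) borel (\<lambda>\<omega>. \<Sum>i\<in>J. X i \<omega>)"
      using insert.hyps indep_vars_subset[OF indX insert.prems] by (rule indep_vars_sum)
    then have "distr P borel (\<lambda>\<omega>. X j \<omega> + (\<Sum>i\<in>J. X i \<omega>))
        = (distr P borel (X j) \<star> distr P borel (\<lambda>\<omega>. \<Sum>i\<in>J. X i \<omega>))"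
      by (rule sum_indep_random_variable) (use jJ Xm in \<open>auto intro!: borel_measurable_sum\<close>)
    moreover have "le_3convex (distr P borel (X j)) (gam_diff ((l j)\<^sup>2 * (1 + l j) / 4) ((l j)\<^sup>2 * (1 - l j) / 4))"
      unfolding X_def using l[OF jJ(1)] by (intro le_3convex_std_normal_square Y jJ) auto
    moreover have "le_3convex (distr P borel (\<lambda>\<omega>. \<Sum>i\<in>J. X i \<omega>))
        (gam_diff (\<Sum>i\<in>J. (l i)\<^sup>2 * (1 + l i) / 4) (\<Sum>i\<in>J. (l i)\<^sup>2 * (1 - l i) / 4))"
      using insert.IH jJ by simp
    moreover have "gam_diff ((l j)\<^sup>2 * (1 + l j) / 4 + (\<Sum>i\<in>J. (l i)\<^sup>2 * (1 + l i) / 4))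
          ((l j)\<^sup>2 * (1 - l j) / 4 + (\<Sum>i\<in>J. (l i)\<^sup>2 * (1 - l i) / 4))
        = (gam_diff ((l j)\<^sup>2 * (1 + l j) / 4) ((l j)\<^sup>2 * (1 - l j) / 4)
          \<star> gam_diff (\<Sum>i\<in>J. (l i)\<^sup>2 * (1 + l i) / 4) (\<Sum>i\<in>J. (l i)\<^sup>2 * (1 - l i) / 4))"
      using nn jJ by (intro gam_diff_add sum_nonneg) auto
    ultimately show ?case
      using insert.hyps by (simp add: le_3convex_convolution)
  qed
  from this[of I] show ?thesis using \<open>finite I\<close> by (simp add: X_def)
qed

lemma distr_gam_diff:
  assumes "prob_space Q" and ind: "prob_space.indep_var Q borel A borel B"
    and A: "distr Q borel A = gam a" and B: "distr Q borel B = gam b" and ab: "0 \<le> a" "0 \<le> b"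
  shows "distr Q borel (\<lambda>\<omega>. A \<omega> - B \<omega> - 2 * (a - b)) = gam_diff a b"
proof -
  interpret prob_space Q by fact
  have Am[measurable]: "A \<in> borel_measurable Q" and Bm[measurable]: "B \<in> borel_measurable Q"
    using ind by (auto dest: indep_var_rv1 indep_var_rv2)
  have "indep_var borel ((\<lambda>x. x) \<circ> A) borel (uminus \<circ> B)"
    by (rule indep_var_compose[OF ind]) simp_all
  then have "indep_var borel A borel (\<lambda>\<omega>. - B \<omega>)" by (simp add: o_def)
  then have "distr Q borel (\<lambda>\<omega>. A \<omega> + - B \<omega>) = (distr Q borel A \<star> distr Q borel (\<lambda>\<omega>. - B \<omega>))"
    by (rule sum_indep_random_variable) simp_all
  also have "distr Q borel (\<lambda>\<omega>. - B \<omega>) = distr (gam b) borel (\<lambda>x. - x)"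
    unfolding B[symmetric] by (subst distr_distr) (simp_all add: o_def)
  finally have AB: "distr Q borel (\<lambda>\<omega>. A \<omega> - B \<omega>) = (gam a \<star> distr (gam b) borel (\<lambda>x. - x))"
    by (simp add: A)
  have "gam_diff a b = distr (distr Q borel (\<lambda>\<omega>. A \<omega> - B \<omega>)) borel (\<lambda>x. x + - (2 * (a - b)))"
    unfolding gam_diff_def AB
    by (intro convolution_return has_moments_convolution has_moments_gam has_moments_gam_uminus ab)
  also have "\<dots> = distr Q borel (\<lambda>\<omega>. A \<omega> - B \<omega> - 2 * (a - b))"
    by (subst distr_distr) (simp_all add: o_def algebra_simps)
  finally show ?thesis by simp
qed

section \<open>Absolute powers and cubic polynomials as test functions\<close>

text \<open>Away from 0 the function agrees locally with a power of x or of - x. At 0 the difference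
  quotient is at most |h|^(q - 1) in absolute value, which tends to 0 because q > 1.\<close>

lemma has_real_derivative_abs_powr:
  assumes "q > 1"
  shows "((\<lambda>x::real. \<bar>x\<bar> powr q) has_real_derivative q * (sgn x * \<bar>x\<bar> powr (q - 1))) (at x)"
proof (cases x "0 :: real" rule: linorder_cases)
  case greater
  have "((\<lambda>x. x powr q) has_real_derivative q * x powr (q - 1)) (at x)"
    by (rule has_real_derivative_powr[OF greater])
  moreover have "eventually (\<lambda>y. y powr q = \<bar>y\<bar> powr q) (nhds x)"
    using eventually_nhds_in_open[of "{0<..}" x] greater by (auto elim!: eventually_mono)
  ultimately show ?thesis using greater by (simp add: DERIV_cong_ev[OF refl _ refl])
next
  case less
  have "((\<lambda>x. (- x) powr q) has_real_derivative (q * (- x) powr (q - 1)) * - 1) (at x)"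
    by (rule DERIV_chain2[OF has_real_derivative_powr]) (use less in \<open>auto intro!: derivative_eq_intros\<close>)
  moreover have "eventually (\<lambda>y. (- y) powr q = \<bar>y\<bar> powr q) (nhds x)"
    using eventually_nhds_in_open[of "{..<0}" x] less by (auto elim!: eventually_mono)
  ultimately show ?thesis using less by (simp add: DERIV_cong_ev[OF refl _ refl])
next
  case equal
  have "((\<lambda>h. \<bar>h\<bar> powr q / h) \<longlongrightarrow> 0) (at 0)"
  proof (rule Lim_null_comparison)
    have "norm (\<bar>h\<bar> powr q / h) \<le> \<bar>h\<bar> powr (q - 1)" for h :: real
      by (cases "h = 0") (simp_all add: powr_diff abs_divide)
    then show "eventually (\<lambda>h. norm (\<bar>h\<bar> powr q / h) \<le> \<bar>h\<bar> powr (q - 1)) (at 0)" by simp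
    have "((\<lambda>h::real. \<bar>h\<bar> powr (q - 1)) \<longlongrightarrow> 0 powr (q - 1)) (at 0)"
      using assms by (intro tendsto_powr2) (auto intro!: tendsto_eq_intros)
    then show "((\<lambda>h::real. \<bar>h\<bar> powr (q - 1)) \<longlongrightarrow> 0) (at 0)" by simp
  qed
  then show ?thesis using equal by (simp add: DERIV_def)
qed

lemma has_real_derivative_sgn_abs_powr:
  assumes "q > 1"
  shows "((\<lambda>x::real. sgn x * \<bar>x\<bar> powr q) has_real_derivative q * \<bar>x\<bar> powr (q - 1)) (at x)"
proof (cases "x = 0")
  case False
  have "((\<lambda>y. sgn x * \<bar>y\<bar> powr q) has_real_derivative sgn x * (q * (sgn x * \<bar>x\<bar> powr (q - 1)))) (at x)"
    by (intro DERIV_cmult has_real_derivative_abs_powr assms)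
  moreover have "eventually (\<lambda>y. sgn x * \<bar>y\<bar> powr q = sgn y * \<bar>y\<bar> powr q) (nhds x)"
  proof (cases "x > 0")
    case True
    then show ?thesis using eventually_nhds_in_open[of "{0<..}" x] by (auto elim!: eventually_mono)
  next
    case n: False
    then show ?thesis using eventually_nhds_in_open[of "{..<0}" x] False by (auto elim!: eventually_mono)
  qed
  moreover have "sgn x * (q * (sgn x * \<bar>x\<bar> powr (q - 1))) = q * \<bar>x\<bar> powr (q - 1)"
    using False by (simp add: sgn_if)
  ultimately show ?thesis by (simp add: DERIV_cong_ev[OF refl _ refl])
next
  case True
  have "sgn h * \<bar>h\<bar> powr q / h = \<bar>h\<bar> powr (q - 1)" for h :: real
    by (cases "h = 0") (auto simp: powr_diff sgn_if)
  moreover have "((\<lambda>h::real. \<bar>h\<bar> powr (q - 1)) \<longlongrightarrow> 0 powr (q - 1)) (at 0)"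
    using assms by (intro tendsto_powr2) (auto intro!: tendsto_eq_intros)
  ultimately show ?thesis using True by (simp add: DERIV_def)
qed

text \<open>For q > 1 the derivative is increasing. The case q = 1, not differentiable at 0, is the
  absolute value; it is reached from p = 3.\<close>

lemma convex_on_abs_powr:
  assumes "q \<ge> 1" shows "convex_on UNIV (\<lambda>x::real. \<bar>x\<bar> powr q)"
proof (cases "q = 1")
  case True
  then show ?thesis using convex_on_dist[of "UNIV :: real set" 0] by simp
next
  case False
  then have q: "q > 1" using assms by simp
  show ?thesis
  proof (rule convex_on_realI)
    show "((\<lambda>x::real. \<bar>x\<bar> powr q) has_real_derivative q * (sgn x * \<bar>x\<bar> powr (q - 1))) (at x)" for x
      by (rule has_real_derivative_abs_powr[OF q])
    fix x y :: real assume "x \<le> y"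
    have "sgn x * \<bar>x\<bar> powr (q - 1) \<le> sgn y * \<bar>y\<bar> powr (q - 1)"
    proof (cases "0 < x \<or> y < 0")
      case True
      then show ?thesis using \<open>x \<le> y\<close> q by (auto intro!: powr_mono2)
    next
      case False
      then have "sgn x * \<bar>x\<bar> powr (q - 1) \<le> 0" "0 \<le> sgn y * \<bar>y\<bar> powr (q - 1)"
        by (auto simp: sgn_if)
      then show ?thesis by linarith
    qed
    then show "q * (sgn x * \<bar>x\<bar> powr (q - 1)) \<le> q * (sgn y * \<bar>y\<bar> powr (q - 1))"
      using q by (intro mult_left_mono) auto
  qed simp
qed

lemma powr_le_weight: "\<bar>x :: real\<bar> powr m \<le> (1 + \<bar>x\<bar>) ^ nat \<lceil>m\<rceil>" if "m \<ge> 0"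
proof -
  have "\<bar>x\<bar> powr m \<le> (1 + \<bar>x\<bar>) powr m" using that by (intro powr_mono2) auto
  also have "\<dots> \<le> (1 + \<bar>x\<bar>) powr real (nat \<lceil>m\<rceil>)" using that by (intro powr_mono) linarith+
  also have "\<dots> = (1 + \<bar>x\<bar>) ^ nat \<lceil>m\<rceil>" by (rule powr_realpow) linarith
  finally show ?thesis .
qed

text \<open>The second derivative is a multiple of |x|^(p - 2), and p \<ge> 3 puts that exponent
  into the convex range.\<close>

lemma test_function_abs_powr:
  assumes p: "p \<ge> 3"
  shows "test_function (\<lambda>x. \<bar>x\<bar> powr p) (\<lambda>x. p * (sgn x * \<bar>x\<bar> powr (p - 1)))
    (\<lambda>x. p * ((p - 1) * \<bar>x\<bar> powr (p - 2)))"
  unfolding test_function_def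
proof (intro conjI allI)
  show "((\<lambda>x. \<bar>x\<bar> powr p) has_real_derivative p * (sgn x * \<bar>x\<bar> powr (p - 1))) (at x)" for x
    using p by (intro has_real_derivative_abs_powr) auto
  have "((\<lambda>x. sgn x * \<bar>x\<bar> powr (p - 1)) has_real_derivative (p - 1) * \<bar>x\<bar> powr (p - 2)) (at x)" for x
    using has_real_derivative_sgn_abs_powr[of "p - 1" x] p by simp
  then show "((\<lambda>x. p * (sgn x * \<bar>x\<bar> powr (p - 1))) has_real_derivative p * ((p - 1) * \<bar>x\<bar> powr (p - 2))) (at x)" for x
    by (rule DERIV_cmult)
  show "convex_on UNIV (\<lambda>x. p * ((p - 1) * \<bar>x\<bar> powr (p - 2)))"
    using p by (intro convex_on_cmul convex_on_abs_powr) auto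
  have "\<bar>p * ((p - 1) * \<bar>x\<bar> powr (p - 2))\<bar> \<le> (p * (p - 1)) * (1 + \<bar>x\<bar>) ^ nat \<lceil>p - 2\<rceil>" for x
    using p powr_le_weight[of "p - 2" x] by (simp add: abs_mult mult.assoc mult_left_mono)
  then show "poly_bounded (\<lambda>x. p * ((p - 1) * \<bar>x\<bar> powr (p - 2)))"
    unfolding poly_bounded_def by blast
qed

lemma test_function_cubic:
  "test_function (\<lambda>x. a + b * x + c * x\<^sup>2 + d * x ^ 3) (\<lambda>x. b + 2 * c * x + 3 * d * x\<^sup>2) (\<lambda>x. 2 * c + 6 * d * x)"
  unfolding test_function_def
proof (intro conjI allI)
  show "((\<lambda>x. a + b * x + c * x\<^sup>2 + d * x ^ 3) has_real_derivative b + 2 * c * x + 3 * d * x\<^sup>2) (at x)"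
    and "((\<lambda>x. b + 2 * c * x + 3 * d * x\<^sup>2) has_real_derivative 2 * c + 6 * d * x) (at x)" for x
    by (auto intro!: derivative_eq_intros simp: algebra_simps power2_eq_square)
  show "convex_on UNIV (\<lambda>x. 2 * c + 6 * d * x)"
    by (rule convex_onI) (auto simp: algebra_simps)
  have "\<bar>2 * c + 6 * d * x\<bar> \<le> (\<bar>2 * c\<bar> + \<bar>6 * d\<bar>) * (1 + \<bar>x\<bar>) ^ 1" for x
  proof -
    have "\<bar>2 * c + 6 * d * x\<bar> \<le> \<bar>2 * c\<bar> + \<bar>6 * d\<bar> * \<bar>x\<bar>"
      using abs_triangle_ineq[of "2 * c" "6 * d * x"] by (simp add: abs_mult)
    moreover have "0 \<le> \<bar>2 * c\<bar> * \<bar>x\<bar>" by simp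
    ultimately show ?thesis unfolding power_one_right distrib_left distrib_right by linarith
  qed
  then show "poly_bounded (\<lambda>x. 2 * c + 6 * d * x)" unfolding poly_bounded_def by blast
qed

text \<open>Negating the coefficients stays within the family, which reverses the inequality. With
  the whole polynomial under one integral, moments about any point follow by expanding a
  power.\<close>

lemma le_3convex_cubic:
  assumes "le_3convex \<mu> \<nu>"
  shows "(\<integral>x. a + b * x + c * x\<^sup>2 + d * x ^ 3 \<partial>\<mu>) = (\<integral>x. a + b * x + c * x\<^sup>2 + d * x ^ 3 \<partial>\<nu>)"
proof (rule antisym)
  have le: "(\<integral>x. a + b * x + c * x\<^sup>2 + d * x ^ 3 \<partial>\<mu>) \<le> (\<integral>x. a + b * x + c * x\<^sup>2 + d * x ^ 3 \<partial>\<nu>)" for a b c d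
    using assms test_function_cubic unfolding le_3convex_def by blast
  show "(\<integral>x. a + b * x + c * x\<^sup>2 + d * x ^ 3 \<partial>\<mu>) \<le> (\<integral>x. a + b * x + c * x\<^sup>2 + d * x ^ 3 \<partial>\<nu>)"
    by (rule le)
  have "(\<lambda>x. - a + - b * x + - c * x\<^sup>2 + - d * x ^ 3) = (\<lambda>x::real. - (a + b * x + c * x\<^sup>2 + d * x ^ 3))"
    by auto
  then show "(\<integral>x. a + b * x + c * x\<^sup>2 + d * x ^ 3 \<partial>\<nu>) \<le> (\<integral>x. a + b * x + c * x\<^sup>2 + d * x ^ 3 \<partial>\<mu>)"
    using le[of "- a" "- b" "- c" "- d"] by (simp only: Bochner_Integration.integral_minus neg_le_iff_le)
qed

section \<open>Traces and quadratic forms in an eigenbasis\<close>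

text \<open>Conjugation by the orthogonal matrix with rows \<open>u i\<close> preserves the trace,
  and the summands are the diagonal entries of the conjugate.\<close>

lemma trace_orthonormal:
  fixes u :: "'n::finite \<Rightarrow> real ^ 'n"
  assumes u: "\<And>i j. u i \<bullet> u j = (if i = j then 1 else 0)"
  shows "trace N = (\<Sum>i\<in>UNIV. u i \<bullet> (N *v u i))"
proof -
  define U where "U = (\<chi> i. u i)"
  have U: "transpose U ** U = mat 1"
    using orthogonal_matrix_orthonormal[OF u] by (simp add: U_def orthogonal_matrix_def)
  have "trace (U ** N ** transpose U) = trace (transpose U ** (U ** N))"
    by (rule trace_mul_sym)
  also have "\<dots> = trace N" by (simp add: matrix_mul_assoc U)
  finally have "trace N = trace (U ** N ** transpose U)" by simp
  also have "\<dots> = (\<Sum>i\<in>UNIV. u i \<bullet> (N *v u i))"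
    unfolding trace_def
  proof (rule sum.cong[OF refl])
    fix i
    have "(U ** N ** transpose U) $ i $ i = (U ** (N ** transpose U)) $ i $ i"
      by (simp add: matrix_mul_assoc)
    also have "\<dots> = u i \<bullet> (N *v u i)"
      by (simp add: U_def matrix_matrix_mult_def matrix_vector_mult_def transpose_def inner_vec_def)
    finally show "(U ** N ** transpose U) $ i $ i = u i \<bullet> (N *v u i)" .
  qed
  finally show ?thesis .
qed

lemma quadratic_form_eigenbasis:
  fixes u :: "'n::finite \<Rightarrow> real ^ 'n"
  assumes sym: "transpose M = M" and u: "\<And>i j. u i \<bullet> u j = (if i = j then 1 else 0)"
    and e: "\<And>i. M *v u i = e i *\<^sub>R u i"
  shows "x \<bullet> (M *v x) = (\<Sum>i\<in>UNIV. e i * (u i \<bullet> x)\<^sup>2)"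
proof -
  define U where "U = (\<chi> i. u i)"
  have "orthogonal_transformation ((*v) U)"
    using orthogonal_matrix_orthonormal[OF u] by (simp add: orthogonal_transformation_matrix U_def)
  then have "x \<bullet> (M *v x) = (U *v x) \<bullet> (U *v (M *v x))"
    by (simp add: orthogonal_transformation_def)
  also have "\<dots> = (\<Sum>i\<in>UNIV. (u i \<bullet> x) * (u i \<bullet> (M *v x)))"
    by (subst inner_vec_def) (simp add: U_def orthonormal_matrix_vector)
  also have "\<dots> = (\<Sum>i\<in>UNIV. e i * (u i \<bullet> x)\<^sup>2)"
  proof (rule sum.cong[OF refl])
    fix i
    have "u i \<bullet> (M *v x) = (M *v u i) \<bullet> x"
      using dot_lmul_matrix[of "u i" M x] sym by (metis transpose_matrix_vector)
    then show "(u i \<bullet> x) * (u i \<bullet> (M *v x)) = e i * (u i \<bullet> x)\<^sup>2"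
      by (simp add: e power2_eq_square)
  qed
  finally show ?thesis .
qed

text \<open>By symmetry the trace is the sum of the squares of all entries. This makes the
  normalisation by \<open>frobenius_norm\<close> legitimate.\<close>

lemma trace_square_pos:
  fixes M :: "real ^ 'n ^ 'n"
  assumes sym: "transpose M = M" and nz: "M \<noteq> 0"
  shows "0 < trace (M ** M)"
proof -
  have s: "M $ k $ i = M $ i $ k" for i k
    using sym by (simp add: transpose_def vec_eq_iff)
  have tr: "trace (M ** M) = (\<Sum>i\<in>UNIV. \<Sum>k\<in>UNIV. (M $ i $ k)\<^sup>2)"
    unfolding trace_def matrix_matrix_mult_def by (simp add: s power2_eq_square)
  obtain i k where "M $ i $ k \<noteq> 0" using nz by (auto simp: vec_eq_iff)
  then have "0 < (\<Sum>k\<in>UNIV. (M $ i $ k)\<^sup>2)"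
    by (intro sum_pos2[of _ k]) auto
  then show ?thesis
    unfolding tr by (rule sum_pos2[of UNIV i, rotated 2]) (simp_all add: sum_nonneg)
qed

lemma le_3convex_expectation:
  assumes W: "W \<in> borel_measurable P" and Z: "Z \<in> borel_measurable Q"
    and l: "le_3convex (distr P borel W) (distr Q borel Z)" and f: "test_function f f' f''"
  shows "integrable P (\<lambda>\<omega>. f (W \<omega>))" "integrable Q (\<lambda>\<omega>. f (Z \<omega>))"
    and "(\<integral>\<omega>. f (W \<omega>) \<partial>P) \<le> (\<integral>\<omega>. f (Z \<omega>) \<partial>Q)"
proof -
  note fm = smooth_measurable[OF test_function_smooth[OF f]]
    and fb = smooth_poly_bounded[OF test_function_smooth[OF f]]
  have m: "has_moments (distr P borel W)" and n: "has_moments (distr Q borel Z)"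
    using l by (auto simp: le_3convex_def)
  show "integrable P (\<lambda>\<omega>. f (W \<omega>))"
    using integrable_poly_bounded[OF m fm fb, of 0] fm by (simp add: integrable_distr_eq[OF W])
  show "integrable Q (\<lambda>\<omega>. f (Z \<omega>))"
    using integrable_poly_bounded[OF n fm fb, of 0] fm by (simp add: integrable_distr_eq[OF Z])
  have "(\<integral>x. f x \<partial>distr P borel W) \<le> (\<integral>x. f x \<partial>distr Q borel Z)"
    using l f by (auto simp: le_3convex_def)
  then show "(\<integral>\<omega>. f (W \<omega>) \<partial>P) \<le> (\<integral>\<omega>. f (Z \<omega>) \<partial>Q)"
    by (simp add: integral_distr[OF W fm] integral_distr[OF Z fm])
qed

lemma le_3convex_expectation_cubic:
  assumes W: "W \<in> borel_measurable P" and Z: "Z \<in> borel_measurable Q"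
    and l: "le_3convex (distr P borel W) (distr Q borel Z)"
  shows "(\<integral>\<omega>. a + b * W \<omega> + c * (W \<omega>)\<^sup>2 + d * W \<omega> ^ 3 \<partial>P)
    = (\<integral>\<omega>. a + b * Z \<omega> + c * (Z \<omega>)\<^sup>2 + d * Z \<omega> ^ 3 \<partial>Q)"
  using le_3convex_cubic[OF l, of a b c d] by (simp add: integral_distr[OF W] integral_distr[OF Z])

text \<open>The numbers \<open>l i\<close> are eigenvalues divided by the norm, so their squares sum
  to 1 and each is at most 1 in absolute value. Hence the cubes are dominated by the squares, which
  bounds \<open>d\<close>, and the shapes add up to (1 + d) / 4 and (1 - d) / 4.\<close>

lemma le_3convex_gaussian_quadratic_form:
  fixes M :: "real ^ 'n ^ 'n"
  assumes sym: "transpose M = M" and nz: "M \<noteq> 0" and P: "prob_space P"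
    and G: "distributed P lborel G (\<lambda>x. ennreal (\<Prod>i\<in>UNIV. std_normal_density (x $ i)))"
    and d: "d = trace (M ** M ** M) / frobenius_norm M ^ 3"
  shows "\<bar>d\<bar> \<le> 1"
    and "le_3convex (distr P borel (\<lambda>\<omega>. (G \<omega> \<bullet> (M *v G \<omega>) - trace M) / frobenius_norm M))
      (gam_diff ((1 + d) / 4) ((1 - d) / 4))"
proof -
  let ?F = "frobenius_norm M"
  obtain u :: "'n \<Rightarrow> real ^ 'n" and e where u: "\<And>i j. u i \<bullet> u j = (if i = j then 1 else 0)"
    and e: "\<And>i. M *v u i = e i *\<^sub>R u i"
    using symmetric_matrix_eigenbasis[OF sym] by blast
  have F: "?F > 0" "?F\<^sup>2 = trace (M ** M)"
    using trace_square_pos[OF sym nz] by (simp_all add: frobenius_norm_def)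
  have uu: "u i \<bullet> u i = 1" for i using u by simp
  have t1: "trace M = (\<Sum>i\<in>UNIV. e i)"
    by (simp add: trace_orthonormal[OF u] e uu)
  have t2: "trace (M ** M) = (\<Sum>i\<in>UNIV. (e i)\<^sup>2)"
    by (simp add: trace_orthonormal[OF u] e uu matrix_vector_mul_assoc[symmetric]
        matrix_vector_mult_scaleR power2_eq_square)
  have t3: "trace (M ** M ** M) = (\<Sum>i\<in>UNIV. e i ^ 3)"
    by (simp add: trace_orthonormal[OF u] e uu matrix_vector_mul_assoc[symmetric]
        matrix_vector_mult_scaleR power3_eq_cube mult.assoc)
  define l where "l i = e i / ?F" for i
  have s2: "(\<Sum>i\<in>UNIV. (l i)\<^sup>2) = 1"
    unfolding l_def power_divide sum_divide_distrib[symmetric] F(2) t2[symmetric]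
    using trace_square_pos[OF sym nz] by simp
  have s3: "(\<Sum>i\<in>UNIV. l i ^ 3) = d"
    by (simp add: l_def power_divide sum_divide_distrib[symmetric] d t3)
  have l1: "\<bar>l i\<bar> \<le> 1" for i
  proof -
    have "(l i)\<^sup>2 \<le> (\<Sum>i\<in>UNIV. (l i)\<^sup>2)" by (rule member_le_sum) auto
    then show ?thesis by (simp add: s2 abs_square_le_1)
  qed
  have "\<bar>d\<bar> \<le> (\<Sum>i\<in>UNIV. \<bar>l i ^ 3\<bar>)" unfolding s3[symmetric] by (rule sum_abs)
  also have "\<dots> \<le> (\<Sum>i\<in>UNIV. (l i)\<^sup>2)"
  proof (rule sum_mono)
    fix i
    have "\<bar>l i\<bar> * (l i)\<^sup>2 \<le> 1 * (l i)\<^sup>2" by (intro mult_right_mono l1) simp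
    then show "\<bar>l i ^ 3\<bar> \<le> (l i)\<^sup>2" by (simp add: power3_eq_cube power2_eq_square abs_mult)
  qed
  finally show "\<bar>d\<bar> \<le> 1" by (simp add: s2)
  have "(G \<omega> \<bullet> (M *v G \<omega>) - trace M) / ?F = (\<Sum>i\<in>UNIV. l i * ((u i \<bullet> G \<omega>)\<^sup>2 - 1))" for \<omega>
  proof -
    have "G \<omega> \<bullet> (M *v G \<omega>) - trace M = (\<Sum>i\<in>UNIV. e i * ((u i \<bullet> G \<omega>)\<^sup>2 - 1))"
      by (simp add: quadratic_form_eigenbasis[OF sym u e] t1 sum_subtractf right_diff_distrib)
    then show ?thesis by (simp add: l_def sum_divide_distrib)
  qed
  moreover have "le_3convex (distr P borel (\<lambda>\<omega>. \<Sum>i\<in>UNIV. l i * ((u i \<bullet> G \<omega>)\<^sup>2 - 1)))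
    (gam_diff (\<Sum>i\<in>UNIV. (l i)\<^sup>2 * (1 + l i) / 4) (\<Sum>i\<in>UNIV. (l i)\<^sup>2 * (1 - l i) / 4))"
    by (intro le_3convex_sum_std_normal_square P indep_vars_orthonormal_gaussian[OF P G u]
        distributed_orthonormal_gaussian[OF P G u] l1) simp_all
  moreover have "(\<Sum>i\<in>UNIV. (l i)\<^sup>2 * (1 + l i) / 4) = (1 + d) / 4"
  proof -
    have "(\<Sum>i\<in>UNIV. (l i)\<^sup>2 * (1 + l i)) = (\<Sum>i\<in>UNIV. (l i)\<^sup>2) + (\<Sum>i\<in>UNIV. l i ^ 3)"
      by (simp add: sum.distrib[symmetric] distrib_left power2_eq_square power3_eq_cube mult.assoc)
    then show ?thesis by (simp add: s2 s3 sum_divide_distrib[symmetric])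
  qed
  moreover have "(\<Sum>i\<in>UNIV. (l i)\<^sup>2 * (1 - l i) / 4) = (1 - d) / 4"
  proof -
    have "(\<Sum>i\<in>UNIV. (l i)\<^sup>2 * (1 - l i)) = (\<Sum>i\<in>UNIV. (l i)\<^sup>2) - (\<Sum>i\<in>UNIV. l i ^ 3)"
      by (simp add: sum_subtractf[symmetric] right_diff_distrib power2_eq_square power3_eq_cube mult.assoc)
    then show ?thesis by (simp add: s2 s3 sum_divide_distrib[symmetric])
  qed
  ultimately show "le_3convex (distr P borel (\<lambda>\<omega>. (G \<omega> \<bullet> (M *v G \<omega>) - trace M) / ?F))
      (gam_diff ((1 + d) / 4) ((1 - d) / 4))" by simp
qed

text \<open>The Gamma difference is represented by any independent pair with the prescribed laws on
  any probability space. Integrability is asserted alongside each inequality so that the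
  expectations are genuine values and not the default 0.\<close>

theorem corollary2p2:
  fixes M :: "real ^ 'n ^ 'n"
    and P :: "'a measure" and G :: "'a \<Rightarrow> real ^ 'n"
    and \<delta> :: real
  assumes symmetric: "transpose M = M"
    and nonzero: "M \<noteq> 0"
    and P: "prob_space P"
    and G: "distributed P lborel G (\<lambda>x. ennreal (\<Prod>i\<in>UNIV. std_normal_density (x $ i)))"
    and \<delta>: "\<delta> = trace (M ** M ** M) / frobenius_norm M ^ 3"
  shows "\<bar>\<delta>\<bar> \<le> 1 \<and>
    (\<forall>(Q :: 'b measure) A B. 
       prob_space Q \<and> prob_space.indep_var Q borel A borel B \<and>
       distr Q borel A = gamma_distribution ((1 + \<delta>) / 4) (1 / 2) \<and>
       distr Q borel B = gamma_distribution ((1 - \<delta>) / 4) (1 / 2) \<longrightarrow>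
       (let X = (\<lambda>\<omega>. G \<omega> \<bullet> (M *v G \<omega>) - trace M);
            Z = (\<lambda>\<omega>. A \<omega> - B \<omega> - \<delta>);
            Y = (\<lambda>\<omega>. frobenius_norm M * Z \<omega>)
        in
          (\<forall>f f' f'' :: real \<Rightarrow> real.
             (\<forall>x. (f has_real_derivative f' x) (at x)) \<and>
             (\<forall>x. (f' has_real_derivative f'' x) (at x)) \<and>
             continuous_on UNIV f'' \<and> convex_on UNIV f'' \<and>
             (\<exists>C>0. \<exists>m>0. \<forall>x. \<bar>f x\<bar> + \<bar>f' x\<bar> + \<bar>f'' x\<bar> \<le> C * (1 + \<bar>x\<bar> powr m)) \<longrightarrow>
             integrable P (\<lambda>\<omega>. f (X \<omega> / frobenius_norm M)) \<and>
             integrable Q (\<lambda>\<omega>. f (Z \<omega>)) \<and>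
             prob_space.expectation P (\<lambda>\<omega>. f (X \<omega> / frobenius_norm M))
               \<le> prob_space.expectation Q (\<lambda>\<omega>. f (Z \<omega>))) \<and>
          (\<forall>p\<ge>3.
             integrable P (\<lambda>\<omega>. \<bar>X \<omega>\<bar> powr p) \<and>
             integrable Q (\<lambda>\<omega>. \<bar>Z \<omega>\<bar> powr p) \<and>
             prob_space.expectation P (\<lambda>\<omega>. \<bar>X \<omega>\<bar> powr p)
               \<le> frobenius_norm M powr p * prob_space.expectation Q (\<lambda>\<omega>. \<bar>Z \<omega>\<bar> powr p)) \<and>
          prob_space.expectation Q Y = prob_space.expectation P X \<and>
          prob_space.variance Q Y = prob_space.variance P X \<and>
          prob_space.expectation Q (\<lambda>\<omega>. (Y \<omega> - prob_space.expectation Q Y) ^ 3)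
            = prob_space.expectation P (\<lambda>\<omega>. (X \<omega> - prob_space.expectation P X) ^ 3)))"
proof (intro conjI allI impI)
  show d1: "\<bar>\<delta>\<bar> \<le> 1"
    using le_3convex_gaussian_quadratic_form(1)[OF symmetric nonzero P G \<delta>] .
  fix Q :: "'b measure" and A B
  assume "prob_space Q \<and> prob_space.indep_var Q borel A borel B \<and>
       distr Q borel A = gamma_distribution ((1 + \<delta>) / 4) (1 / 2) \<and>
       distr Q borel B = gamma_distribution ((1 - \<delta>) / 4) (1 / 2)"
  then have Q: "prob_space Q" and ind: "prob_space.indep_var Q borel A borel B"
    and A: "distr Q borel A = gam ((1 + \<delta>) / 4)" and B: "distr Q borel B = gam ((1 - \<delta>) / 4)"
    by auto
  let ?F = "frobenius_norm M"
  define X where "X = (\<lambda>\<omega>. G \<omega> \<bullet> (M *v G \<omega>) - trace M)"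
  define Z where "Z = (\<lambda>\<omega>. A \<omega> - B \<omega> - \<delta>)"
  define W where "W = (\<lambda>\<omega>. X \<omega> / ?F)"
  have F: "?F > 0" using trace_square_pos[OF symmetric nonzero] by (simp add: frobenius_norm_def)
  have XW: "X \<omega> = ?F * W \<omega>" for \<omega> using F by (simp add: W_def)
  \<comment> \<open>The constant subtracted in \<open>gam_diff\<close> is exactly \<delta> for these
    shapes.\<close>
  have "2 * ((1 + \<delta>) / 4 - (1 - \<delta>) / 4) = \<delta>" by (simp add: field_simps)
  then have "distr Q borel Z = gam_diff ((1 + \<delta>) / 4) ((1 - \<delta>) / 4)"
    using distr_gam_diff[OF Q ind A B] d1 by (simp add: Z_def)
  then have le: "le_3convex (distr P borel W) (distr Q borel Z)"
    using le_3convex_gaussian_quadratic_form(2)[OF symmetric nonzero P G \<delta>] by (simp add: W_def X_def)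
  have Gm: "G \<in> borel_measurable P" using G by (auto simp: distributed_def)
  have "(\<lambda>x. x \<bullet> (M *v x)) \<in> borel_measurable borel"
    by (intro borel_measurable_continuous_onI continuous_intros)
  from measurable_compose[OF Gm this] have Wm: "W \<in> borel_measurable P"
    unfolding W_def X_def by measurable
  have Zm: "Z \<in> borel_measurable Q"
    using prob_space.indep_var_rv1[OF Q ind] prob_space.indep_var_rv2[OF Q ind]
    unfolding Z_def by measurable
  note test = le_3convex_expectation[OF Wm Zm le]
  note cubic = le_3convex_expectation_cubic[OF Wm Zm le]
  define Y where "Y = (\<lambda>\<omega>. ?F * Z \<omega>)"
  have Y_eq: "Y \<omega> = ?F * Z \<omega>" for \<omega> by (simp add: Y_def)
  have mean: "(\<integral>\<omega>. Y \<omega> \<partial>Q) = (\<integral>\<omega>. X \<omega> \<partial>P)"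
    using cubic[of 0 ?F 0 0] by (auto simp: XW Y_def)
  \<comment> \<open>Second moments agree about every point \<open>m\<close>; since the means
    coincide, \<open>m\<close> can be taken to be both of them. The third moment is treated
    alike.\<close>
  have "(\<integral>\<omega>. (Y \<omega> - m)\<^sup>2 \<partial>Q) = (\<integral>\<omega>. (X \<omega> - m)\<^sup>2 \<partial>P)" for m
  proof -
    have "(?F * z - m)\<^sup>2 = m\<^sup>2 + (- 2 * ?F * m) * z + ?F\<^sup>2 * z\<^sup>2 + 0 * z ^ 3" for z
      by (simp add: power2_eq_square algebra_simps)
    then show ?thesis unfolding XW Y_def by (simp only: cubic)
  qed
  then have var: "(\<integral>\<omega>. (Y \<omega> - (\<integral>\<omega>. Y \<omega> \<partial>Q))\<^sup>2 \<partial>Q) = (\<integral>\<omega>. (X \<omega> - (\<integral>\<omega>. X \<omega> \<partial>P))\<^sup>2 \<partial>P)"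
    unfolding mean .
  have "(\<integral>\<omega>. (Y \<omega> - m) ^ 3 \<partial>Q) = (\<integral>\<omega>. (X \<omega> - m) ^ 3 \<partial>P)" for m
  proof -
    have "(?F * z - m) ^ 3 = - (m ^ 3) + (3 * ?F * m\<^sup>2) * z + (- 3 * ?F\<^sup>2 * m) * z\<^sup>2 + ?F ^ 3 * z ^ 3" for z
      by (simp add: power2_eq_square power3_eq_cube algebra_simps)
    then show ?thesis unfolding XW Y_def by (simp only: cubic)
  qed
  then have third: "(\<integral>\<omega>. (Y \<omega> - (\<integral>\<omega>. Y \<omega> \<partial>Q)) ^ 3 \<partial>Q) = (\<integral>\<omega>. (X \<omega> - (\<integral>\<omega>. X \<omega> \<partial>P)) ^ 3 \<partial>P)"
    unfolding mean .
  have convex: "integrable P (\<lambda>\<omega>. f (X \<omega> / ?F)) \<and> integrable Q (\<lambda>\<omega>. f (Z \<omega>)) \<and>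
      (\<integral>\<omega>. f (X \<omega> / ?F) \<partial>P) \<le> (\<integral>\<omega>. f (Z \<omega>) \<partial>Q)"
    if f: "(\<forall>x. (f has_real_derivative f' x) (at x)) \<and>
        (\<forall>x. (f' has_real_derivative f'' x) (at x)) \<and>
        continuous_on UNIV f'' \<and> convex_on UNIV f'' \<and>
        (\<exists>C>0. \<exists>m>0. \<forall>x. \<bar>f x\<bar> + \<bar>f' x\<bar> + \<bar>f'' x\<bar> \<le> C * (1 + \<bar>x\<bar> powr m))" for f f' f'' :: "real \<Rightarrow> real"
  proof -
    obtain C m where "C > 0" "m > 0" and C: "\<And>x. \<bar>f x\<bar> + \<bar>f' x\<bar> + \<bar>f'' x\<bar> \<le> C * (1 + \<bar>x\<bar> powr m)"
      using f by blast
    \<comment> \<open>The real exponent \<open>m\<close> is rounded up to a natural one, and 2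
      absorbs the summand 1.\<close>
    have "\<bar>f'' x\<bar> \<le> (C * 2) * (1 + \<bar>x\<bar>) ^ nat \<lceil>m\<rceil>" for x
    proof -
      have "1 + \<bar>x\<bar> powr m \<le> 2 * (1 + \<bar>x\<bar>) ^ nat \<lceil>m\<rceil>"
        using powr_le_weight[of m x] weight_ge_1[of x "nat \<lceil>m\<rceil>"] \<open>m > 0\<close> by linarith
      then have "C * (1 + \<bar>x\<bar> powr m) \<le> C * (2 * (1 + \<bar>x\<bar>) ^ nat \<lceil>m\<rceil>)"
        using \<open>C > 0\<close> by (intro mult_left_mono) auto
      then show ?thesis using C[of x] unfolding mult.assoc by linarith
    qed
    then have "poly_bounded f''" unfolding poly_bounded_def by blast
    then have "test_function f f' f''" using f by (simp add: test_function_def)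
    from test[OF this] show ?thesis by (simp add: W_def)
  qed
  have powers: "integrable P (\<lambda>\<omega>. \<bar>X \<omega>\<bar> powr p) \<and> integrable Q (\<lambda>\<omega>. \<bar>Z \<omega>\<bar> powr p) \<and>
      (\<integral>\<omega>. \<bar>X \<omega>\<bar> powr p \<partial>P) \<le> ?F powr p * (\<integral>\<omega>. \<bar>Z \<omega>\<bar> powr p \<partial>Q)" if "p \<ge> 3" for p
  proof -
    note t = test[OF test_function_abs_powr[OF that]]
    have "\<bar>X \<omega>\<bar> powr p = ?F powr p * \<bar>W \<omega>\<bar> powr p" for \<omega>
      using F by (simp add: XW abs_mult powr_mult)
    then show ?thesis using t by (simp add: mult_left_mono)
  qed
  show "let X = (\<lambda>\<omega>. G \<omega> \<bullet> (M *v G \<omega>) - trace M);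
            Z = (\<lambda>\<omega>. A \<omega> - B \<omega> - \<delta>);
            Y = (\<lambda>\<omega>. frobenius_norm M * Z \<omega>)
        in
          (\<forall>f f' f'' :: real \<Rightarrow> real.
             (\<forall>x. (f has_real_derivative f' x) (at x)) \<and>
             (\<forall>x. (f' has_real_derivative f'' x) (at x)) \<and>
             continuous_on UNIV f'' \<and> convex_on UNIV f'' \<and>
             (\<exists>C>0. \<exists>m>0. \<forall>x. \<bar>f x\<bar> + \<bar>f' x\<bar> + \<bar>f'' x\<bar> \<le> C * (1 + \<bar>x\<bar> powr m)) \<longrightarrow>
             integrable P (\<lambda>\<omega>. f (X \<omega> / frobenius_norm M)) \<and>
             integrable Q (\<lambda>\<omega>. f (Z \<omega>)) \<and>
             prob_space.expectation P (\<lambda>\<omega>. f (X \<omega> / frobenius_norm M))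
               \<le> prob_space.expectation Q (\<lambda>\<omega>. f (Z \<omega>))) \<and>
          (\<forall>p\<ge>3.
             integrable P (\<lambda>\<omega>. \<bar>X \<omega>\<bar> powr p) \<and>
             integrable Q (\<lambda>\<omega>. \<bar>Z \<omega>\<bar> powr p) \<and>
             prob_space.expectation P (\<lambda>\<omega>. \<bar>X \<omega>\<bar> powr p)
               \<le> frobenius_norm M powr p * prob_space.expectation Q (\<lambda>\<omega>. \<bar>Z \<omega>\<bar> powr p)) \<and>
          prob_space.expectation Q Y = prob_space.expectation P X \<and>
          prob_space.variance Q Y = prob_space.variance P X \<and>
          prob_space.expectation Q (\<lambda>\<omega>. (Y \<omega> - prob_space.expectation Q Y) ^ 3)
            = prob_space.expectation P (\<lambda>\<omega>. (X \<omega> - prob_space.expectation P X) ^ 3)"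
    unfolding Let_def X_def[symmetric] Z_def[symmetric] Y_eq[symmetric]
    by (rule conjI[OF _ conjI[OF _ conjI[OF mean conjI[OF var third]]]])
      (intro allI impI, rule convex powers, assumption)+
qed

end
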